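(* Let $\mathcal{A}$ be a finite set of indices, let $a_i,b_i,c_i,t_{i,1}$ $(i\in\mathcal{A})$ be real numbers, and for $\tau=(t_{i,2})_{i\in\mathcal{A}}\in\mathbb{R}^{\#\mathcal{A}}$ let $$\Phi=\left\{f_i(x)=\begin{pmatrix} a_i & 0 \\ b_i & c_i\end{pmatrix}x+\begin{pmatrix}t_{i,1}\\t_{i,2}\end{pmatrix}\right\}_{i\in\mathcal{A}}$$ be an IFS such that $0<|a_i|<|c_i|<1/2$ for every $i\in\mathcal{A}$, $\sum_{i\in\mathcal{A}}|c_i|>1$, and the linear parts are not simultaneously diagonalisable. Furthermore, suppose that the IFS $\Phi_1=\{x\mapsto a_ix+t_{i,1}\}_{i\in\mathcal{A}}$ on $\mathbb{R}$ satisfies the strong open set condition. Denote by $s_0\in(1,2]$ the affinity dimension, given by $\sum_{i\in\mathcal{A}}|c_i||a_i|^{s_0-1}=1$. If $\sum_{i\in\mathcal{A}}|c_i|^{-1}|a_i|^{2(s_0-1)}<1$ then $0<\mathcal{H}^{s_0}(X)<\infty$ for Lebesgue-almost every $\tau=(t_{i,2})_{i\in\mathcal{A}}$, where $X$ is the attractor of $\Phi$.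
   Context: The attractor $X$ of $\Phi$ is the unique non-empty compact set $X\subset\mathbb{R}^2$ with $X=\bigcup_{i\in\mathcal{A}}f_i(X)$ (it depends on $\tau$). The standing assumption for IFSs of affinities in the paper is that the linear parts $A_i$ satisfy $\|A_i\|<1$ and $\det A_i\ne0$. Strong open set condition for $\Phi_1=\{g_i\}$: there is a non-empty bounded open set $O\subset\mathbb{R}$ with $g_i(O)\subseteq O$, $g_i(O)\cap g_j(O)=\emptyset$ for $i\ne j$, and $O$ intersects the attractor of $\Phi_1$. $\mathcal{H}^{s}$ denotes $s$-dimensional Hausdorff measure. *)

theory Defs
  imports "HOL-Analysis.Analysis"
begin

subsection \<open>Hausdorff measure\<close>

text \<open>
  The unnormalised measure, intended for \<open>s > 0\<close>: since \<open>0 powr s = 0\<close>, empty and one-point sets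
  cost nothing (so at \<open>s = 0\<close> this is not counting measure). Boundedness of the covering
  sets is required explicitly because \<^const>\<open>diameter\<close> is unspecified on unbounded sets. Finite
  covers are included by taking almost all \<open>U n\<close> empty.
\<close>

definition hausdorff_premeasure :: "real \<Rightarrow> real \<Rightarrow> 'a::metric_space set \<Rightarrow> ennreal" where
  "hausdorff_premeasure s \<delta> E =
     (INF U \<in> {U :: nat \<Rightarrow> 'a set.
                 E \<subseteq> (\<Union>n. U n) \<and> (\<forall>n. bounded (U n) \<and> diameter (U n) \<le> \<delta>)}.
        (\<Sum>n. ennreal (diameter (U n) powr s)))"

definition hausdorff_measure :: "real \<Rightarrow> 'a::metric_space set \<Rightarrow> ennreal" where
  "hausdorff_measure s E = (SUP \<delta> \<in> {0<..}. hausdorff_premeasure s \<delta> E)"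

subsection \<open>Iterated function systems\<close>

definition is_attractor :: "('i \<Rightarrow> 'a \<Rightarrow> 'a) \<Rightarrow> 'a::topological_space set \<Rightarrow> bool" where
  "is_attractor f X \<longleftrightarrow> X \<noteq> {} \<and> compact X \<and> X = (\<Union>i. f i ` X)"

text \<open>For a finite family of contractions of a Euclidean space there is exactly one such set.\<close>

definition attractor :: "('i \<Rightarrow> 'a \<Rightarrow> 'a) \<Rightarrow> 'a::topological_space set" where
  "attractor f = (THE X. is_attractor f X)"

definition strong_open_set_condition :: "('i \<Rightarrow> 'a \<Rightarrow> 'a) \<Rightarrow> 'a::metric_space set \<Rightarrow> bool" where
  "strong_open_set_condition g U \<longleftrightarrow>
     U \<noteq> {} \<and> bounded U \<and> open U \<and>
     (\<forall>i. g i ` U \<subseteq> U) \<and> (\<forall>i j. i \<noteq> j \<longrightarrow> g i ` U \<inter> g j ` U = {}) \<and>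
     U \<inter> attractor g \<noteq> {}"

definition satisfies_SOSC :: "('i \<Rightarrow> 'a \<Rightarrow> 'a::metric_space) \<Rightarrow> bool" where
  "satisfies_SOSC g \<longleftrightarrow> (\<exists>U. strong_open_set_condition g U)"

subsection \<open>Families of matrices\<close>

text \<open>The standing assumption on linear parts; the norm is the Euclidean operator norm.\<close>

definition affine_IFS_linear_parts :: "('i \<Rightarrow> real ^ 'n ^ 'n) \<Rightarrow> bool" where
  "affine_IFS_linear_parts A \<longleftrightarrow> (\<forall>i. onorm ((*v) (A i)) < 1 \<and> det (A i) \<noteq> 0)"

definition diagonal_matrix :: "real ^ 'n ^ 'n \<Rightarrow> bool" where
  "diagonal_matrix D \<longleftrightarrow> (\<forall>j k. j \<noteq> k \<longrightarrow> D $ j $ k = 0)"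

definition simultaneously_diagonalisable :: "('i \<Rightarrow> real ^ 'n ^ 'n) \<Rightarrow> bool" where
  "simultaneously_diagonalisable A \<longleftrightarrow>
     (\<exists>P :: real ^ 'n ^ 'n. invertible P \<and> (\<forall>i. diagonal_matrix (matrix_inv P ** A i ** P)))"

subsection \<open>The lower triangular systems in the plane\<close>

definition lin_part :: "('i \<Rightarrow> real) \<Rightarrow> ('i \<Rightarrow> real) \<Rightarrow> ('i \<Rightarrow> real) \<Rightarrow> 'i \<Rightarrow> real ^ 2 ^ 2" where
  "lin_part a b c i = vector [vector [a i, 0], vector [b i, c i]]"

definition planar_IFS ::
  "('i \<Rightarrow> real) \<Rightarrow> ('i \<Rightarrow> real) \<Rightarrow> ('i \<Rightarrow> real) \<Rightarrow> ('i \<Rightarrow> real) \<Rightarrow> real ^ 'i \<Rightarrow>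
   'i \<Rightarrow> real ^ 2 \<Rightarrow> real ^ 2" where
  "planar_IFS a b c t1 \<tau> i x = lin_part a b c i *v x + vector [t1 i, \<tau> $ i]"

definition line_IFS :: "('i \<Rightarrow> real) \<Rightarrow> ('i \<Rightarrow> real) \<Rightarrow> 'i \<Rightarrow> real \<Rightarrow> real" where
  "line_IFS a t1 i x = a i * x + t1 i"

end

theory Submission
  imports Defs "HOL-Library.Sublist"
begin

text \<open>
  Give a word \<open>w\<close> of length \<open>N\<close> the mass \<open>\<bar>c\<^sub>w\<bar> \<bar>a\<^sub>w\<bar>\<^sup>s\<^sup>-\<^sup>1\<close> and place it at the image of the origin.
  A square of side \<open>d\<close> meets boundedly many cylinders of width about \<open>d\<close>, by the open set condition,
  and pulling it back along such a cylinder \<open>u\<close> gives a strip of width \<open>d / \<bar>c\<^sub>u\<bar>\<close> whose slope stays in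
  a fixed compact interval. So if all strips with slopes in that interval have mass at most
  proportional to their width, then a square has mass \<open>O(d\<^sup>s)\<close>, and the mass distribution principle
  gives positivity. Finiteness comes from cutting each cylinder, which is about \<open>\<bar>a\<^sub>w\<bar>\<close> wide and
  \<open>\<bar>c\<^sub>w\<bar>\<close> high, into squares of side \<open>\<bar>a\<^sub>w\<bar>\<close>.

  The strip estimate for almost every \<open>\<tau>\<close> is a Sobolev type argument without Fourier transforms.
  Smooth the strip mass at scale \<open>r\<close> in both the offset and the slope; passing from scale \<open>2 r\<close> to \<open>r\<close>
  is a second order difference, whose square is bounded, uniformly in slope and offset, by \<open>r\<^sup>-\<^sup>2\<close>
  times a quadratic energy. Averaged over \<open>\<tau>\<close>, the contribution to the energy of two words whose
  common prefix has vertical ratio \<open>l\<close> is at most of order \<open>l\<^sup>-\<^sup>1 min 1 ((r / l)\<^sup>4)\<close>: since \<open>\<bar>c\<^sub>i\<bar> < 1 / 2\<close>, the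
  difference of their heights is an affine function of \<open>\<tau>\<close> with gradient of order \<open>l\<close>, so that both
  second differences can be moved onto a smooth cutoff in \<open>\<tau>\<close>. As \<open>\<Sum> p\<^sub>i\<^sup>2 \<bar>c\<^sub>i\<bar>\<^sup>-\<^sup>3 < 1\<close>, the exponent \<open>3\<close>
  can be increased slightly, which makes the dyadic differences summable. All measures are finite
  sums over words of length \<open>N\<close>; Fatou's lemma makes the bounds uniform along infinitely many \<open>N\<close>.
\<close>

section \<open>Hausdorff measure and attractors\<close>

lemma hausdorff_premeasure_finite_cover:
  fixes E :: "'a::metric_space set"
  assumes "finite I" "E \<subseteq> (\<Union>i\<in>I. U i)" "\<And>i. i \<in> I \<Longrightarrow> bounded (U i) \<and> diameter (U i) \<le> \<delta>" "0 \<le> \<delta>"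
  shows "hausdorff_premeasure s \<delta> E \<le> (\<Sum>i\<in>I. ennreal (diameter (U i) powr s))"
proof -
  obtain e where e: "bij_betw e {..<card I} I"
    using assms(1) by (metis bij_betw_from_nat_into_finite)
  \<comment> \<open>The cover is padded with empty sets, which cost nothing: their diameter is 0 and
    \<open>0 powr s = 0\<close>.\<close>
  define V where "V n = (if n < card I then U (e n) else {})" for n
  have eI: "e n \<in> I" if "n < card I" for n
    using e that by (auto simp: bij_betw_def)
  have "E \<subseteq> (\<Union>n. V n)"
  proof
    fix x assume "x \<in> E"
    then obtain i where i: "i \<in> I" "x \<in> U i" using assms(2) by auto
    then have "i \<in> e ` {..<card I}" using e by (simp add: bij_betw_def)
    then obtain n where "n < card I" "e n = i" by blast
    then show "x \<in> (\<Union>n. V n)" using i by (auto simp: V_def)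
  qed
  moreover have "bounded (V n) \<and> diameter (V n) \<le> \<delta>" for n
    using assms(3)[OF eI, of n] assms(4) by (auto simp: V_def)
  ultimately have "hausdorff_premeasure s \<delta> E \<le> (\<Sum>n. ennreal (diameter (V n) powr s))"
    unfolding hausdorff_premeasure_def by (intro INF_lower) auto
  also have "\<dots> = (\<Sum>n<card I. ennreal (diameter (V n) powr s))"
    by (intro suminf_finite) (auto simp: V_def)
  also have "\<dots> = (\<Sum>n<card I. ennreal (diameter (U (e n)) powr s))"
    by (intro sum.cong) (auto simp: V_def)
  also have "\<dots> = (\<Sum>i\<in>I. ennreal (diameter (U i) powr s))"
    by (rule sum.reindex_bij_betw[OF e])
  finally show ?thesis .
qed

text \<open>A point of \<open>X\<close> farthest from \<open>Y\<close> is the image of some point of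
  \<open>X\<close>. Contracting that point together with its nearest point of \<open>Y\<close> shows
  that the maximal distance is at most \<open>L\<close> times itself, hence 0.\<close>

lemma attractor_unique_subset:
  fixes f :: "'i::finite \<Rightarrow> 'a::heine_borel \<Rightarrow> 'a"
  assumes L: "0 \<le> L" "L < 1" "\<And>i x y. dist (f i x) (f i y) \<le> L * dist x y"
    and X: "is_attractor f X" and Y: "is_attractor f Y"
  shows "X \<subseteq> Y"
proof -
  have cX: "compact X" and nX: "X \<noteq> {}" and eX: "X = (\<Union>i. f i ` X)"
    and cY: "compact Y" and nY: "Y \<noteq> {}" and eY: "Y = (\<Union>i. f i ` Y)"
    using X[unfolded is_attractor_def] Y[unfolded is_attractor_def] by argo+
  have "continuous_on X (\<lambda>x. infdist x Y)" by (intro continuous_intros)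
  then obtain x where x: "x \<in> X" and mx: "\<And>x'. x' \<in> X \<Longrightarrow> infdist x' Y \<le> infdist x Y"
    using continuous_attains_sup[OF cX nX, of "\<lambda>x. infdist x Y"] by metis
  obtain i x' where x': "x' \<in> X" "x = f i x'" using equalityD1[OF eX, THEN subsetD, OF x] by (elim UN_E imageE)
  obtain y where y: "y \<in> Y" "infdist x' Y = dist x' y"
    using infdist_attains_inf[OF compact_imp_closed[OF cY] nY, of x'] by metis
  have "f i y \<in> Y" by (rule equalityD2[OF eY, THEN subsetD]) (use y(1) in blast)
  then have "infdist x Y \<le> dist x (f i y)" by (rule infdist_le)
  also have "\<dots> \<le> L * dist x' y" using L(3) x' by simp
  also have "\<dots> \<le> L * infdist x Y" using mx[OF x'(1)] y L(1) by (simp add: mult_left_mono)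
  finally have "(1 - L) * infdist x Y \<le> 0" by (simp add: algebra_simps)
  then have "infdist x Y \<le> 0" using L(2) by (simp add: mult_le_0_iff)
  then have z: "infdist x' Y = 0" if "x' \<in> X" for x'
    using mx[OF that] infdist_nonneg[of x' Y] by linarith
  show ?thesis
  proof
    fix u assume "u \<in> X"
    then show "u \<in> Y"
      using z in_closed_iff_infdist_zero[OF compact_imp_closed[OF cY] nY, of u] by simp
  qed
qed

text \<open>Some closed ball is mapped into itself; its iterated images form a decreasing sequence
  of compact sets, whose intersection is the attractor.\<close>

lemma is_attractor_exists:
  fixes f :: "'i::finite \<Rightarrow> 'a::heine_borel \<Rightarrow> 'a"
  assumes L: "0 \<le> L" "L < 1" "\<And>i x y. dist (f i x) (f i y) \<le> L * dist x y"
  shows "\<exists>X. is_attractor f X"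
proof -
  have cf: "continuous_on S (f i)" for i S
    by (rule continuous_on_subset[OF lipschitz_on_continuous_on[of L UNIV "f i"]])
       (use L in \<open>auto simp: lipschitz_on_def\<close>)
  define o' :: 'a where "o' = undefined"
  \<comment> \<open>With this choice \<open>(1 - L) * R\<close> dominates the displacement of the
    centre under every map, so that the ball of radius \<open>R\<close> is mapped into
    itself.\<close>
  define R where "R = Max (range (\<lambda>i. dist (f i o') o')) / (1 - L)"
  have R: "dist (f i o') o' \<le> (1 - L) * R" for i
    using L(2) by (simp add: R_def)
  have "0 \<le> (1 - L) * R" using R[of undefined] zero_le_dist order_trans by blast
  then have R0: "0 \<le> R" using L(2) by (simp add: zero_le_mult_iff)
  define K where "K n = ((\<lambda>S. \<Union>i. f i ` S) ^^ n) (cball o' R)" for n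
  have K0: "K 0 = cball o' R" and KS: "K (Suc n) = (\<Union>i. f i ` K n)" for n
    by (simp_all add: K_def)
  have cK: "compact (K n)" for n
    by (induction n) (auto simp: K0 KS intro!: compact_UN compact_continuous_image cf)
  have nK: "K n \<noteq> {}" for n
    by (induction n) (auto simp: K0 KS R0 not_less)
  have K10: "K (Suc 0) \<subseteq> K 0"
  proof
    fix y assume "y \<in> K (Suc 0)"
    then obtain i x where x: "dist o' x \<le> R" "y = f i x" by (auto simp: KS K0)
    have "dist o' y \<le> dist o' (f i o') + dist (f i o') (f i x)" using x by (simp add: dist_triangle)
    also have "\<dots> \<le> (1 - L) * R + L * R"
      using R[of i] L(3)[of i o' x] mult_left_mono[OF x(1) L(1)] by (simp add: dist_commute)
    finally show "y \<in> K 0" by (simp add: K0 algebra_simps)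
  qed
  have Kd1: "K (Suc n) \<subseteq> K n" for n
  proof (induction n)
    case (Suc n)
    have "K (Suc (Suc n)) = (\<Union>i. f i ` K (Suc n))" by (rule KS)
    also have "\<dots> \<subseteq> (\<Union>i. f i ` K n)" using Suc by blast
    finally show ?case by (simp add: KS)
  qed (rule K10)
  have Kd: "K n \<subseteq> K m" if "m \<le> n" for m n
    using lift_Suc_antimono_le[of K, OF Kd1 that] .
  define X where "X = (\<Inter>n. K n)"
  have "X \<noteq> {}" unfolding X_def
    using compact_nest[of K, OF cK nK Kd] .
  moreover have "compact X" unfolding X_def by (rule compact_Inter) (use cK in auto)
  moreover have "X = (\<Union>i. f i ` X)"
  proof
    show "(\<Union>i. f i ` X) \<subseteq> X"
    proof
      fix y assume "y \<in> (\<Union>i. f i ` X)"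
      then obtain i x where x: "\<And>n. x \<in> K n" "y = f i x" by (auto simp: X_def)
      have "y \<in> K (Suc n)" for n using x(1)[of n] x(2) by (auto simp: KS)
      then have "y \<in> K n" for n using Kd1[of n] by blast
      then show "y \<in> X" by (simp add: X_def)
    qed
  next
    show "X \<subseteq> (\<Union>i. f i ` X)"
    proof
      fix y assume y: "y \<in> X"
      have "\<exists>i. y \<in> f i ` K n" for n
        using y KS[of n] by (metis INT_E UNIV_I UN_E X_def)
      then obtain i where i: "\<And>n. y \<in> f (i n) ` K n" by metis
      \<comment> \<open>Pigeonhole: one index \<open>j\<close> occurs at infinitely many levels, and
        since the sets \<open>K n\<close> decrease it then serves at every level.\<close>
      have "\<exists>j. infinite {n. i n = j}"
      proof (rule ccontr)
        assume "\<nexists>j. infinite {n. i n = j}"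
        then have "finite (\<Union>j. {n. i n = j})" by simp
        moreover have "(\<Union>j. {n. i n = j}) = UNIV" by auto
        ultimately show False by simp
      qed
      then obtain j where j: "infinite {n. i n = j}" by blast
      have yj: "y \<in> f j ` K n" for n
      proof -
        obtain m where "m \<ge> n" "i m = j"
          using j unfolding infinite_nat_iff_unbounded_le by auto
        then show ?thesis using i[of m] Kd[of n m] by auto
      qed
      \<comment> \<open>The preimages of \<open>y\<close> under \<open>f j\<close> inside the sets
        \<open>K n\<close> are nested, compact and nonempty; a common point of them lies in
        \<open>X\<close>.\<close>
      have "(\<Inter>n. K n \<inter> f j -` {y}) \<noteq> {}"
      proof (rule compact_nest)
        fix n
        have "closed (f j -` {y})" using continuous_closed_vimage[of "{y}" "f j"] cf[of UNIV j]
          by (simp add: continuous_on_eq_continuous_at)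
        then show "compact (K n \<inter> f j -` {y})" using cK by (simp add: compact_Int_closed)
        show "K n \<inter> f j -` {y} \<noteq> {}" using yj[of n] by auto
      next
        fix m n :: nat assume "m \<le> n" then show "K n \<inter> f j -` {y} \<subseteq> K m \<inter> f j -` {y}"
          using Kd by blast
      qed
      then show "y \<in> (\<Union>i. f i ` X)" by (auto simp: X_def)
    qed
  qed
  ultimately have "is_attractor f X" unfolding is_attractor_def by (intro conjI)
  then show ?thesis by (rule exI)
qed

lemma is_attractor_attractor:
  fixes f :: "'i::finite \<Rightarrow> 'a::heine_borel \<Rightarrow> 'a"
  assumes L: "0 \<le> L" "L < 1" "\<And>i x y. dist (f i x) (f i y) \<le> L * dist x y"
  shows "is_attractor f (attractor f)"
  unfolding attractor_def
proof (rule theI')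
  show "\<exists>!X. is_attractor f X"
    by (rule ex_ex1I[OF is_attractor_exists[OF L]])
       (rule subset_antisym; rule attractor_unique_subset[OF L]; assumption)
qed

text \<open>After division by \<open>\<sigma>\<close> and rounding down, separated values land on
  distinct integers of an interval of length about \<open>2 * L / \<sigma>\<close>.\<close>

lemma card_separated_le:
  fixes T :: "'b set" and g :: "'b \<Rightarrow> real"
  assumes "0 < \<sigma>" "\<And>u. u \<in> T \<Longrightarrow> \<bar>g u - z\<bar> \<le> L" and L: "0 \<le> L"
    and sep: "\<And>u v. u \<in> T \<Longrightarrow> v \<in> T \<Longrightarrow> u \<noteq> v \<Longrightarrow> \<sigma> \<le> \<bar>g u - g v\<bar>"
  shows "finite T \<and> real (card T) \<le> 2 * L / \<sigma> + 3"
proof -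
  let ?k = "\<lambda>u. \<lfloor>(g u - z) / \<sigma>\<rfloor>"
  let ?S = "{\<lfloor>- (L / \<sigma>)\<rfloor>..\<lfloor>L / \<sigma>\<rfloor>}"
  have inj: "inj_on ?k T"
  proof (rule inj_onI, rule ccontr)
    fix u v assume uv: "u \<in> T" "v \<in> T" "?k u = ?k v" "u \<noteq> v"
    have "\<bar>(g u - z) / \<sigma> - (g v - z) / \<sigma>\<bar> < 1"
      using uv(3) by linarith
    then have "\<bar>(g u - g v) / \<sigma>\<bar> < 1" by (simp add: diff_divide_distrib)
    then have "\<bar>g u - g v\<bar> < \<sigma>" using assms(1) by (simp add: abs_divide)
    then show False using sep[OF uv(1,2,4)] by simp
  qed
  have sub: "?k ` T \<subseteq> ?S"
  proof
    fix n assume "n \<in> ?k ` T"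
    then obtain u where u: "u \<in> T" "n = ?k u" by auto
    have "(g u - z) / \<sigma> \<le> L / \<sigma>" "- (L / \<sigma>) \<le> (g u - z) / \<sigma>"
      using assms(2)[OF u(1)] assms(1) by (auto simp: divide_simps)
    then show "n \<in> ?S" using u(2) by (auto intro: floor_mono)
  qed
  have fin: "finite T" using inj sub finite_imageD finite_subset by blast
  have "card T \<le> card ?S" using card_inj_on_le[OF inj sub] by simp
  also have "\<dots> = nat (\<lfloor>L / \<sigma>\<rfloor> + 1 - \<lfloor>- (L / \<sigma>)\<rfloor>)" by simp
  finally have "card T \<le> nat (\<lfloor>L / \<sigma>\<rfloor> + 1 - \<lfloor>- (L / \<sigma>)\<rfloor>)" .
  moreover have "0 \<le> L/\<sigma>" using L assms(1) by simp
  ultimately have "real (card T) \<le> L / \<sigma> + 1 + (L/\<sigma> + 1)" by linarith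
  then show ?thesis using fin by simp
qed

lemma sum_UN_le:
  fixes f :: "'k \<Rightarrow> real"
  assumes "finite I" "\<And>n. n \<in> I \<Longrightarrow> finite (W n)" "\<And>w. 0 \<le> f w"
  shows "sum f (\<Union>n\<in>I. W n) \<le> (\<Sum>n\<in>I. sum f (W n))"
  using assms(1,2)
proof (induction I)
  case (insert n I)
  have "sum f (\<Union>n\<in>insert n I. W n) = sum f (W n \<union> (\<Union>n\<in>I. W n))" by simp
  also have "\<dots> \<le> sum f (W n) + sum f (\<Union>n\<in>I. W n)"
    using insert by (subst sum.union_inter[symmetric]) (auto intro!: sum_nonneg assms(3))
  finally show ?case using insert by simp
qed simp

section \<open>The hat kernel and a smooth bump\<close>

text \<open>For \<open>r > 0\<close> this is the triangle of unit mass supported on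
  \<open>[- 2 * r, 2 * r]\<close>, that is, the convolution of the uniform density on
  \<open>[- r, r]\<close> with itself.\<close>

definition hat :: "real \<Rightarrow> real \<Rightarrow> real" where
  "hat r s = max 0 (2 * r - \<bar>s\<bar>) / (4 * r\<^sup>2)"

lemma hat_nonneg: "0 \<le> hat r s"
  by (simp add: hat_def)

lemma hat_le: "0 < r \<Longrightarrow> hat r s \<le> 1 / (2 * r)"
  by (simp add: hat_def field_simps power2_eq_square max_def mult_nonneg_nonneg)

lemma hat_ge: "0 < r \<Longrightarrow> \<bar>s\<bar> \<le> r \<Longrightarrow> 1 / (4 * r) \<le> hat r s"
  by (simp add: hat_def field_simps power2_eq_square max_def)

lemma hat_support: "2 * r \<le> \<bar>s\<bar> \<Longrightarrow> hat r s = 0"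
  by (simp add: hat_def max_def)

lemma continuous_on_hat [continuous_intros]:
  "continuous_on S f \<Longrightarrow> continuous_on S (\<lambda>x. hat r (f x))"
  unfolding hat_def by (cases "r = 0") (auto intro!: continuous_intros)

lemma hat_measurable [measurable]: "hat r \<in> borel_measurable borel"
  by (intro borel_measurable_continuous_onI continuous_intros)

text \<open>The two-scale relation of the linear B-spline. It turns a change of scale into a second
  order difference at a single scale.\<close>

lemma hat_double:
  assumes "0 < r"
  shows "hat (2 * r) s = (hat r (s - 2 * r) + 2 * hat r s + hat r (s + 2 * r)) / 4"
proof -
  have "max 0 (2 * (2 * r) - \<bar>s\<bar>) = max 0 (2 * r - \<bar>s - 2 * r\<bar>) + 2 * max 0 (2 * r - \<bar>s\<bar>) + max 0 (2 * r - \<bar>s + 2 * r\<bar>)"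
    using assms by (auto simp: max_def abs_if)
  then have "max 0 (2 * (2 * r) - \<bar>s\<bar>) / (4 * (2 * r)\<^sup>2)
    = (max 0 (2 * r - \<bar>s - 2 * r\<bar>) + 2 * max 0 (2 * r - \<bar>s\<bar>) + max 0 (2 * r - \<bar>s + 2 * r\<bar>)) / (4 * (2 * r)\<^sup>2)"
    by (rule arg_cong)
  also have "\<dots> = (hat r (s - 2 * r) + 2 * hat r s + hat r (s + 2 * r)) / 4"
    unfolding hat_def by (simp only: power_mult_distrib add_divide_distrib) (simp add: field_simps)
  finally show ?thesis by (simp only: hat_def)
qed

lemma integrable_box_prod:
  fixes \<alpha> \<beta> r :: real
  shows
  "integrable lborel (\<lambda>t. indicat_real {\<alpha> - r..\<alpha> + r} t * indicat_real {\<beta> - r..\<beta> + r} t)"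
  unfolding indicator_inter_arith[symmetric] Int_atLeastAtMost
  by (rule integrable_real_indicator) (auto simp: Int_atLeastAtMost emeasure_lborel_Icc_eq)

lemma hat_eq_integral:
  assumes "0 < r"
  shows "hat r (\<alpha> - \<beta>) =
    (\<integral>t. indicat_real {\<alpha> - r..\<alpha> + r} t * indicat_real {\<beta> - r..\<beta> + r} t \<partial>lborel) / (4 * r\<^sup>2)"
proof -
  have "(\<integral>t. indicat_real {\<alpha> - r..\<alpha> + r} t * indicat_real {\<beta> - r..\<beta> + r} t \<partial>lborel)
     = measure lborel {max (\<alpha> - r) (\<beta> - r)..min (\<alpha> + r) (\<beta> + r)}"
    by (simp add: indicator_inter_arith[symmetric] Int_atLeastAtMost max_def min_def)
  also have "\<dots> = max 0 (2 * r - \<bar>\<alpha> - \<beta>\<bar>)"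
    using assms by (simp add: max_def min_def measure_def)
  finally show ?thesis by (simp add: hat_def)
qed

text \<open>The hat is the correlation of an indicator with itself, hence a Gram kernel;
  this is the Cauchy-Schwarz inequality in \<open>L\<^sup>2\<close>.\<close>

lemma hat_gram:
  fixes q \<alpha> :: "'k \<Rightarrow> real"
  assumes "0 < r" "finite K"
  shows "(\<Sum>k\<in>K. q k * hat r (\<alpha> k - z))\<^sup>2
    \<le> (\<Sum>k\<in>K. \<Sum>l\<in>K. q k * q l * hat r (\<alpha> k - \<alpha> l)) / (2 * r)"
proof -
  define B where "B \<beta> t = indicat_real {\<beta> - r..\<beta> + r} t" for \<beta> t
  have int: "integrable lborel (\<lambda>t. B \<beta> t * B \<gamma> t)" for \<beta> \<gamma>
    unfolding B_def by (rule integrable_box_prod)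
  have hat: "(\<integral>t. B \<beta> t * B \<gamma> t \<partial>lborel) = 4 * r\<^sup>2 * hat r (\<beta> - \<gamma>)" for \<beta> \<gamma>
    using hat_eq_integral[OF assms(1), of \<beta> \<gamma>] assms(1) by (simp add: B_def)
  define S where "S = (\<Sum>k\<in>K. q k * hat r (\<alpha> k - z))"
  define E where "E = (\<Sum>k\<in>K. \<Sum>l\<in>K. q k * q l * hat r (\<alpha> k - \<alpha> l))"
  \<comment> \<open>This value minimises the quadratic polynomial
    \<open>E - 2 * c * S + c\<^sup>2 / (2 * r)\<close>, whose nonnegativity is obtained
    below.\<close>
  define c where "c = 2 * r * S"
  have exp: "((\<Sum>k\<in>K. q k * B (\<alpha> k) t) - c * B z t)\<^sup>2
     = (\<Sum>k\<in>K. \<Sum>l\<in>K. q k * q l * (B (\<alpha> k) t * B (\<alpha> l) t))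
       - 2 * c * (\<Sum>k\<in>K. q k * (B (\<alpha> k) t * B z t)) + c\<^sup>2 * (B z t * B z t)" for t
    unfolding power2_diff
    by (simp add: power2_eq_square sum_product sum_distrib_left sum_distrib_right mult_ac)
  have "0 \<le> (\<integral>t. ((\<Sum>k\<in>K. q k * B (\<alpha> k) t) - c * B z t)\<^sup>2 \<partial>lborel)" by simp
  also have "\<dots> = (\<Sum>k\<in>K. \<Sum>l\<in>K. q k * q l * (4 * r\<^sup>2 * hat r (\<alpha> k - \<alpha> l)))
     - 2 * c * (\<Sum>k\<in>K. q k * (4 * r\<^sup>2 * hat r (\<alpha> k - z))) + c\<^sup>2 * (4 * r\<^sup>2 * hat r (z - z))"
    unfolding exp by (simp add: int hat)
  also have "\<dots> = 4 * r\<^sup>2 * (E - 2 * c * S + c\<^sup>2 * hat r 0)"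
    by (simp add: E_def S_def algebra_simps sum_distrib_left)
  finally have "0 \<le> E - 2 * c * S + c\<^sup>2 * hat r 0" 
    using assms(1) by (simp add: zero_le_mult_iff)
  moreover have "hat r 0 = 1 / (2 * r)" using assms(1) by (simp add: hat_def power2_eq_square)
  ultimately have "0 \<le> E - 2 * r * S\<^sup>2"
    using assms(1) by (simp add: c_def power2_eq_square mult_ac)
  then show ?thesis using assms(1) by (simp add: E_def S_def field_simps)
qed

text \<open>The vanishing moments of order 0 and 1 remove the linear Taylor polynomial of
  \<open>f\<close> at \<open>s\<close>, so only the second order remainders contribute.\<close>

lemma second_order_difference_bound:
  fixes f f' f'' :: "real \<Rightarrow> real" and \<kappa> g :: "'m \<Rightarrow> real"
  assumes d1: "\<And>s. (f has_real_derivative f' s) (at s)"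
    and d2: "\<And>s. (f' has_real_derivative f'' s) (at s)" and B: "\<And>s. \<bar>f'' s\<bar> \<le> B"
    and M: "finite M" "(\<Sum>m\<in>M. \<kappa> m) = 0" "(\<Sum>m\<in>M. \<kappa> m * g m) = 0" "\<And>m. m \<in> M \<Longrightarrow> \<bar>g m\<bar> \<le> G"
  shows "\<bar>\<Sum>m\<in>M. \<kappa> m * f (s + g m)\<bar> \<le> (\<Sum>m\<in>M. \<bar>\<kappa> m\<bar>) * (B * G\<^sup>2 / 2)"
proof -
  have tay: "\<bar>f (s + h) - f s - h * f' s\<bar> \<le> B * h\<^sup>2 / 2" for h
  proof (cases "h = 0")
    case False
    define dd where "dd = (\<lambda>n::nat. if n = 0 then f else if n = 1 then f' else f'')"
    have "\<exists>t. (if s + h < s then s + h < t \<and> t < s else s < t \<and> t < s + h) \<and>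
        f (s + h) = (\<Sum>m<2. dd m s / fact m * (s + h - s) ^ m) + dd 2 t / fact 2 * (s + h - s)\<^sup>2"
      by (rule Taylor[where a = "min s (s + h)" and b = "max s (s + h)"])
         (use False d1 d2 in \<open>auto simp: dd_def less_Suc_eq numeral_2_eq_2\<close>)
    then obtain t where "f (s + h) = f s + f' s * h + f'' t / 2 * h\<^sup>2"
      by (auto simp: dd_def numeral_2_eq_2)
    then have "\<bar>f (s + h) - f s - h * f' s\<bar> = \<bar>f'' t\<bar> * h\<^sup>2 / 2"
      by (simp add: abs_mult)
    also have "\<dots> \<le> B * h\<^sup>2 / 2" using B[of t] by (simp add: mult_right_mono)
    finally show ?thesis .
  qed simp
  have B0: "0 \<le> B" using B[of 0] by linarith
  have "(\<Sum>m\<in>M. \<kappa> m * f (s + g m))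
     = (\<Sum>m\<in>M. \<kappa> m * (f (s + g m) - f s - g m * f' s)) + f s * (\<Sum>m\<in>M. \<kappa> m) + f' s * (\<Sum>m\<in>M. \<kappa> m * g m)"
    by (simp add: algebra_simps sum.distrib sum_distrib_left sum_subtractf)
  also have "\<dots> = (\<Sum>m\<in>M. \<kappa> m * (f (s + g m) - f s - g m * f' s))" using M by simp
  also have "\<bar>\<dots>\<bar> \<le> (\<Sum>m\<in>M. \<bar>\<kappa> m\<bar> * (B * G\<^sup>2 / 2))"
  proof (rule order_trans[OF sum_abs sum_mono])
    fix m assume m: "m \<in> M"
    have "(g m)\<^sup>2 \<le> G\<^sup>2" using M(4)[OF m] by (simp add: abs_le_square_iff[symmetric])
    then have "\<bar>f (s + g m) - f s - g m * f' s\<bar> \<le> B * G\<^sup>2 / 2"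
      using tay[of "g m"] mult_left_mono[of "(g m)\<^sup>2" "G\<^sup>2" B] B0 by linarith
    then show "\<bar>\<kappa> m * (f (s + g m) - f s - g m * f' s)\<bar> \<le> \<bar>\<kappa> m\<bar> * (B * G\<^sup>2 / 2)"
      by (simp only: abs_mult mult_left_mono abs_ge_zero)
  qed
  finally show ?thesis by (simp only: sum_distrib_right)
qed

text \<open>The exponent 5 gives four continuous derivatives across the endpoints, as many as two
  second order differences consume.\<close>

definition bump :: "real \<Rightarrow> real" where "bump s = max 0 (1 - s\<^sup>2) ^ 5"

text \<open>With an exponent of at least 2 the kink of \<open>max 0 x\<close> at 0 disappears: the
  difference quotient there is at most \<open>\<bar>h\<bar> ^ Suc n\<close>.\<close>

lemma DERIV_max0_power:
  "((\<lambda>x. max 0 x ^ Suc (Suc n)) has_real_derivative real (Suc (Suc n)) * max 0 x ^ Suc n) (at x)"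
proof -
  consider "x > 0" | "x < 0" | "x = 0" by linarith
  then show ?thesis
  proof cases
    case 1
    have "((\<lambda>x. x ^ Suc (Suc n)) has_real_derivative real (Suc (Suc n)) * x ^ Suc n) (at x)"
      using DERIV_pow[of "Suc (Suc n)" x UNIV] by simp
    then have "((\<lambda>x. max 0 x ^ Suc (Suc n)) has_real_derivative real (Suc (Suc n)) * x ^ Suc n) (at x)"
      by (rule has_field_derivative_transform_within_open[of _ _ _ "{0<..}"]) (use 1 in auto)
    then show ?thesis using 1 by simp
  next
    case 2
    have "((\<lambda>x. 0) has_real_derivative 0) (at x)" by simp
    then have "((\<lambda>x. max 0 x ^ Suc (Suc n)) has_real_derivative 0) (at x)"
      by (rule has_field_derivative_transform_within_open[of _ _ _ "{..<0}"]) (use 2 in auto)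
    then show ?thesis using 2 by simp
  next
    case 3
    have "((\<lambda>h::real. max 0 h ^ Suc (Suc n) / h) \<longlongrightarrow> 0) (at 0)"
    proof (rule tendsto_0_le[where K = 1])
      show "\<forall>\<^sub>F h::real in at 0. norm (max 0 h ^ Suc (Suc n) / h) \<le> norm (\<bar>h\<bar> ^ Suc n) * 1"
        by (rule always_eventually) (auto simp: max_def abs_mult power_abs intro: mult_nonpos_nonneg)
      have "((\<lambda>h::real. \<bar>h\<bar> ^ Suc n) \<longlongrightarrow> \<bar>0\<bar> ^ Suc n) (at 0)" by (intro tendsto_intros)
      then show "((\<lambda>h::real. \<bar>h\<bar> ^ Suc n) \<longlongrightarrow> 0) (at 0)" by simp
    qed
    then show ?thesis using 3 by (simp add: has_field_derivative_iff)
  qed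
qed

text \<open>\<open>second_order_difference_bound\<close> is used twice: on the second derivative of
  the bump, and then on the differenced bump \<open>u\<close>, whose second derivative
  \<open>u2\<close> has been bounded by the first use.\<close>

lemma bump_second_order_bound:
  fixes \<kappa> g g' :: "'m \<Rightarrow> real"
  assumes M: "finite M" "(\<Sum>m\<in>M. \<kappa> m) = 0" "(\<Sum>m\<in>M. \<bar>\<kappa> m\<bar>) \<le> 2"
    and g: "(\<Sum>m\<in>M. \<kappa> m * g m) = 0" "\<And>m. m \<in> M \<Longrightarrow> \<bar>g m\<bar> \<le> G"
    and g': "(\<Sum>m\<in>M. \<kappa> m * g' m) = 0" "\<And>m. m \<in> M \<Longrightarrow> \<bar>g' m\<bar> \<le> G'"
  shows "\<bar>\<Sum>m\<in>M. \<Sum>m'\<in>M. \<kappa> m * \<kappa> m' * bump (s + g m + g' m')\<bar> \<le> 5040 * G\<^sup>2 * G'\<^sup>2"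
proof -
  define p where "p s = max 0 (1 - s\<^sup>2)" for s :: real
  have pw: "((\<lambda>s. p s ^ Suc (Suc n)) has_real_derivative real (Suc (Suc n)) * p s ^ Suc n * (- 2 * s)) (at s)" for n s
    unfolding p_def
    by (rule DERIV_chain2[OF DERIV_max0_power]) (auto intro!: derivative_eq_intros)
  have p5: "((\<lambda>s. p s ^ 5) has_real_derivative 5 * p s ^ 4 * (- 2 * s)) (at s)"
    and p4: "((\<lambda>s. p s ^ 4) has_real_derivative 4 * p s ^ 3 * (- 2 * s)) (at s)"
    and p3: "((\<lambda>s. p s ^ 3) has_real_derivative 3 * p s ^ 2 * (- 2 * s)) (at s)"
    and p2: "((\<lambda>s. p s ^ 2) has_real_derivative 2 * p s * (- 2 * s)) (at s)" for s
    using pw[of 3 s] pw[of 2 s] pw[of 1 s] pw[of 0 s] by (simp_all add: eval_nat_numeral)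
  define f1 where "f1 s = - 10 * s * p s ^ 4" for s
  define f2 where "f2 s = 80 * s\<^sup>2 * p s ^ 3 - 10 * p s ^ 4" for s
  define f3 where "f3 s = 240 * s * p s ^ 3 - 480 * s ^ 3 * p s ^ 2" for s
  define f4 where "f4 s = 240 * p s ^ 3 - 2880 * s\<^sup>2 * p s ^ 2 + 1920 * s ^ 4 * p s" for s
  have d1: "(bump has_real_derivative f1 s) (at s)" for s
    using p5[of s] by (simp add: f1_def bump_def[abs_def] p_def[symmetric] mult_ac)
  have d2: "(f1 has_real_derivative f2 s) (at s)" for s
    unfolding f1_def[abs_def] f2_def
    by (rule derivative_eq_intros p4 refl)+ (simp add: algebra_simps eval_nat_numeral)
  have d3: "(f2 has_real_derivative f3 s) (at s)" for s
    unfolding f2_def[abs_def] f3_def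
    by (rule derivative_eq_intros p4 p3 refl)+ (simp add: algebra_simps eval_nat_numeral)
  have d4: "(f3 has_real_derivative f4 s) (at s)" for s
    unfolding f3_def[abs_def] f4_def
    by (rule derivative_eq_intros p3 p2 refl)+ (simp add: algebra_simps eval_nat_numeral)
  \<comment> \<open>\<open>5040 = 240 + 2880 + 1920\<close> is the sum of the absolute coefficients
    of \<open>f4\<close>; the products they multiply are at most 1 on \<open>[-1, 1]\<close>, and
    outside that interval \<open>p\<close> vanishes.\<close>
  have f4: "\<bar>f4 s\<bar> \<le> 5040" for s
  proof (cases "\<bar>s\<bar> \<le> 1")
    case True
    then have s: "s\<^sup>2 \<le> 1" by (simp add: abs_square_le_1)
    then have p: "0 \<le> p s" "p s \<le> 1" by (auto simp: p_def)
    have s4: "s ^ 4 = (s\<^sup>2)\<^sup>2" by simp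
    have a: "0 \<le> p s ^ 3" "p s ^ 3 \<le> 1" using p by (auto intro: power_le_one)
    have b: "0 \<le> s\<^sup>2 * p s ^ 2" "s\<^sup>2 * p s ^ 2 \<le> 1" using p s by (auto intro: mult_le_one power_le_one)
    have "s ^ 4 \<le> 1" unfolding s4 by (rule power_le_one) (use s in auto)
    then have c: "0 \<le> s ^ 4 * p s" "s ^ 4 * p s \<le> 1" using p by (auto intro: mult_le_one)
    show ?thesis using a b c unfolding f4_def by linarith
  next
    case False
    then have "1 < s\<^sup>2" by (metis abs_square_le_1 not_le)
    then have "p s = 0" by (simp add: p_def)
    then show ?thesis by (simp add: f4_def)
  qed
  define k where "k = (\<Sum>m\<in>M. \<bar>\<kappa> m\<bar>)"
  have k: "0 \<le> k" "k \<le> 2" using M by (auto simp: k_def intro: sum_nonneg)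
  define u u1 u2 where "u s = (\<Sum>m\<in>M. \<kappa> m * bump (s + g m))"
    and "u1 s = (\<Sum>m\<in>M. \<kappa> m * f1 (s + g m))" and "u2 s = (\<Sum>m\<in>M. \<kappa> m * f2 (s + g m))" for s
  have du: "(u has_real_derivative u1 s) (at s)" for s
    unfolding u_def[abs_def] u1_def
    by (auto intro!: derivative_eq_intros DERIV_chain2[OF d1] sum.cong)
  have du1: "(u1 has_real_derivative u2 s) (at s)" for s
    unfolding u1_def[abs_def] u2_def
    by (auto intro!: derivative_eq_intros DERIV_chain2[OF d2] sum.cong)
  have u2: "\<bar>u2 s\<bar> \<le> k * (5040 * G\<^sup>2 / 2)" for s
    unfolding u2_def k_def by (rule second_order_difference_bound[OF d3 d4 f4 M(1,2) g])
  have "(\<Sum>m\<in>M. \<Sum>m'\<in>M. \<kappa> m * \<kappa> m' * bump (s + g m + g' m')) = (\<Sum>m'\<in>M. \<kappa> m' * u (s + g' m'))"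
    unfolding u_def by (subst sum.swap) (simp add: sum_distrib_left algebra_simps)
  also have "\<bar>\<dots>\<bar> \<le> k * (k * (5040 * G\<^sup>2 / 2) * G'\<^sup>2 / 2)"
    unfolding k_def[of] by (rule second_order_difference_bound[OF du du1 u2[unfolded k_def] M(1,2) g'])
  also have "\<dots> = (k * k) * (1260 * G\<^sup>2 * G'\<^sup>2)" by simp
  also have "\<dots> \<le> (2 * 2) * (1260 * G\<^sup>2 * G'\<^sup>2)"
    using k by (intro mult_right_mono mult_mono) auto
  finally show ?thesis by simp
qed

lemma bump_bounds: "0 \<le> bump s" "bump s \<le> 1" "1 \<le> \<bar>s\<bar> \<Longrightarrow> bump s = 0" "\<bar>s\<bar> < 1 \<Longrightarrow> 0 < bump s"
proof -
  show "0 \<le> bump s" "bump s \<le> 1" by (auto simp: bump_def intro: power_le_one)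
  show "bump s = 0" if "1 \<le> \<bar>s\<bar>"
    using that by (simp add: bump_def max_def) (metis abs_square_le_1 abs_le_square_iff abs_one one_power2 order_antisym)
  show "0 < bump s" if "\<bar>s\<bar> < 1"
    using that by (simp add: bump_def abs_square_less_1)
qed

lemma continuous_on_bump [continuous_intros]:
  "continuous_on S f \<Longrightarrow> continuous_on S (\<lambda>x. bump (f x))"
  unfolding bump_def by (intro continuous_intros)

section \<open>Averaging over translation vectors\<close>

definition cube :: "real \<Rightarrow> (real ^ 'n) set" where
  "cube R = {\<tau>. \<forall>j. \<bar>\<tau> $ j\<bar> \<le> R}"

lemma cube_eq_cbox: "cube R = cbox (\<chi> j. - R) (\<chi> j. R)"
  by (auto simp: cube_def mem_box_cart abs_le_iff minus_le_iff)

lemma cube_measurable [measurable]: "cube R \<in> sets borel"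
  by (simp add: cube_eq_cbox)

lemma emeasure_cube:
  "emeasure lborel (cube R :: (real ^ 'n) set) = ennreal (measure lborel (cube R :: (real ^ 'n) set))"
  unfolding cube_eq_cbox
  by (rule emeasure_eq_ennreal_measure) (use emeasure_lborel_cbox_finite in \<open>auto simp: less_top[symmetric]\<close>)

lemma cube_fmeasurable: "cube R \<in> fmeasurable lborel"
  by (simp add: cube_eq_cbox)

lemma nn_integral_lborel_translate:
  fixes f :: "'a::euclidean_space \<Rightarrow> ennreal"
  assumes [measurable]: "f \<in> borel_measurable borel"
  shows "(\<integral>\<^sup>+ x. f (v + x) \<partial>lborel) = (\<integral>\<^sup>+ x. f x \<partial>lborel)"
proof -
  have "(\<integral>\<^sup>+ x. f x \<partial>lborel) = (\<integral>\<^sup>+ x. f x \<partial>(distr lborel borel ((+) v)))"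
    by (simp only: lborel_distr_plus)
  also have "\<dots> = (\<integral>\<^sup>+ x. f (v + x) \<partial>lborel)" by (simp add: nn_integral_distr)
  finally show ?thesis by simp
qed

lemma integral_lborel_translate:
  fixes f :: "'a::euclidean_space \<Rightarrow> real"
  assumes [measurable]: "f \<in> borel_measurable borel"
  shows "(\<integral> x. f (v + x) \<partial>lborel) = (\<integral> x. f x \<partial>lborel)"
proof -
  have "(\<integral> x. f x \<partial>lborel) = (\<integral> x. f x \<partial>(distr lborel borel ((+) v)))"
    by (simp only: lborel_distr_plus)
  also have "\<dots> = (\<integral> x. f (v + x) \<partial>lborel)" by (simp add: integral_distr)
  finally show ?thesis by simp
qed

lemma nn_integral_hat_affine:
  assumes "0 < r" "d \<noteq> 0"
  shows "(\<integral>\<^sup>+ s. ennreal (hat r (\<beta> + d * s)) \<partial>lborel) \<le> ennreal (2 / \<bar>d\<bar>)"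
proof -
  have "(\<integral>\<^sup>+ s. ennreal (hat r s) \<partial>lborel) = ennreal \<bar>d\<bar> * (\<integral>\<^sup>+ s. ennreal (hat r (\<beta> + d * s)) \<partial>lborel)"
    by (rule nn_integral_real_affine) (use assms in auto)
  moreover have "(\<integral>\<^sup>+ s. ennreal (hat r s) \<partial>lborel) \<le> (\<integral>\<^sup>+ s. ennreal (1 / (2 * r)) * indicator {- 2 * r..2 * r} s \<partial>lborel)"
    using hat_le[OF assms(1)] hat_support[of r]
    by (intro nn_integral_mono) (auto simp: indicator_def not_le abs_if intro!: ennreal_leI split: if_splits)
  moreover have "(\<integral>\<^sup>+ s. ennreal (1 / (2 * r)) * indicator {- 2 * r..2 * r} s \<partial>lborel) = ennreal 2"
    using assms(1) by (simp add: nn_integral_cmult_indicator ennreal_mult'[symmetric])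
  ultimately have *: "ennreal \<bar>d\<bar> * (\<integral>\<^sup>+ s. ennreal (hat r (\<beta> + d * s)) \<partial>lborel) \<le> ennreal 2" by simp
  have "(\<integral>\<^sup>+ s. ennreal (hat r (\<beta> + d * s)) \<partial>lborel)
     = ennreal (1 / \<bar>d\<bar>) * (ennreal \<bar>d\<bar> * (\<integral>\<^sup>+ s. ennreal (hat r (\<beta> + d * s)) \<partial>lborel))"
    using assms(2) by (simp add: mult.assoc[symmetric] ennreal_mult'[symmetric])
  also have "\<dots> \<le> ennreal (1 / \<bar>d\<bar>) * ennreal 2" by (intro mult_left_mono *) simp
  also have "\<dots> = ennreal (2 / \<bar>d\<bar>)" by (subst ennreal_mult'[symmetric]) auto
  finally show ?thesis .
qed

text \<open>Instead of slicing \<open>\<real>\<^sup>n\<close> along the \<open>k\<close>-th coordinate, average over translations in that direction.\<close>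

lemma hat_nonconcentration:
  fixes D :: "real ^ 'n"
  assumes "0 < r" "D $ k \<noteq> 0" "0 \<le> R"
  shows "(\<integral>\<^sup>+ \<tau>. indicator (cube R) \<tau> * ennreal (hat r (D \<bullet> \<tau> + \<beta>)) \<partial>lborel)
    \<le> ennreal (2 / \<bar>D $ k\<bar> * measure lborel (cube (R + 1) :: (real ^ 'n) set))"
    (is "?I \<le> _")
proof -
  define F :: "real ^ 'n \<Rightarrow> ennreal" where "F \<tau> = indicator (cube R) \<tau> * ennreal (hat r (D \<bullet> \<tau> + \<beta>))" for \<tau>
  have [measurable]: "F \<in> borel_measurable borel" unfolding F_def by measurable
  define e where "e = (axis k 1 :: real ^ 'n)"
  have De: "D \<bullet> (s *\<^sub>R e + \<tau>) = D $ k * s + D \<bullet> \<tau>" for s \<tau>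
    by (simp add: e_def inner_right_distrib inner_axis)
  have "?I = (\<integral>\<^sup>+ s. indicator {0..1::real} s * ?I \<partial>lborel)"
    by (simp add: nn_integral_multc)
  also have "\<dots> = (\<integral>\<^sup>+ s. (\<integral>\<^sup>+ \<tau>. indicator {0..1::real} s * F (s *\<^sub>R e + \<tau>) \<partial>lborel) \<partial>lborel)"
    unfolding F_def[symmetric]
    by (intro nn_integral_cong) (simp add: nn_integral_cmult nn_integral_lborel_translate)
  also have "\<dots> = (\<integral>\<^sup>+ \<tau>. (\<integral>\<^sup>+ s. indicator {0..1::real} s * F (s *\<^sub>R e + \<tau>) \<partial>lborel) \<partial>lborel)"
    by (rule lborel_pair.Fubini') measurable
  \<comment> \<open>Shifting one coordinate by at most 1 keeps the point inside the cube of
    half-side \<open>R + 1\<close>. The enlarged indicator no longer depends on \<open>s\<close>, so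
    the inner integral may run over the whole line.\<close>
  also have "\<dots> \<le> (\<integral>\<^sup>+ \<tau>. (\<integral>\<^sup>+ s. indicator (cube (R + 1)) \<tau> * ennreal (hat r ((D \<bullet> \<tau> + \<beta>) + D $ k * s)) \<partial>lborel) \<partial>lborel)"
  proof (intro nn_integral_mono)
    fix \<tau> :: "real ^ 'n" and s :: real
    show "indicator {0..1::real} s * F (s *\<^sub>R e + \<tau>) \<le> indicator (cube (R + 1)) \<tau> * ennreal (hat r ((D \<bullet> \<tau> + \<beta>) + D $ k * s))"
    proof (cases "s \<in> {0..1} \<and> s *\<^sub>R e + \<tau> \<in> cube R")
      case True
      then have "\<bar>\<tau> $ j\<bar> \<le> R + 1" for j
      proof -
        have "\<bar>s * (e $ j) + \<tau> $ j\<bar> \<le> R" using True by (auto simp: cube_def)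
        moreover have "\<bar>s * (e $ j)\<bar> \<le> 1" using True by (auto simp: e_def axis_def)
        ultimately show ?thesis by linarith
      qed
      then have "\<tau> \<in> cube (R + 1)" by (simp add: cube_def)
      moreover have "D \<bullet> (\<tau> + s *\<^sub>R e) + \<beta> = (D \<bullet> \<tau> + \<beta>) + D $ k * s" using De[of s \<tau>] by (simp add: add_ac)
      ultimately show ?thesis using True by (simp add: F_def add_ac)
    next
      case False
      then have "indicator {0..1::real} s * F (s *\<^sub>R e + \<tau>) = 0" by (auto simp: F_def indicator_def)
      then show ?thesis by (simp only: zero_le)
    qed
  qed
  also have "\<dots> = (\<integral>\<^sup>+ \<tau>. indicator (cube (R + 1)) \<tau> * (\<integral>\<^sup>+ s. ennreal (hat r ((D \<bullet> \<tau> + \<beta>) + D $ k * s)) \<partial>lborel) \<partial>lborel)"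
    by (intro nn_integral_cong nn_integral_cmult) measurable
  also have "\<dots> \<le> (\<integral>\<^sup>+ \<tau>. indicator (cube (R + 1) :: (real ^ 'n) set) \<tau> * ennreal (2 / \<bar>D $ k\<bar>) \<partial>lborel)"
    by (intro nn_integral_mono mult_left_mono nn_integral_hat_affine assms) simp
  also have "\<dots> = emeasure lborel (cube (R + 1) :: (real ^ 'n) set) * ennreal (2 / \<bar>D $ k\<bar>)"
    by (subst nn_integral_multc) auto
  also have "\<dots> = ennreal (2 / \<bar>D $ k\<bar> * measure lborel (cube (R + 1) :: (real ^ 'n) set))"
    unfolding emeasure_cube by (subst ennreal_mult'[symmetric]) (auto simp: mult.commute)
  finally show ?thesis .
qed

text \<open>A product over the coordinates, so that a translation along one axis changes a single
  factor.\<close>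

definition cutoff :: "real \<Rightarrow> real ^ 'n \<Rightarrow> real" where
  "cutoff R \<tau> = (\<Prod>j\<in>UNIV. bump (\<tau> $ j / R))"

lemma cutoff_measurable [measurable]: "cutoff R \<in> borel_measurable borel"
  unfolding cutoff_def[abs_def] divide_inverse by (intro borel_measurable_continuous_onI continuous_intros)

lemma cutoff_nonneg: "0 \<le> cutoff R \<tau>"
  by (simp add: cutoff_def prod_nonneg bump_bounds)

lemma cutoff_le_indicator:
  assumes "0 < R"
  shows "cutoff R \<tau> \<le> indicator (cube R) \<tau>"
proof (cases "\<tau> \<in> cube R")
  case True
  have "cutoff R \<tau> \<le> 1" unfolding cutoff_def by (intro prod_le_1 conjI bump_bounds(1,2))
  then show ?thesis using True by simp
next
  case False
  then obtain j where "\<bar>\<tau> $ j\<bar> > R" by (auto simp: cube_def not_le)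
  then have "bump (\<tau> $ j / R) = 0" using assms by (intro bump_bounds) (simp add: abs_divide)
  then have "cutoff R \<tau> = 0" unfolding cutoff_def by (intro prod_zero bexI[of _ j]) simp_all
  then show ?thesis by simp
qed

lemma cutoff_pos:
  assumes "\<And>j. \<bar>\<tau> $ j\<bar> < R"
  shows "0 < cutoff R \<tau>"
proof -
  have "0 < bump (\<tau> $ j / R)" for j
    using assms[of j] by (intro bump_bounds) (simp add: abs_divide)
  then show ?thesis unfolding cutoff_def by (intro prod_pos) auto
qed

lemma integrable_cutoff_mult:
  fixes f :: "real ^ 'n \<Rightarrow> real"
  assumes [measurable]: "f \<in> borel_measurable borel" and B: "\<And>\<tau>. \<bar>f \<tau>\<bar> \<le> B" and R: "0 < R"
  shows "integrable lborel (\<lambda>\<tau>. cutoff R \<tau> * f \<tau>)"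
    "(\<integral>\<tau>. cutoff R \<tau> * f \<tau> \<partial>lborel) \<le> B * measure lborel (cube R :: (real ^ 'n) set)"
proof -
  have i: "integrable lborel (\<lambda>\<tau>. B * indicat_real (cube R :: (real ^ 'n) set) \<tau>)"
    by (intro integrable_mult_right integrable_real_indicator) (auto simp: emeasure_cube)
  have le: "\<bar>cutoff R \<tau> * f \<tau>\<bar> \<le> B * indicat_real (cube R) \<tau>" for \<tau>
  proof -
    have "\<bar>cutoff R \<tau> * f \<tau>\<bar> \<le> indicat_real (cube R) \<tau> * B"
      unfolding abs_mult by (intro mult_mono B) (auto simp: cutoff_nonneg cutoff_le_indicator[OF R])
    then show ?thesis by (simp only: mult.commute)
  qed
  show "integrable lborel (\<lambda>\<tau>. cutoff R \<tau> * f \<tau>)"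
    by (rule Bochner_Integration.integrable_bound[OF i]) (auto intro!: order_trans[OF le] AE_I2)
  then have "(\<integral>\<tau>. cutoff R \<tau> * f \<tau> \<partial>lborel) \<le> (\<integral>\<tau>. B * indicat_real (cube R :: (real ^ 'n) set) \<tau> \<partial>lborel)"
    by (intro integral_mono i order_trans[OF abs_ge_self le])
  then show "(\<integral>\<tau>. cutoff R \<tau> * f \<tau> \<partial>lborel) \<le> B * measure lborel (cube R :: (real ^ 'n) set)"
    by simp
qed

text \<open>Two second order differences acting on \<open>hat r (D \<bullet> \<tau> + \<beta>)\<close> are moved onto the cutoff by translating
  \<open>\<tau>\<close> in the direction of the \<open>k\<close>-th coordinate, which costs a factor \<open>(G / l)\<^sup>4\<close>.\<close>

lemma hat_difference_energy:
  fixes D :: "real ^ 'n" and \<kappa> g g' :: "'m \<Rightarrow> real"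
  assumes M: "finite M" "(\<Sum>m\<in>M. \<kappa> m) = 0" "(\<Sum>m\<in>M. \<bar>\<kappa> m\<bar>) \<le> 2"
    and g: "(\<Sum>m\<in>M. \<kappa> m * g m) = 0" "\<And>m. m \<in> M \<Longrightarrow> \<bar>g m\<bar> \<le> G"
    and g': "(\<Sum>m\<in>M. \<kappa> m * g' m) = 0" "\<And>m. m \<in> M \<Longrightarrow> \<bar>g' m\<bar> \<le> G"
    and r: "0 < r" and R: "1 \<le> R" and G: "0 < G" and l: "0 < l" "l \<le> \<bar>D $ k\<bar>"
    and e: "0 \<le> e" "e \<le> 4"
  shows "\<bar>\<integral>\<tau>. cutoff R \<tau> * (\<Sum>m\<in>M. \<Sum>m'\<in>M. \<kappa> m * \<kappa> m' * hat r (D \<bullet> \<tau> + \<beta> + g m - g' m')) \<partial>lborel\<bar>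
    \<le> 10080 * measure lborel (cube (R + 3) :: (real ^ 'n) set) / l * (G / l) powr e"
proof -
  define V where "V S = measure lborel (cube S :: (real ^ 'n) set)" for S
  have V0: "0 \<le> V S" for S by (simp add: V_def)
  have Vmono: "V S \<le> V S'" if "S \<le> S'" for S S'
    unfolding V_def using that
    by (intro measure_mono_fmeasurable cube_fmeasurable) (auto simp: cube_def intro: order_trans)
  have Dk: "D $ k \<noteq> 0" using l by auto
  have intc: "integrable lborel (\<lambda>\<tau>::real^'n. indicat_real (cube S) \<tau> * hat r (D \<bullet> \<tau> + b))" for S b
  proof (rule Bochner_Integration.integrable_bound)
    show "integrable lborel (\<lambda>\<tau>::real^'n. indicat_real (cube S) \<tau> * (1 / (2 * r)))"
      by (intro integrable_mult_left integrable_real_indicator) (auto simp: emeasure_cube)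
    show "AE \<tau> in lborel. norm (indicat_real (cube S) \<tau> * hat r (D \<bullet> \<tau> + b))
        \<le> norm (indicat_real (cube S) (\<tau>::real^'n) * (1 / (2 * r)))"
      using r hat_le[OF r] hat_nonneg[of r] by (intro AE_I2) (auto simp: abs_mult indicator_def)
  qed measurable
  have nc: "(\<integral>\<tau>. indicat_real (cube S) \<tau> * hat r (D \<bullet> \<tau> + b) \<partial>lborel) \<le> 2 / l * V (S + 1)"
    if "0 \<le> S" for S b
  proof -
    have "ennreal (\<integral>\<tau>. indicat_real (cube S) \<tau> * hat r (D \<bullet> \<tau> + b) \<partial>lborel)
       = (\<integral>\<^sup>+ \<tau>. ennreal (indicat_real (cube S) \<tau> * hat r (D \<bullet> \<tau> + b)) \<partial>lborel)"
      by (rule nn_integral_eq_integral[symmetric, OF intc]) (simp add: hat_nonneg)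
    also have "\<dots> = (\<integral>\<^sup>+ \<tau>. indicator (cube S) \<tau> * ennreal (hat r (D \<bullet> \<tau> + b)) \<partial>lborel)"
      by (intro nn_integral_cong) (simp add: indicator_def)
    also have "\<dots> \<le> ennreal (2 / \<bar>D $ k\<bar> * V (S + 1))"
      unfolding V_def by (rule hat_nonconcentration[OF r Dk that])
    also have "\<dots> \<le> ennreal (2 / l * V (S + 1))"
      using l V0 by (intro ennreal_leI mult_right_mono divide_left_mono) auto
    finally show ?thesis using l V0 by (simp add: ennreal_le_iff)
  qed
  have cut: "\<bar>cutoff R \<tau>\<bar> \<le> indicat_real (cube R) \<tau>" for \<tau> :: "real^'n"
    using cutoff_le_indicator[of R \<tau>] cutoff_nonneg[of R \<tau>] R by simp
  have inth: "integrable lborel (\<lambda>\<tau>::real^'n. cutoff R \<tau> * hat r (D \<bullet> \<tau> + b))" for b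
    by (rule Bochner_Integration.integrable_bound[OF intc[of R b]])
       (use cut in \<open>auto simp: abs_mult hat_nonneg intro!: mult_right_mono\<close>)
  define J where "J b = (\<integral>\<tau>. cutoff R \<tau> * hat r (D \<bullet> \<tau> + b) \<partial>lborel)" for b
  have J0: "0 \<le> J b" for b unfolding J_def by (simp add: cutoff_nonneg hat_nonneg)
  have Jle: "J b \<le> 2 / l * V (R + 1)" for b
  proof -
    have "J b \<le> (\<integral>\<tau>. indicat_real (cube R) \<tau> * hat r (D \<bullet> \<tau> + b) \<partial>lborel)"
      unfolding J_def using cut
      by (intro integral_mono inth intc mult_right_mono hat_nonneg) (auto intro: order_trans[OF abs_ge_self])
    also have "\<dots> \<le> 2 / l * V (R + 1)" using nc R by simp
    finally show ?thesis .
  qed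
  have eq: "(\<integral>\<tau>. cutoff R \<tau> * (\<Sum>m\<in>M. \<Sum>m'\<in>M. \<kappa> m * \<kappa> m' * hat r (D \<bullet> \<tau> + \<beta> + g m - g' m')) \<partial>lborel)
     = (\<Sum>m\<in>M. \<Sum>m'\<in>M. \<kappa> m * \<kappa> m' * J (\<beta> + g m - g' m'))"
  proof -
    have "(\<integral>\<tau>. cutoff R \<tau> * (\<Sum>m\<in>M. \<Sum>m'\<in>M. \<kappa> m * \<kappa> m' * hat r (D \<bullet> \<tau> + \<beta> + g m - g' m')) \<partial>lborel)
     = (\<integral>\<tau>. (\<Sum>m\<in>M. \<Sum>m'\<in>M. \<kappa> m * \<kappa> m' * (cutoff R \<tau> * hat r (D \<bullet> \<tau> + (\<beta> + g m - g' m')))) \<partial>lborel)"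
      by (intro Bochner_Integration.integral_cong refl) (simp add: sum_distrib_left algebra_simps)
    also have "\<dots> = (\<Sum>m\<in>M. \<Sum>m'\<in>M. \<kappa> m * \<kappa> m' * J (\<beta> + g m - g' m'))"
      unfolding J_def by (simp add: inth)
    finally show ?thesis .
  qed
  show ?thesis
  proof (cases "G \<le> l")
    \<comment> \<open>Here \<open>G / l > 1\<close>, so it is enough to bound every average
      \<open>J\<close> separately.\<close>
    case False
    have "\<bar>\<Sum>m\<in>M. \<Sum>m'\<in>M. \<kappa> m * \<kappa> m' * J (\<beta> + g m - g' m')\<bar>
       \<le> (\<Sum>m\<in>M. \<Sum>m'\<in>M. \<bar>\<kappa> m\<bar> * \<bar>\<kappa> m'\<bar> * (2 / l * V (R + 1)))"
      by (intro order_trans[OF sum_abs sum_mono] order_trans[OF sum_abs sum_mono])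
         (simp only: abs_mult abs_of_nonneg[OF J0], intro mult_left_mono Jle mult_nonneg_nonneg abs_ge_zero)
    also have "\<dots> = (\<Sum>m\<in>M. \<bar>\<kappa> m\<bar>) * (\<Sum>m\<in>M. \<bar>\<kappa> m\<bar>) * (2 / l * V (R + 1))"
      unfolding sum_product by (simp only: sum_distrib_right)
    also have "\<dots> \<le> (2 * 2) * (2 / l * V (R + 1))"
      using M(3) l V0 by (intro mult_right_mono mult_mono) (auto intro: sum_nonneg)
    also have "\<dots> \<le> 10080 * V (R + 3) / l * 1"
      using Vmono[of "R + 1" "R + 3"] V0[of "R+1"] l by (simp add: divide_right_mono)
    also have "\<dots> \<le> 10080 * V (R + 3) / l * (G / l) powr e"
      using False l e V0[of "R+3"] by (intro mult_left_mono ge_one_powr_ge_zero) (auto simp: field_simps)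
    finally show ?thesis unfolding eq V_def .
  next
    case True
    define a where "a = axis k (1::real)"
    have Da: "D \<bullet> ((- (\<delta> / D $ k)) *\<^sub>R a + \<tau>) = D \<bullet> \<tau> - \<delta>" for \<delta> \<tau>
      using Dk by (simp add: a_def inner_diff_right inner_axis)
    define T where "T \<tau> = (\<Sum>m\<in>M. \<Sum>m'\<in>M. \<kappa> m * \<kappa> m' * cutoff R ((- ((g m - g' m') / D $ k)) *\<^sub>R a + \<tau>))" for \<tau>
    \<comment> \<open>Translation invariance moves the offset \<open>\<delta>\<close> from the hat
      to the cutoff. The scalar product changes at rate \<open>D $ k\<close> along the axis, hence
      the translation by \<open>\<delta> / D $ k\<close>.\<close>
    have shift: "J (\<beta> + \<delta>) = (\<integral>\<tau>. cutoff R ((- (\<delta> / D $ k)) *\<^sub>R a + \<tau>) * hat r (D \<bullet> \<tau> + \<beta>) \<partial>lborel)" for \<delta>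
    proof -
      have "J (\<beta> + \<delta>) = (\<integral>\<tau>. cutoff R ((- (\<delta> / D $ k)) *\<^sub>R a + \<tau>) * hat r (D \<bullet> ((- (\<delta> / D $ k)) *\<^sub>R a + \<tau>) + (\<beta> + \<delta>)) \<partial>lborel)"
        unfolding J_def by (rule integral_lborel_translate[symmetric]) measurable
      then show ?thesis unfolding Da by (simp add: algebra_simps)
    qed
    \<comment> \<open>Since \<open>l \<le> \<bar>D $ k\<bar>\<close>, such an offset translates the
      cutoff by at most 2. The remaining unit in \<open>R + 3\<close> comes from
      \<open>hat_nonconcentration\<close>.\<close>
    have cutsh: "cutoff R ((- (\<delta> / D $ k)) *\<^sub>R a + \<tau>) \<le> indicat_real (cube (R + 2)) \<tau>" if "\<bar>\<delta>\<bar> \<le> 2 * l" for \<delta> \<tau>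
    proof -
      let ?v = "(- (\<delta> / D $ k)) *\<^sub>R a + \<tau>"
      have d: "\<bar>\<delta> / D $ k\<bar> \<le> 2" using that l by (simp add: abs_divide divide_le_eq)
      have "\<tau> \<in> cube (R + 2)" if "?v \<in> cube R"
        unfolding cube_def
      proof (intro CollectI allI)
        fix j
        have "\<bar>(- (\<delta> / D $ k)) * a $ j + \<tau> $ j\<bar> \<le> R" using that by (auto simp: cube_def)
        moreover have "\<bar>(- (\<delta> / D $ k)) * a $ j\<bar> \<le> 2" using d by (auto simp: a_def axis_def)
        ultimately show "\<bar>\<tau> $ j\<bar> \<le> R + 2" by linarith
      qed
      then have "indicat_real (cube R) ?v \<le> indicat_real (cube (R + 2)) \<tau>"
        by (auto simp: indicator_def)
      then show ?thesis using cutoff_le_indicator[of R ?v] R by linarith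
    qed
    have ints: "integrable lborel (\<lambda>\<tau>. cutoff R ((- (\<delta> / D $ k)) *\<^sub>R a + \<tau>) * hat r (D \<bullet> \<tau> + \<beta>))" if "\<bar>\<delta>\<bar> \<le> 2 * l" for \<delta>
    proof (rule Bochner_Integration.integrable_bound[OF intc[of "R + 2" \<beta>]])
      show "AE \<tau> in lborel. norm (cutoff R ((- (\<delta> / D $ k)) *\<^sub>R a + \<tau>) * hat r (D \<bullet> \<tau> + \<beta>)) \<le> norm (indicat_real (cube (R + 2)) \<tau> * hat r (D \<bullet> \<tau> + \<beta>))"
        using cutsh[OF that] by (intro AE_I2) (simp add: abs_mult cutoff_nonneg hat_nonneg mult_right_mono)
    qed measurable
    have gd: "\<bar>g m - g' m'\<bar> \<le> 2 * l" if "m \<in> M" "m' \<in> M" for m m'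
      using g(2)[OF that(1)] g'(2)[OF that(2)] True by linarith
    have Tb: "\<bar>T \<tau>\<bar> \<le> 5040 * (G / l) ^ 4 * indicat_real (cube (R + 2)) \<tau>" for \<tau>
    proof (cases "\<tau> \<in> cube (R + 2)")
      case False
      have "cutoff R ((- ((g m - g' m') / D $ k)) *\<^sub>R a + \<tau>) = 0" if "m \<in> M" "m' \<in> M" for m m'
        by (rule order_antisym[OF order_trans[OF cutsh[OF gd[OF that]]] cutoff_nonneg]) (use False in simp)
      then have "T \<tau> = 0" by (simp add: T_def)
      then show ?thesis using False by simp
    next
      case inside: True
      \<comment> \<open>\<open>P\<close> collects the factors that the translation leaves alone, so
        \<open>T\<close> reduces to a double difference of one bump.\<close>
      define P where "P = (\<Prod>j\<in>UNIV - {k}. bump (\<tau> $ j / R))"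
      have P: "0 \<le> P" "P \<le> 1" unfolding P_def by (auto intro!: prod_nonneg prod_le_1 bump_bounds)
      define h where "h m = - g m / (D $ k * R)" for m
      define h' where "h' m = g' m / (D $ k * R)" for m
      have cu: "cutoff R ((- ((g m - g' m') / D $ k)) *\<^sub>R a + \<tau>) = P * bump (\<tau> $ k / R + h m + h' m')" for m m'
      proof -
        let ?v = "(- ((g m - g' m') / D $ k)) *\<^sub>R a + \<tau>"
        have "cutoff R ?v = bump (?v $ k / R) * (\<Prod>j\<in>UNIV - {k}. bump (?v $ j / R))"
          unfolding cutoff_def by (rule prod.remove) auto
        also have "(\<Prod>j\<in>UNIV - {k}. bump (?v $ j / R)) = P"
          unfolding P_def by (intro prod.cong) (auto simp: a_def axis_def)
        also have "?v $ k / R = \<tau> $ k / R + h m + h' m'"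
          using R Dk by (simp add: a_def axis_def h_def h'_def field_simps)
        finally show ?thesis by (simp only: mult.commute)
      qed
      have hb: "\<bar>x / (D $ k * R)\<bar> \<le> G / l" if "\<bar>x\<bar> \<le> G" for x
      proof -
        have "l * 1 \<le> \<bar>D $ k\<bar> * R" using l R by (intro mult_mono) auto
        then have "\<bar>x\<bar> / (\<bar>D $ k\<bar> * R) \<le> G / l" using l that by (intro frac_le) auto
        then show ?thesis using R by (simp add: abs_mult)
      qed
      have mom: "(\<Sum>m\<in>M. \<kappa> m * h m) = 0" "(\<Sum>m\<in>M. \<kappa> m * h' m) = 0"
        using g(1) g'(1) by (simp_all add: h_def h'_def sum_negf flip: sum_divide_distrib)
      have "T \<tau> = P * (\<Sum>m\<in>M. \<Sum>m'\<in>M. \<kappa> m * \<kappa> m' * bump (\<tau> $ k / R + h m + h' m'))"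
        unfolding T_def cu by (simp add: sum_distrib_left mult_ac)
      also have "\<bar>\<dots>\<bar> \<le> 1 * (5040 * (G / l)\<^sup>2 * (G / l)\<^sup>2)"
        unfolding abs_mult
        by (intro mult_mono bump_second_order_bound M mom)
           (use P hb[OF g(2)] hb[OF g'(2)] in \<open>auto simp: h_def h'_def\<close>)
      also have "\<dots> = 5040 * (G / l) ^ 4" by (simp add: eval_nat_numeral)
      finally show ?thesis using inside by simp
    qed
    have "(\<Sum>m\<in>M. \<Sum>m'\<in>M. \<kappa> m * \<kappa> m' * J (\<beta> + g m - g' m'))
      = (\<Sum>m\<in>M. \<Sum>m'\<in>M. \<kappa> m * \<kappa> m' * (\<integral>\<tau>. cutoff R ((- ((g m - g' m') / D $ k)) *\<^sub>R a + \<tau>) * hat r (D \<bullet> \<tau> + \<beta>) \<partial>lborel))"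
      by (simp only: shift[symmetric] add_diff_eq)
    also have "\<dots> = (\<integral>\<tau>. (\<Sum>m\<in>M. \<Sum>m'\<in>M. \<kappa> m * \<kappa> m' * (cutoff R ((- ((g m - g' m') / D $ k)) *\<^sub>R a + \<tau>) * hat r (D \<bullet> \<tau> + \<beta>))) \<partial>lborel)"
      using ints[OF gd] by (simp add: Bochner_Integration.integral_sum del: integral_mult_right_zero integral_mult_right)
    also have "\<dots> = (\<integral>\<tau>. T \<tau> * hat r (D \<bullet> \<tau> + \<beta>) \<partial>lborel)"
      by (intro Bochner_Integration.integral_cong refl) (simp only: T_def sum_distrib_right mult.assoc)
    finally have eqT: "(\<Sum>m\<in>M. \<Sum>m'\<in>M. \<kappa> m * \<kappa> m' * J (\<beta> + g m - g' m')) = (\<integral>\<tau>. T \<tau> * hat r (D \<bullet> \<tau> + \<beta>) \<partial>lborel)" .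
    have "\<bar>\<integral>\<tau>. T \<tau> * hat r (D \<bullet> \<tau> + \<beta>) \<partial>lborel\<bar> \<le> (\<integral>\<tau>. \<bar>T \<tau> * hat r (D \<bullet> \<tau> + \<beta>)\<bar> \<partial>lborel)"
      by (rule integral_abs_bound)
    also have "\<dots> \<le> (\<integral>\<tau>. 5040 * (G / l) ^ 4 * (indicat_real (cube (R + 2)) \<tau> * hat r (D \<bullet> \<tau> + \<beta>)) \<partial>lborel)"
    proof (rule integral_mono')
      show "integrable lborel (\<lambda>\<tau>. 5040 * (G / l) ^ 4 * (indicat_real (cube (R + 2)) \<tau> * hat r (D \<bullet> \<tau> + \<beta>)))"
        by (intro integrable_mult_right intc)
      fix \<tau> :: "real ^ 'n"
      show "\<bar>T \<tau> * hat r (D \<bullet> \<tau> + \<beta>)\<bar> \<le> 5040 * (G / l) ^ 4 * (indicat_real (cube (R + 2)) \<tau> * hat r (D \<bullet> \<tau> + \<beta>))"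
        using mult_right_mono[OF Tb[of \<tau>] hat_nonneg[of r "D \<bullet> \<tau> + \<beta>"]]
        by (simp only: abs_mult abs_of_nonneg[OF hat_nonneg] mult.assoc)
      show "0 \<le> 5040 * (G / l) ^ 4 * (indicat_real (cube (R + 2)) \<tau> * hat r (D \<bullet> \<tau> + \<beta>))"
        using G l by (intro mult_nonneg_nonneg hat_nonneg) auto
    qed
    also have "\<dots> \<le> 5040 * (G / l) ^ 4 * (2 / l * V (R + 2 + 1))"
      by (subst integral_mult_right_zero, intro mult_left_mono nc) (use R G l in auto)
    also have "\<dots> = 10080 * V (R + 3) / l * (G / l) ^ 4" by (simp add: add.assoc)
    \<comment> \<open>As \<open>G / l \<le> 1\<close>, lowering the exponent from 4 to
      \<open>e\<close> can only increase the bound.\<close>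
    also have "\<dots> \<le> 10080 * V (R + 3) / l * (G / l) powr e"
    proof -
      have "(G / l) ^ 4 = (G / l) powr 4" using G l by (simp add: powr_numeral)
      also have "\<dots> \<le> (G / l) powr e" using G l True e by (intro powr_mono') auto
      finally show ?thesis using V0 l by (intro mult_left_mono) auto
    qed
    finally show ?thesis unfolding eq eqT V_def .
  qed
qed

section \<open>Strip masses of weighted point sets\<close>

text \<open>The integral of the squared deviation of \<open>f\<close> from its mean \<open>c\<close>
  is nonnegative; expanding the square and multiplying by \<open>b - a\<close> gives the
  claim.\<close>

lemma Cauchy_Schwarz_interval:
  fixes f :: "real \<Rightarrow> real"
  assumes f: "continuous_on {a..b} f" and ab: "a < b"
  shows "(integral {a..b} f)\<^sup>2 \<le> (b - a) * integral {a..b} (\<lambda>s. (f s)\<^sup>2)"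
proof -
  define I where "I = integral {a..b} f"
  define c where "c = I / (b - a)"
  have int: "f integrable_on {a..b}" "(\<lambda>s. (f s)\<^sup>2) integrable_on {a..b}"
    using f by (auto intro!: integrable_continuous_real continuous_intros)
  have "0 \<le> integral {a..b} (\<lambda>s. (f s - c)\<^sup>2)"
    by (intro integral_nonneg integrable_continuous_real continuous_intros f) auto
  also have "(\<lambda>s. (f s - c)\<^sup>2) = (\<lambda>s. (f s)\<^sup>2 - 2 * c * f s + c\<^sup>2)"
    by (auto simp: power2_diff)
  also have "integral {a..b} \<dots> = integral {a..b} (\<lambda>s. (f s)\<^sup>2) - 2 * c * I + c\<^sup>2 * (b - a)"
  proof (rule integral_unique)
    have "((\<lambda>s. c\<^sup>2) has_integral c\<^sup>2 * (b - a)) {a..b}"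
      using has_integral_const_real[of "c\<^sup>2" a b] ab by (simp add: mult.commute)
    then show "((\<lambda>s. (f s)\<^sup>2 - 2 * c * f s + c\<^sup>2) has_integral
        integral {a..b} (\<lambda>s. (f s)\<^sup>2) - 2 * c * I + c\<^sup>2 * (b - a)) {a..b}"
      unfolding I_def using int
      by (intro has_integral_add has_integral_diff has_integral_mult_right integrable_integral)
  qed
  finally have "0 \<le> integral {a..b} (\<lambda>s. (f s)\<^sup>2) - 2 * c * I + c\<^sup>2 * (b - a)" .
  then have "0 * (b - a) \<le> (integral {a..b} (\<lambda>s. (f s)\<^sup>2) - 2 * c * I + c\<^sup>2 * (b - a)) * (b - a)"
    using ab by (intro mult_right_mono) auto
  also have "\<dots> = (b - a) * integral {a..b} (\<lambda>s. (f s)\<^sup>2) - I\<^sup>2"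
  proof -
    have cb: "c * (b - a) = I" using ab by (simp add: c_def)
    show ?thesis unfolding cb[symmetric] by (simp add: power2_eq_square algebra_simps)
  qed
  finally show ?thesis by (simp add: I_def)
qed

text \<open>Doubling the scale \<open>r\<close> replaces the hat by its mean with weights \<open>1/4, 1/2, 1/4\<close> at the shifts
  \<open>- 2 r, 0, 2 r\<close>, and the average over slopes by its mean over the shifts \<open>\<plusminus> r\<close>. The pairs are the combined
  slope and offset shifts in units of \<open>r\<close>; \<open>(0, 0)\<close> carries the subtracted term at scale \<open>r\<close>.\<close>

definition steps :: "(real \<times> real) set" where
  "steps = {(-1, -2), (-1, 0), (-1, 2), (1, -2), (1, 0), (1, 2), (0, 0)}"

definition step_coeff :: "real \<times> real \<Rightarrow> real" where
  "step_coeff m = (if fst m = 0 then -1 else if snd m = 0 then 1 / 4 else 1 / 8)"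

definition step_shift :: "real \<Rightarrow> real \<Rightarrow> real \<times> real \<Rightarrow> real" where
  "step_shift r \<xi> m = r * (fst m * \<xi> + snd m)"

lemma sum_steps:
  "(\<Sum>m\<in>steps. step_coeff m * f m) =
     (f (-1, -2) + 2 * f (-1, 0) + f (-1, 2) + f (1, -2) + 2 * f (1, 0) + f (1, 2)) / 8 - f (0, 0)"
  by (simp add: steps_def step_coeff_def)

text \<open>The first moment vanishes because \<open>steps\<close> and its coefficients are
  invariant under negation of both components. These are the conditions that
  \<open>hat_difference_energy\<close> puts on the coefficients, with the abscissa of a point in the
  role of \<open>\<xi>\<close>.\<close>

lemma step_moments:
  "finite steps" "(\<Sum>m\<in>steps. step_coeff m) = 0" "(\<Sum>m\<in>steps. \<bar>step_coeff m\<bar>) \<le> 2"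
  "(\<Sum>m\<in>steps. step_coeff m * step_shift r \<xi> m) = 0"
proof -
  show "(\<Sum>m\<in>steps. step_coeff m * step_shift r \<xi> m) = 0"
    unfolding sum_steps step_shift_def by (simp add: algebra_simps)
qed (simp_all add: steps_def step_coeff_def)

lemma step_shift_bound:
  assumes "m \<in> steps" "\<bar>\<xi>\<bar> \<le> X" "1 \<le> X" "0 < r"
  shows "\<bar>step_shift r \<xi> m\<bar> \<le> 3 * X * r"
proof -
  have "\<bar>fst m * \<xi> + snd m\<bar> \<le> 3 * X"
    using assms by (auto simp: steps_def)
  then show ?thesis using assms(4) by (simp add: step_shift_def abs_mult mult_ac mult_left_mono)
qed

lemma step_kernel_bound:
  assumes "0 < r"
  shows "\<bar>\<Sum>m\<in>steps. \<Sum>m'\<in>steps. step_coeff m * step_coeff m' * hat r (g m m')\<bar> \<le> 2 / r"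
proof -
  have "\<bar>\<Sum>m\<in>steps. \<Sum>m'\<in>steps. step_coeff m * step_coeff m' * hat r (g m m')\<bar>
     \<le> (\<Sum>m\<in>steps. \<Sum>m'\<in>steps. \<bar>step_coeff m\<bar> * \<bar>step_coeff m'\<bar> * (1 / (2 * r)))"
    by (intro order_trans[OF sum_abs sum_mono] order_trans[OF sum_abs sum_mono])
       (simp only: abs_mult abs_of_nonneg[OF hat_nonneg], intro mult_left_mono hat_le assms, simp)
  also have "\<dots> = (\<Sum>m\<in>steps. \<bar>step_coeff m\<bar>) * (\<Sum>m\<in>steps. \<bar>step_coeff m\<bar>) * (1 / (2 * r))"
    unfolding sum_product by (simp only: sum_distrib_right)
  also have "\<dots> \<le> 2 * 2 * (1 / (2 * r))"
    using assms step_moments(3) by (intro mult_right_mono mult_mono) (auto intro: sum_nonneg)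
  finally show ?thesis by simp
qed

text \<open>The six steps with nonzero slope shift are \<open>hat_double\<close> expanded at
  \<open>u + r * \<xi>\<close> and at \<open>u - r * \<xi>\<close>.\<close>

lemma hat_step:
  assumes "0 < r"
  shows "(\<Sum>m\<in>steps. step_coeff m * hat r (u + step_shift r \<xi> m))
    = (hat (2 * r) (u + r * \<xi>) + hat (2 * r) (u - r * \<xi>)) / 2 - hat r u"
proof -
  have "step_shift r \<xi> (-1, -2) = - (r * \<xi>) - 2 * r" "step_shift r \<xi> (-1, 0) = - (r * \<xi>)"
    "step_shift r \<xi> (-1, 2) = - (r * \<xi>) + 2 * r" "step_shift r \<xi> (1, -2) = r * \<xi> - 2 * r"
    "step_shift r \<xi> (1, 0) = r * \<xi>" "step_shift r \<xi> (1, 2) = r * \<xi> + 2 * r" "step_shift r \<xi> (0, 0) = 0"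
    by (simp_all add: step_shift_def algebra_simps)
  note shifts = this
  have "u + (- (r * \<xi>) - 2 * r) = u - r * \<xi> - 2 * r" "u + - (r * \<xi>) = u - r * \<xi>"
    "u + (- (r * \<xi>) + 2 * r) = u - r * \<xi> + 2 * r" "u + (r * \<xi> - 2 * r) = u + r * \<xi> - 2 * r"
    "u + (r * \<xi> + 2 * r) = u + r * \<xi> + 2 * r" "u + 0 = u" by simp_all
  then show ?thesis unfolding sum_steps hat_double[OF assms] shifts by (simp add: field_simps)
qed

text \<open>A probability measure with finitely many atoms \<open>(x w, y w)\<close>. The bound
  concerns the abscissae because a change of slope displaces a point in proportion to
  \<open>x w\<close>.\<close>

locale weighted_points =
  fixes W :: "'w set" and p x y :: "'w \<Rightarrow> real" and X :: real
  assumes finite_W: "finite W" and p_nonneg: "w \<in> W \<Longrightarrow> 0 \<le> p w" and sum_p: "sum p W = 1"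
    and x_bound: "w \<in> W \<Longrightarrow> \<bar>x w\<bar> \<le> X" and X_ge_1: "1 \<le> X"
begin

definition smoothed :: "real \<Rightarrow> real \<Rightarrow> real \<Rightarrow> real" where
  "smoothed r z \<theta> = (\<Sum>w\<in>W. p w * hat r (y w + \<theta> * x w - z))"

definition averaged :: "real \<Rightarrow> real \<Rightarrow> real \<Rightarrow> real" where
  "averaged r z \<theta> = integral {- r..r} (\<lambda>s. smoothed r z (\<theta> + s)) / (2 * r)"

text \<open>The Gram form of \<open>hat_gram\<close> for the signed masses
  \<open>p w * step_coeff m\<close>, indexed by a point and a step. It does not involve the offset
  \<open>z\<close>, which makes the resulting bounds uniform in \<open>z\<close>.\<close>

definition energy :: "real \<Rightarrow> real \<Rightarrow> real" where
  "energy r \<theta> = (\<Sum>w\<in>W. \<Sum>w'\<in>W. p w * p w' *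
     (\<Sum>m\<in>steps. \<Sum>m'\<in>steps. step_coeff m * step_coeff m' *
       hat r (y w + \<theta> * x w + step_shift r (x w) m - (y w' + \<theta> * x w' + step_shift r (x w') m'))))"

lemma continuous_on_smoothed [continuous_intros]:
  "continuous_on S f \<Longrightarrow> continuous_on S (\<lambda>s. smoothed r z (f s))"
  unfolding smoothed_def by (intro continuous_intros)

lemma continuous_on_energy [continuous_intros]:
  "continuous_on S f \<Longrightarrow> continuous_on S (\<lambda>s. energy r (f s))"
  unfolding energy_def by (intro continuous_intros)

lemma smoothed_nonneg: "0 \<le> smoothed r z \<theta>"
  unfolding smoothed_def by (intro sum_nonneg mult_nonneg_nonneg p_nonneg hat_nonneg)

lemma averaged_le:
  assumes "0 < r"
  shows "averaged r z \<theta> \<le> 1 / (2 * r)"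
proof -
  have "smoothed r z s \<le> 1 / (2 * r)" for s
  proof -
    have "smoothed r z s \<le> (\<Sum>w\<in>W. p w * (1 / (2 * r)))"
      unfolding smoothed_def by (intro sum_mono mult_left_mono hat_le p_nonneg assms)
    then show ?thesis by (simp only: sum_distrib_right[symmetric] sum_p mult_1)
  qed
  then have "integral {- r..r} (\<lambda>s. smoothed r z (\<theta> + s)) \<le> integral {- r..r} (\<lambda>s. 1 / (2 * r))"
    by (intro integral_le integrable_continuous_real continuous_intros)
  also have "\<dots> = 1" using assms by simp
  finally show ?thesis using assms by (simp add: averaged_def divide_right_mono)
qed

lemma smoothed_step:
  assumes "0 < r"
  shows "(smoothed (2 * r) z (\<theta> + r) + smoothed (2 * r) z (\<theta> - r)) / 2 - smoothed r z \<theta>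
    = (\<Sum>w\<in>W. \<Sum>m\<in>steps. p w * step_coeff m * hat r (y w + \<theta> * x w + step_shift r (x w) m - z))"
proof -
  have "(\<Sum>w\<in>W. \<Sum>m\<in>steps. p w * step_coeff m * hat r (y w + \<theta> * x w + step_shift r (x w) m - z))
     = (\<Sum>w\<in>W. p w * ((hat (2 * r) (y w + (\<theta> + r) * x w - z) + hat (2 * r) (y w + (\<theta> - r) * x w - z)) / 2
          - hat r (y w + \<theta> * x w - z)))"
  proof (intro sum.cong refl)
    fix w assume "w \<in> W"
    let ?u = "y w + \<theta> * x w - z"
    have "(\<Sum>m\<in>steps. p w * step_coeff m * hat r (y w + \<theta> * x w + step_shift r (x w) m - z))
      = p w * (\<Sum>m\<in>steps. step_coeff m * hat r (?u + step_shift r (x w) m))"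
      by (simp add: sum_distrib_left algebra_simps)
    also have "\<dots> = p w * ((hat (2 * r) (?u + r * x w) + hat (2 * r) (?u - r * x w)) / 2 - hat r ?u)"
      by (simp only: hat_step[OF assms])
    finally show "(\<Sum>m\<in>steps. p w * step_coeff m * hat r (y w + \<theta> * x w + step_shift r (x w) m - z))
      = p w * ((hat (2 * r) (y w + (\<theta> + r) * x w - z) + hat (2 * r) (y w + (\<theta> - r) * x w - z)) / 2
          - hat r (y w + \<theta> * x w - z))"
      by (simp add: algebra_simps)
  qed
  then show ?thesis
    by (simp add: smoothed_def sum.distrib sum_subtractf right_diff_distrib distrib_left
        add_divide_distrib sum_divide_distrib)
qed

lemma smoothed_step_square_le:
  assumes "0 < r"
  shows "((smoothed (2 * r) z (\<theta> + r) + smoothed (2 * r) z (\<theta> - r)) / 2 - smoothed r z \<theta>)\<^sup>2 \<le> energy r \<theta> / (2 * r)"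
proof -
  define q where "q = (\<lambda>(w, m). p w * step_coeff m)"
  define \<alpha> where "\<alpha> = (\<lambda>(w, m). y w + \<theta> * x w + step_shift r (x w) m)"
  have "(\<Sum>k\<in>W \<times> steps. q k * hat r (\<alpha> k - z))\<^sup>2
     \<le> (\<Sum>k\<in>W \<times> steps. \<Sum>l\<in>W \<times> steps. q k * q l * hat r (\<alpha> k - \<alpha> l)) / (2 * r)"
    using assms finite_W step_moments(1) by (intro hat_gram) auto
  also have "(\<Sum>k\<in>W \<times> steps. \<Sum>l\<in>W \<times> steps. q k * q l * hat r (\<alpha> k - \<alpha> l)) = energy r \<theta>"
  proof -
    have "(\<Sum>k\<in>W \<times> steps. \<Sum>l\<in>W \<times> steps. q k * q l * hat r (\<alpha> k - \<alpha> l))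
      = (\<Sum>w\<in>W. \<Sum>m\<in>steps. \<Sum>w'\<in>W. \<Sum>m'\<in>steps. q (w, m) * q (w', m') * hat r (\<alpha> (w, m) - \<alpha> (w', m')))"
      by (simp add: sum.cartesian_product')
    also have "\<dots> = (\<Sum>w\<in>W. \<Sum>w'\<in>W. \<Sum>m\<in>steps. \<Sum>m'\<in>steps. q (w, m) * q (w', m') * hat r (\<alpha> (w, m) - \<alpha> (w', m')))"
      by (intro sum.cong refl sum.swap)
    also have "\<dots> = energy r \<theta>"
      unfolding energy_def q_def \<alpha>_def by (simp add: sum_distrib_left mult_ac)
    finally show ?thesis .
  qed
  also have "(\<Sum>k\<in>W \<times> steps. q k * hat r (\<alpha> k - z)) = (smoothed (2 * r) z (\<theta> + r) + smoothed (2 * r) z (\<theta> - r)) / 2 - smoothed r z \<theta>"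
    unfolding smoothed_step[OF assms] by (simp add: sum.cartesian_product' q_def \<alpha>_def)
  finally show ?thesis .
qed

lemma energy_nonneg: "0 < r \<Longrightarrow> 0 \<le> energy r \<theta>"
  using order_trans[OF zero_le_power2 smoothed_step_square_le[of r 0 \<theta>]] by (simp add: zero_le_divide_iff)

text \<open>The slope window of radius \<open>2 * r\<close> consists of two windows of radius
  \<open>r\<close>, centred at \<open>\<theta> - r\<close> and \<open>\<theta> + r\<close>. Hence
  the change of scale is the mean of \<open>N\<close> over one window, and Cauchy-Schwarz combines
  with \<open>smoothed_step_square_le\<close>.\<close>

lemma averaged_step:
  assumes r: "0 < r"
  shows "(averaged (2 * r) z \<theta> - averaged r z \<theta>)\<^sup>2 \<le> integral {\<theta> - r..\<theta> + r} (energy r) / (4 * r\<^sup>2)"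
proof -
  let ?f = "smoothed (2 * r) z"
  define N where "N \<theta> = (?f (\<theta> + r) + ?f (\<theta> - r)) / 2 - smoothed r z \<theta>" for \<theta>
  have cN: "continuous_on S (\<lambda>s. N (\<theta> + s))" for S unfolding N_def by (intro continuous_intros) auto
  have io: "(\<lambda>s. smoothed r' z (c + s)) integrable_on {a..b}" for r' c a b
    by (intro integrable_continuous_real continuous_intros)
  have "integral {- (2 * r)..2 * r} (\<lambda>s. ?f (\<theta> + s))
     = integral {- (2 * r)..0} (\<lambda>s. ?f (\<theta> + s)) + integral {0..2 * r} (\<lambda>s. ?f (\<theta> + s))"
    by (rule Henstock_Kurzweil_Integration.integral_combine[symmetric]) (use r io in auto)
  also have "integral {- (2 * r)..0} (\<lambda>s. ?f (\<theta> + s)) = integral {- r..r} (\<lambda>s. ?f (\<theta> - r + s))"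
    using integral_shift_real_ivl[of "- r" "r" r "\<lambda>s. ?f (\<theta> - r + s)"] by (simp add: algebra_simps)
  also have "integral {0..2 * r} (\<lambda>s. ?f (\<theta> + s)) = integral {- r..r} (\<lambda>s. ?f (\<theta> + r + s))"
    using integral_shift_real_ivl[of "- r" "- r" "r" "\<lambda>s. ?f (\<theta> + r + s)"] by (simp add: algebra_simps)
  finally have "averaged (2 * r) z \<theta> - averaged r z \<theta>
     = ((integral {- r..r} (\<lambda>s. ?f (\<theta> - r + s)) + integral {- r..r} (\<lambda>s. ?f (\<theta> + r + s))) / 2
         - integral {- r..r} (\<lambda>s. smoothed r z (\<theta> + s))) / (2 * r)"
    using r by (simp add: averaged_def field_simps)
  also have "(integral {- r..r} (\<lambda>s. ?f (\<theta> - r + s)) + integral {- r..r} (\<lambda>s. ?f (\<theta> + r + s))) / 2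
         - integral {- r..r} (\<lambda>s. smoothed r z (\<theta> + s)) = integral {- r..r} (\<lambda>s. N (\<theta> + s))"
  proof (rule integral_unique[symmetric])
    have "((\<lambda>s. (?f (\<theta> - r + s) + ?f (\<theta> + r + s)) / 2 - smoothed r z (\<theta> + s)) has_integral
      (integral {- r..r} (\<lambda>s. ?f (\<theta> - r + s)) + integral {- r..r} (\<lambda>s. ?f (\<theta> + r + s))) / 2
         - integral {- r..r} (\<lambda>s. smoothed r z (\<theta> + s))) {- r..r}"
      by (intro has_integral_diff has_integral_divide has_integral_add integrable_integral io)
    then show "((\<lambda>s. N (\<theta> + s)) has_integral
      (integral {- r..r} (\<lambda>s. ?f (\<theta> - r + s)) + integral {- r..r} (\<lambda>s. ?f (\<theta> + r + s))) / 2
         - integral {- r..r} (\<lambda>s. smoothed r z (\<theta> + s))) {- r..r}"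
      unfolding N_def by (simp add: algebra_simps)
  qed
  finally have "(averaged (2 * r) z \<theta> - averaged r z \<theta>)\<^sup>2 = (integral {- r..r} (\<lambda>s. N (\<theta> + s)))\<^sup>2 / (4 * r\<^sup>2)"
    by (simp add: power_divide power_mult_distrib)
  also have "\<dots> \<le> (2 * r * integral {- r..r} (\<lambda>s. (N (\<theta> + s))\<^sup>2)) / (4 * r\<^sup>2)"
    using Cauchy_Schwarz_interval[OF cN, of "- r" r] r by (intro divide_right_mono) auto
  also have "\<dots> \<le> (2 * r * integral {- r..r} (\<lambda>s. energy r (\<theta> + s) / (2 * r))) / (4 * r\<^sup>2)"
    using r cN
    by (intro divide_right_mono mult_left_mono integral_le integrable_continuous_real continuous_intros)
       (auto simp: N_def smoothed_step_square_le)
  also have "\<dots> = integral {- r..r} (\<lambda>s. energy r (\<theta> + s)) / (4 * r\<^sup>2)"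
    using r by (simp add: field_simps)
  also have "integral {- r..r} (\<lambda>s. energy r (\<theta> + s)) = integral {\<theta> - r..\<theta> + r} (energy r)"
    using integral_shift_real_ivl[of "\<theta> - r" \<theta> "\<theta> + r" "energy r"] by (simp add: add.commute)
  finally show ?thesis .
qed

lemma strip_le_averaged:
  assumes r: "0 < r"
  shows "(\<Sum>w\<in>{w \<in> W. \<bar>y w + \<theta> * x w - z\<bar> \<le> r / 2}. p w) \<le> 8 * X * r * averaged r z \<theta>"
proof -
  let ?S = "{w \<in> W. \<bar>y w + \<theta> * x w - z\<bar> \<le> r / 2}"
  \<comment> \<open>Varying the slope by at most \<open>h\<close> moves a point by at most
    \<open>h * X = r / 2\<close>, so the points of the strip stay within distance \<open>r\<close>,
    where the hat is at least \<open>1 / (4 * r)\<close>.\<close>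
  define h where "h = r / (2 * X)"
  have h: "0 < h" "h \<le> r" using r X_ge_1 by (auto simp: h_def divide_le_eq)
  have low: "sum p ?S / (4 * r) \<le> smoothed r z (\<theta> + s)" if "\<bar>s\<bar> \<le> h" for s
  proof -
    have "sum p ?S / (4 * r) = (\<Sum>w\<in>?S. p w * (1 / (4 * r)))" by (simp add: sum_divide_distrib)
    also have "\<dots> \<le> (\<Sum>w\<in>?S. p w * hat r (y w + (\<theta> + s) * x w - z))"
    proof (intro sum_mono mult_left_mono hat_ge r)
      fix w assume w: "w \<in> ?S"
      have "\<bar>s * x w\<bar> \<le> h * X" unfolding abs_mult using that x_bound[of w] w X_ge_1 by (intro mult_mono) auto
      also have "\<dots> = r / 2" using X_ge_1 by (simp add: h_def)
      finally have "\<bar>s * x w\<bar> \<le> r / 2" .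
      moreover have "y w + (\<theta> + s) * x w - z = (y w + \<theta> * x w - z) + s * x w" by (simp add: algebra_simps)
      moreover have "\<bar>y w + \<theta> * x w - z\<bar> \<le> r / 2" using w by simp
      ultimately show "\<bar>y w + (\<theta> + s) * x w - z\<bar> \<le> r" by linarith
      show "0 \<le> p w" using w p_nonneg by auto
    qed
    also have "\<dots> \<le> smoothed r z (\<theta> + s)" unfolding smoothed_def
      by (intro sum_mono2 finite_W) (auto intro!: mult_nonneg_nonneg p_nonneg hat_nonneg)
    finally show ?thesis .
  qed
  have io: "(\<lambda>s. smoothed r z (\<theta> + s)) integrable_on {a..b}" for a b
    by (intro integrable_continuous_real continuous_intros)
  have "2 * h * (sum p ?S / (4 * r)) = integral {- h..h} (\<lambda>s. sum p ?S / (4 * r))" using h by simp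
  also have "\<dots> \<le> integral {- h..h} (\<lambda>s. smoothed r z (\<theta> + s))"
    by (intro integral_le io low) auto
  also have "\<dots> \<le> integral {- r..r} (\<lambda>s. smoothed r z (\<theta> + s))"
    by (rule integral_subset_le) (use h io smoothed_nonneg in auto)
  also have "\<dots> = 2 * r * averaged r z \<theta>" using r by (simp add: averaged_def)
  finally have "2 * h * (sum p ?S / (4 * r)) * (4 * X) \<le> 2 * r * averaged r z \<theta> * (4 * X)"
    using X_ge_1 by (intro mult_right_mono) auto
  moreover have "2 * h * (sum p ?S / (4 * r)) * (4 * X) = sum p ?S" using r X_ge_1 by (simp add: h_def)
  ultimately show ?thesis by (simp add: mult_ac)
qed

text \<open>Telescoping from scale 1: the step down to scale \<open>r\<close> costs at most
  \<open>sqrt B * r powr (\<epsilon> / 2)\<close>, which is geometric in the number of halvings. The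
  margin 1 in the hypothesis on \<open>\<theta>\<close> keeps the slope windows inside
  \<open>[- T, T]\<close>.\<close>

lemma averaged_dyadic_le:
  assumes en: "\<And>i. 1 \<le> i \<Longrightarrow> i \<le> N \<Longrightarrow>
      (\<integral>\<^sup>+\<theta>. indicator {- T..T} \<theta> * ennreal (energy (1 / 2 ^ i) \<theta>) \<partial>lborel) \<le> ennreal (B * (1 / 2 ^ i) powr (2 + \<epsilon>))"
    and B: "0 \<le> B" and \<theta>: "\<bar>\<theta>\<bar> + 1 \<le> T" and \<epsilon>: "0 < \<epsilon>" and j: "j \<le> N"
  shows "averaged (1 / 2 ^ j) z \<theta> \<le> 1 + sqrt B / (1 - 2 powr (- (\<epsilon> / 2)))"
proof -
  have step: "\<bar>averaged (1 / 2 ^ i) z \<theta> - averaged (1 / 2 ^ Suc i) z \<theta>\<bar> \<le> sqrt B * (2 powr (- (\<epsilon> / 2))) ^ Suc i"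
    if "Suc i \<le> N" for i
  proof -
    define r :: real where "r = 1 / 2 ^ Suc i"
    have r: "0 < r" "r \<le> 1" and r2: "1 / 2 ^ i = 2 * r" using one_le_power[of "2::real" "Suc i"] by (auto simp: r_def)
    have [measurable]: "energy r \<in> borel_measurable borel"
      by (intro borel_measurable_continuous_onI continuous_intros)
    have "ennreal (integral {\<theta> - r..\<theta> + r} (energy r))
       = (\<integral>\<^sup>+s. ennreal (energy r s * indicator {\<theta> - r..\<theta> + r} s) \<partial>lborel)"
    proof (rule nn_integral_has_integral_lborel[symmetric])
      show "((\<lambda>s. energy r s * indicat_real {\<theta> - r..\<theta> + r} s) has_integral integral {\<theta> - r..\<theta> + r} (energy r)) UNIV"
      proof -
        have "(\<lambda>s. energy r s * indicat_real {\<theta> - r..\<theta> + r} s) = (\<lambda>s. if s \<in> {\<theta> - r..\<theta> + r} then energy r s else 0)"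
          by (auto simp: indicator_def)
        then show ?thesis
          by (simp only: has_integral_restrict_UNIV) (intro integrable_integral integrable_continuous_real continuous_intros)
      qed
      show "(\<lambda>s. energy r s * indicat_real {\<theta> - r..\<theta> + r} s) \<in> borel_measurable borel"
        by measurable
    qed (simp add: energy_nonneg r)
    also have "\<dots> \<le> (\<integral>\<^sup>+\<theta>. indicator {- T..T} \<theta> * ennreal (energy r \<theta>) \<partial>lborel)"
      using \<theta> r by (intro nn_integral_mono) (auto simp: indicator_def abs_le_iff)
    also have "\<dots> \<le> ennreal (B * r powr (2 + \<epsilon>))" unfolding r_def by (rule en) (use that in auto)
    finally have int: "integral {\<theta> - r..\<theta> + r} (energy r) \<le> B * r powr (2 + \<epsilon>)"
      using B by (simp add: ennreal_le_iff)
    have "(averaged (1 / 2 ^ i) z \<theta> - averaged r z \<theta>)\<^sup>2 \<le> integral {\<theta> - r..\<theta> + r} (energy r) / (4 * r\<^sup>2)"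
      unfolding r2 by (rule averaged_step[OF r(1)])
    also have "\<dots> \<le> B * r powr (2 + \<epsilon>) / (1 * r\<^sup>2)" using int r B by (intro frac_le) auto
    also have "\<dots> = B * r powr \<epsilon>" using r by (simp add: powr_add powr_numeral)
    finally have "\<bar>averaged (1 / 2 ^ i) z \<theta> - averaged r z \<theta>\<bar> \<le> sqrt (B * r powr \<epsilon>)"
      by (intro real_le_rsqrt) simp
    also have "\<dots> = sqrt B * r powr (\<epsilon> / 2)"
      using r by (simp add: real_sqrt_mult powr_half_sqrt[symmetric] powr_powr)
    also have "r powr (\<epsilon> / 2) = (2 powr (- (\<epsilon> / 2))) ^ Suc i"
    proof -
      have "r = 2 powr (- real (Suc i))" by (simp add: r_def powr_minus powr_realpow inverse_eq_divide del: of_nat_Suc power_Suc)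
      then show ?thesis by (simp add: powr_powr powr_realpow[symmetric] mult_ac del: of_nat_Suc power_Suc)
    qed
    finally show ?thesis unfolding r_def .
  qed
  define q :: real where "q = 2 powr (- (\<epsilon> / 2))"
  have q: "0 < q" "q < 1" using \<epsilon> powr_less_mono[of "- (\<epsilon> / 2)" 0 2] by (auto simp: q_def)
  have "averaged (1 / 2 ^ j) z \<theta> \<le> 1 + sqrt B * (\<Sum>i<j. q ^ Suc i)" using j
  proof (induction j)
    case 0
    then show ?case using averaged_le[of 1 z \<theta>] by simp
  next
    case (Suc j)
    then show ?case using step[of j] by (simp add: q_def[symmetric] abs_le_iff algebra_simps)
  qed
  also have "(\<Sum>i<j. q ^ Suc i) \<le> 1 / (1 - q)"
  proof -
    have "(\<Sum>i<j. q ^ Suc i) \<le> (\<Sum>i<j. q ^ i)"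
      using q by (intro sum_mono) (simp add: mult_le_cancel_right1)
    also have "\<dots> \<le> 1 / (1 - q)"
      using q by (simp add: sum_gp_strict divide_right_mono)
    finally show ?thesis .
  qed
  finally show ?thesis using B by (simp add: q_def mult_left_mono)
qed

lemma strip_dyadic_le:
  assumes en: "\<And>i. 1 \<le> i \<Longrightarrow> i \<le> N \<Longrightarrow>
      (\<integral>\<^sup>+\<theta>. indicator {- T..T} \<theta> * ennreal (energy (1 / 2 ^ i) \<theta>) \<partial>lborel) \<le> ennreal (B * (1 / 2 ^ i) powr (2 + \<epsilon>))"
    and B: "0 \<le> B" and \<theta>: "\<bar>\<theta>\<bar> + 1 \<le> T" and \<epsilon>: "0 < \<epsilon>" and \<delta>: "1 / 2 ^ N \<le> \<delta>"
  shows "(\<Sum>w\<in>{w \<in> W. \<bar>y w + \<theta> * x w - z\<bar> \<le> \<delta>}. p w) \<le> 32 * X * (1 + sqrt B / (1 - 2 powr (- (\<epsilon> / 2)))) * \<delta>"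
proof -
  define C where "C = 1 + sqrt B / (1 - 2 powr (- (\<epsilon> / 2)))"
  have "(2::real) powr (- (\<epsilon> / 2)) < 1" using \<epsilon> powr_less_mono[of "- (\<epsilon> / 2)" 0 2] by auto
  then have C: "1 \<le> C" using B by (simp add: C_def)
  have d0: "0 < \<delta>" using \<delta> by (meson less_le_trans zero_less_divide_1_iff zero_less_numeral zero_less_power)
  show ?thesis
  \<comment> \<open>For large \<open>\<delta>\<close> the total mass 1 is a sufficient
    bound.\<close>
  proof (cases "1 / 2 < \<delta>")
    case True
    have "(\<Sum>w\<in>{w \<in> W. \<bar>y w + \<theta> * x w - z\<bar> \<le> \<delta>}. p w) \<le> sum p W"
      using finite_W p_nonneg by (intro sum_mono2) auto
    also have "\<dots> \<le> 32 * (1 * 1) * (1 / 2)" by (simp add: sum_p)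
    also have "\<dots> \<le> 32 * (X * C) * \<delta>" using True C X_ge_1 by (intro mult_mono) auto
    finally show ?thesis by (simp add: C_def mult_ac)
  next
    case False
    \<comment> \<open>The finest level at which \<open>r = 1 / 2 ^ j\<close> still satisfies
      \<open>\<delta> \<le> r / 2\<close>. Maximality gives \<open>r \<le> 4 * \<delta>\<close>,
      which turns the factor \<open>8 * X\<close> of \<open>strip_le_averaged\<close> into
      \<open>32 * X\<close>.\<close>
    define j where "j = (GREATEST j. \<delta> \<le> 1 / 2 ^ Suc j)"
    have bnd: "j < N" if "\<delta> \<le> 1 / 2 ^ Suc j" for j
    proof -
      have "(1::real) / 2 ^ N \<le> 1 / 2 ^ Suc j" using that \<delta> by linarith
      then have "(2::real) ^ Suc j \<le> 2 ^ N" by (simp add: divide_simps split: if_splits)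
      then show ?thesis by (metis Suc_le_eq one_less_numeral_iff power_le_imp_le_exp semiring_norm(76))
    qed
    have ex: "\<delta> \<le> 1 / 2 ^ Suc 0" using False by simp
    have j1: "\<delta> \<le> 1 / 2 ^ Suc j" unfolding j_def
      by (rule GreatestI_nat[where P = "\<lambda>j. \<delta> \<le> 1 / 2 ^ Suc j", OF ex]) (use bnd in \<open>auto dest: less_imp_le\<close>)
    have j2: "\<not> \<delta> \<le> 1 / 2 ^ Suc (Suc j)"
    proof
      assume "\<delta> \<le> 1 / 2 ^ Suc (Suc j)"
      then have "Suc j \<le> j" unfolding j_def
        by (rule Greatest_le_nat[where P = "\<lambda>j. \<delta> \<le> 1 / 2 ^ Suc j"]) (use bnd in \<open>auto dest: less_imp_le\<close>)
      then show False by simp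
    qed
    define r :: real where "r = 1 / 2 ^ j"
    have r: "0 < r" "\<delta> \<le> r / 2" "r \<le> 4 * \<delta>" using j1 j2 by (auto simp: r_def)
    have "(\<Sum>w\<in>{w \<in> W. \<bar>y w + \<theta> * x w - z\<bar> \<le> \<delta>}. p w) \<le> (\<Sum>w\<in>{w \<in> W. \<bar>y w + \<theta> * x w - z\<bar> \<le> r / 2}. p w)"
      using finite_W p_nonneg r(2) by (intro sum_mono2) auto
    also have "\<dots> \<le> 8 * X * r * averaged r z \<theta>" by (rule strip_le_averaged[OF r(1)])
    also have "\<dots> \<le> 8 * X * r * C" unfolding r_def C_def
      by (intro mult_left_mono averaged_dyadic_le[OF en B \<theta> \<epsilon> less_imp_le[OF bnd[OF j1]]]) (use X_ge_1 in auto)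
    also have "\<dots> \<le> 8 * X * (4 * \<delta>) * C" using r X_ge_1 C by (intro mult_right_mono mult_left_mono) auto
    finally show ?thesis by (simp add: C_def mult_ac)
  qed
qed

end

section \<open>Words and transversality\<close>

definition words :: "nat \<Rightarrow> 'i list set" where
  "words N = {w. length w = N}"

definition wprod :: "('i \<Rightarrow> real) \<Rightarrow> 'i list \<Rightarrow> real" where
  "wprod f w = (\<Prod>i\<leftarrow>w. f i)"

lemma wprod_simps [simp]:
  "wprod f [] = 1" "wprod f (i # w) = f i * wprod f w" "wprod f (u @ v) = wprod f u * wprod f v"
  by (simp_all add: wprod_def)

lemma wprod_pos: "(\<And>i. 0 < f i) \<Longrightarrow> 0 < wprod f w"
  by (induction w) auto

lemma wprod_abs: "\<bar>wprod f w\<bar> = wprod (\<lambda>i. \<bar>f i\<bar>) w"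
  by (induction w) (auto simp: abs_mult)

lemma wprod_abs_le_power:
  assumes "\<And>i. \<bar>f i\<bar> \<le> q"
  shows "\<bar>wprod f w\<bar> \<le> q ^ length w"
proof (induction w)
  case (Cons i w)
  then show ?case using assms[of i] abs_ge_zero[of "f i"] by (simp add: abs_mult mult_mono)
qed simp

lemma finite_words [simp]: "finite (words N :: 'i::finite list set)"
  using finite_lists_length_eq[of "UNIV :: 'i set" N] by (simp add: words_def)

lemma words_0 [simp]: "words 0 = {[]}"
  by (simp add: words_def)

lemma sum_words_add:
  "(\<Sum>w\<in>words (m + n). f w) = (\<Sum>u\<in>words m. \<Sum>v\<in>words n. f (u @ v :: 'i::finite list))"
proof -
  have "(\<Sum>u\<in>words m. \<Sum>v\<in>words n. f (u @ v)) = (\<Sum>(u, v)\<in>words m \<times> words n. f (u @ v))"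
    by (simp add: sum.cartesian_product)
  also have "\<dots> = (\<Sum>w\<in>words (m + n). f w)"
    by (rule sum.reindex_bij_witness[where j = "\<lambda>(u, v). u @ v" and i = "\<lambda>w. (take m w, drop m w)"])
       (auto simp: words_def)
  finally show ?thesis by simp
qed

lemma sum_words_Suc: "(\<Sum>w\<in>words (Suc N). f w) = (\<Sum>i\<in>UNIV. \<Sum>v\<in>words N. f (i # v :: 'i::finite list))"
proof -
  have "(\<Sum>i\<in>UNIV. \<Sum>v\<in>words N. f (i # v)) = (\<Sum>(i, v)\<in>UNIV \<times> words N. f (i # v))"
    by (simp add: sum.cartesian_product)
  also have "\<dots> = (\<Sum>w\<in>words (Suc N). f w)"
    by (rule sum.reindex_bij_witness[where j = "\<lambda>(i, v). i # v" and i = "\<lambda>w. (hd w, tl w)"])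
       (auto simp: words_def length_Suc_conv)
  finally show ?thesis by simp
qed

lemma sum_wprod: "(\<Sum>w\<in>words N. wprod f w) = (\<Sum>i\<in>UNIV. f (i :: 'i::finite)) ^ N"
proof (induction N)
  case (Suc N)
  have "(\<Sum>w\<in>words (Suc N). wprod f w) = (\<Sum>i\<in>UNIV. f i) * (\<Sum>w\<in>words N. wprod f w)"
    by (simp only: sum_words_Suc wprod_simps sum_product)
  then show ?case using Suc by simp
qed simp

text \<open>The vertical contraction ratio along the longest common prefix of the two words.\<close>

fun split_ratio :: "('i \<Rightarrow> real) \<Rightarrow> 'i list \<Rightarrow> 'i list \<Rightarrow> real" where
  "split_ratio c (i # v) (j # w) = (if i = j then \<bar>c i\<bar> * split_ratio c v w else 1)"
| "split_ratio c _ _ = 1"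

lemma split_ratio_pos: "(\<And>i. c i \<noteq> 0) \<Longrightarrow> 0 < split_ratio c v w"
  by (induction c v w rule: split_ratio.induct) auto

lemma split_ratio_same: "split_ratio c w w = \<bar>wprod c w\<bar>"
  by (induction w) (auto simp: abs_mult)

text \<open>Pairs with distinct first letters contribute at most 1 in total; a common first letter
  \<open>i\<close> reproduces the sum for \<open>N\<close> with the factor
  \<open>(p i)\<^sup>2 * \<bar>c i\<bar> powr (- q)\<close>. So each sum is at most
  \<open>1 + \<kappa>\<close> times the previous one added as \<open>1 + \<kappa> * S\<close>, a
  recursion with fixed point \<open>1 / (1 - \<kappa>)\<close>.\<close>

lemma sum_split_ratio_le:
  fixes p c :: "'i::finite \<Rightarrow> real"
  assumes p: "\<And>i. 0 \<le> p i" "(\<Sum>i\<in>UNIV. p i) = 1" and c: "\<And>i. c i \<noteq> 0"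
    and \<kappa>: "(\<Sum>i\<in>UNIV. (p i)\<^sup>2 * \<bar>c i\<bar> powr (- q)) \<le> \<kappa>" "\<kappa> < 1"
  shows "(\<Sum>v\<in>words N. \<Sum>w\<in>words N. wprod p v * wprod p w * split_ratio c v w powr (- q)) \<le> 1 / (1 - \<kappa>)"
proof (induction N)
  case 0
  have "0 \<le> \<kappa>" using \<kappa>(1) by (rule order_trans[rotated]) (auto intro!: sum_nonneg)
  then show ?case using \<kappa>(2) by simp
next
  case (Suc N)
  let ?g = "\<lambda>v w. wprod p v * wprod p w * split_ratio c v w powr (- q)"
  define S where "S = (\<Sum>v\<in>words N. \<Sum>w\<in>words N. ?g v w)"
  have wp: "0 \<le> wprod p v" for v by (induction v) (auto simp: p)
  have S0: "0 \<le> S" unfolding S_def by (intro sum_nonneg mult_nonneg_nonneg wp) auto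
  have *: "(\<Sum>v\<in>words N. \<Sum>w\<in>words N. ?g (i # v) (j # w)) \<le> p i * p j + (if i = j then (p i)\<^sup>2 * \<bar>c i\<bar> powr (- q) * S else 0)" for i j
  proof (cases "i = j")
    case True
    have "(\<Sum>v\<in>words N. \<Sum>w\<in>words N. ?g (i # v) (j # w)) = (p i)\<^sup>2 * \<bar>c i\<bar> powr (- q) * S"
      unfolding S_def using True
      by (simp add: sum_distrib_left powr_mult less_imp_le[OF split_ratio_pos[OF c]] power2_eq_square mult_ac)
    then show ?thesis using True p by simp
  next
    case False
    have "(\<Sum>v\<in>words N. \<Sum>w\<in>words N. ?g (i # v) (j # w)) = p i * p j * ((\<Sum>v\<in>words N. wprod p v) * (\<Sum>w\<in>words N. wprod p w))"
      using False by (simp add: sum_product sum_distrib_left mult_ac)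
    then show ?thesis using False p by (simp add: sum_wprod)
  qed
  have "(\<Sum>v\<in>words (Suc N). \<Sum>w\<in>words (Suc N). ?g v w)
     = (\<Sum>i\<in>UNIV. \<Sum>v\<in>words N. \<Sum>j\<in>UNIV. \<Sum>w\<in>words N. ?g (i # v) (j # w))"
    by (simp only: sum_words_Suc)
  also have "\<dots> = (\<Sum>i\<in>UNIV. \<Sum>j\<in>UNIV. \<Sum>v\<in>words N. \<Sum>w\<in>words N. ?g (i # v) (j # w))"
    by (intro sum.cong refl sum.swap)
  also have "\<dots> \<le> (\<Sum>i\<in>UNIV. \<Sum>j\<in>UNIV. p i * p j + (if i = j then (p i)\<^sup>2 * \<bar>c i\<bar> powr (- q) * S else 0))"
    by (intro sum_mono *)
  also have "\<dots> = (\<Sum>i\<in>UNIV. p i) * (\<Sum>i\<in>UNIV. p i) + (\<Sum>i\<in>UNIV. (p i)\<^sup>2 * \<bar>c i\<bar> powr (- q)) * S"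
    by (simp only: sum_product) (simp add: sum.distrib sum_distrib_right)
  also have "\<dots> \<le> 1 + \<kappa> * S" using \<kappa> S0 p by (simp add: mult_right_mono)
  also have "\<dots> \<le> 1 + \<kappa> * (1 / (1 - \<kappa>))"
  proof -
    have "0 \<le> \<kappa>" using \<kappa>(1) by (rule order_trans[rotated]) (auto intro!: sum_nonneg)
    then show ?thesis using Suc by (simp only: S_def add_left_mono mult_left_mono)
  qed
  also have "\<dots> = 1 / (1 - \<kappa>)" using \<kappa>(2) by (simp add: field_simps)
  finally show ?case .
qed

lemma powr_sum_less_nudge:
  fixes p c :: "'i::finite \<Rightarrow> real"
  assumes c: "\<And>i. c i \<noteq> 0" and s: "(\<Sum>i\<in>UNIV. (p i)\<^sup>2 * \<bar>c i\<bar> powr (- 3)) < 1"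
  obtains \<eta> where "0 < \<eta>" "\<eta> \<le> 1" "(\<Sum>i\<in>UNIV. (p i)\<^sup>2 * \<bar>c i\<bar> powr (- (3 + \<eta>))) < 1"
proof -
  have "((\<lambda>\<eta>. \<Sum>i\<in>UNIV. (p i)\<^sup>2 * \<bar>c i\<bar> powr (- (3 + \<eta>))) \<longlongrightarrow> (\<Sum>i\<in>UNIV. (p i)\<^sup>2 * \<bar>c i\<bar> powr (- (3 + 0)))) (at_right 0)"
    by (intro tendsto_intros) (use c in auto)
  then have "\<forall>\<^sub>F \<eta> in at_right 0. (\<Sum>i\<in>UNIV. (p i)\<^sup>2 * \<bar>c i\<bar> powr (- (3 + \<eta>))) < 1"
    by (rule order_tendstoD) (use s in simp)
  moreover have "\<forall>\<^sub>F \<eta> in at_right (0::real). \<eta> \<in> {0<..<1}" by (rule eventually_at_right_real) simp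
  ultimately have "\<forall>\<^sub>F \<eta> in at_right 0. (\<Sum>i\<in>UNIV. (p i)\<^sup>2 * \<bar>c i\<bar> powr (- (3 + \<eta>))) < 1 \<and> \<eta> \<in> {0<..<1}"
    by (rule eventually_conj)
  then obtain \<eta> where "(\<Sum>i\<in>UNIV. (p i)\<^sup>2 * \<bar>c i\<bar> powr (- (3 + \<eta>))) < 1" "\<eta> \<in> {0<..<1}"
    using eventually_happens[of _ "at_right (0::real)"] trivial_limit_at_right_real by blast
  then show ?thesis using that by auto
qed

section \<open>Word coding of the triangular system\<close>

locale triangular_IFS =
  fixes a b c t :: "'n::finite \<Rightarrow> real" and s :: real
  assumes coeffs: "0 < \<bar>a i\<bar>" "\<bar>a i\<bar> < \<bar>c i\<bar>" "\<bar>c i\<bar> < 1 / 2"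
    and s: "1 < s" "s \<le> 2"
    and dim: "(\<Sum>i\<in>UNIV. \<bar>c i\<bar> * \<bar>a i\<bar> powr (s - 1)) = 1"
    and small: "(\<Sum>i\<in>UNIV. inverse \<bar>c i\<bar> * \<bar>a i\<bar> powr (2 * (s - 1))) < 1"
begin

definition p :: "'n \<Rightarrow> real" where "p i = \<bar>c i\<bar> * \<bar>a i\<bar> powr (s - 1)"

definition \<gamma> :: real where "\<gamma> = Max (range (\<lambda>i. \<bar>c i\<bar>))"

text \<open>The factor 2 is the sum of the geometric series of ratio \<open>1 / 2\<close>, which
  dominates the ratios \<open>\<bar>a i\<bar>\<close>; the summand 1 provides the bound
  \<open>1 \<le> X\<close> asked for by \<open>weighted_points\<close>.\<close>

definition X :: real where "X = 1 + 2 * (\<Sum>i\<in>UNIV. \<bar>t i\<bar>)"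

primrec wx :: "'n list \<Rightarrow> real" where
  "wx [] = 0"
| "wx (i # w) = a i * wx w + t i"

primrec wlin :: "'n list \<Rightarrow> real ^ 'n" where
  "wlin [] = 0"
| "wlin (i # w) = axis i 1 + c i *\<^sub>R wlin w"

primrec woff :: "'n list \<Rightarrow> real" where
  "woff [] = 0"
| "woff (i # w) = b i * wx w + c i * woff w"

text \<open>\<open>(wx w, wy \<tau> w)\<close> is the image of the origin under the composition along \<open>w\<close>;
  its second coordinate is affine in \<open>\<tau>\<close>.\<close>

definition wy :: "real ^ 'n \<Rightarrow> 'n list \<Rightarrow> real" where
  "wy \<tau> w = wlin w \<bullet> \<tau> + woff w"

lemma wy_simps [simp]: "wy \<tau> [] = 0" "wy \<tau> (i # w) = b i * wx w + c i * wy \<tau> w + \<tau> $ i"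
  by (simp_all add: wy_def inner_left_distrib inner_axis' algebra_simps)

lemma a_nz: "a i \<noteq> 0" and c_nz: "c i \<noteq> 0"
  using coeffs[of i] by auto

lemma p_pos: "0 < p i"
  using a_nz[of i] c_nz[of i] by (simp add: p_def)

lemma sum_p: "(\<Sum>i\<in>UNIV. p i) = 1"
  using dim by (simp add: p_def)

lemma wprod_p: "wprod p w = \<bar>wprod c w\<bar> * \<bar>wprod a w\<bar> powr (s - 1)"
  by (induction w) (simp_all add: p_def abs_mult powr_mult)

lemma \<gamma>: "\<bar>c i\<bar> \<le> \<gamma>" "\<gamma> < 1 / 2" "0 < \<gamma>"
proof -
  show 1: "\<bar>c i\<bar> \<le> \<gamma>" for i by (simp add: \<gamma>_def)
  show "\<gamma> < 1 / 2" unfolding \<gamma>_def by (subst Max_less_iff) (use coeffs in auto)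
  show "0 < \<gamma>" by (rule less_le_trans[OF _ 1[of undefined]]) (use c_nz in simp)
qed

text \<open>Rewrites the hypothesis \<open>small\<close> as a bound on the sum of
  \<open>(p i)\<^sup>2 * \<bar>c i\<bar> powr (- 3)\<close>, the form in which the pair energies are
  added up.\<close>

lemma p2_c3: "(p i)\<^sup>2 * \<bar>c i\<bar> powr (- 3) = inverse \<bar>c i\<bar> * \<bar>a i\<bar> powr (2 * (s - 1))"
proof -
  have "(c i)\<^sup>2 * \<bar>c i\<bar> powr (- 3) = inverse \<bar>c i\<bar>"
  proof -
    have "\<bar>c i\<bar> powr 2 * \<bar>c i\<bar> powr (- 3) = \<bar>c i\<bar> powr (- 1)" by (simp only: powr_add[symmetric]) simp
    then show ?thesis using c_nz[of i] by (simp add: powr_minus powr_numeral)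
  qed
  moreover have "(\<bar>a i\<bar> powr (s - 1))\<^sup>2 = \<bar>a i\<bar> powr (2 * (s - 1))"
    using a_nz[of i] by (simp add: power2_eq_square powr_add[symmetric])
  moreover have "(p i)\<^sup>2 * \<bar>c i\<bar> powr (- 3) = ((c i)\<^sup>2 * \<bar>c i\<bar> powr (- 3)) * (\<bar>a i\<bar> powr (s - 1))\<^sup>2"
    by (simp add: p_def power_mult_distrib mult_ac)
  ultimately show ?thesis by simp
qed

lemma X_ge_1: "1 \<le> X"
  by (simp add: X_def sum_nonneg)

lemma wx_bound: "\<bar>wx w\<bar> \<le> X"
proof -
  have "\<bar>wx w\<bar> \<le> 2 * (\<Sum>i\<in>UNIV. \<bar>t i\<bar>)"
  proof (induction w)
    case (Cons i w)
    have "\<bar>a i * wx w\<bar> \<le> 1 / 2 * (2 * (\<Sum>i\<in>UNIV. \<bar>t i\<bar>))"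
      unfolding abs_mult using coeffs[of i] Cons by (intro mult_mono) auto
    moreover have "\<bar>t i\<bar> \<le> (\<Sum>i\<in>UNIV. \<bar>t i\<bar>)" by (rule member_le_sum) auto
    ultimately show ?case by simp
  qed (simp add: sum_nonneg)
  then show ?thesis by (simp add: X_def)
qed

lemma wx_append: "wx (u @ v) = wprod a u * wx v + wx u"
  by (induction u) (simp_all add: algebra_simps)

lemma weighted: "weighted_points (words N) (wprod p) wx X"
  by unfold_locales
     (use wx_bound X_ge_1 sum_wprod[of p N] sum_p less_imp_le[OF wprod_pos[OF p_pos]] in auto)

text \<open>Half of the worst case \<open>2 - 2 * \<gamma> / (1 - \<gamma>)\<close> in the proof of
  transversality; it is positive because \<open>\<gamma> < 1 / 2\<close>.\<close>

definition gap :: real where "gap = 1 - \<gamma> / (1 - \<gamma>)"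

lemma gap_pos: "0 < gap"
  using \<gamma>(2,3) by (simp add: gap_def field_simps)

text \<open>Each letter adds a unit vector scaled by the vertical ratio of the preceding letters, so
  the sum of absolute entries is dominated by a geometric series of ratio
  \<open>\<gamma>\<close>.\<close>

lemma wlin_sum_bound: "(\<Sum>k\<in>UNIV. \<bar>wlin w $ k\<bar>) \<le> 1 / (1 - \<gamma>)"
proof (induction w)
  case (Cons i w)
  have "(\<Sum>k\<in>UNIV. \<bar>wlin (i # w) $ k\<bar>) \<le> (\<Sum>k\<in>UNIV. \<bar>(axis i 1 :: real ^ 'n) $ k\<bar> + \<bar>c i\<bar> * \<bar>wlin w $ k\<bar>)"
    by (intro sum_mono) (auto simp: abs_mult[symmetric] abs_triangle_ineq)
  also have "\<dots> = 1 + \<bar>c i\<bar> * (\<Sum>k\<in>UNIV. \<bar>wlin w $ k\<bar>)"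
    by (simp add: sum.distrib sum_distrib_left axis_def if_distrib[of abs] cong: if_cong)
  also have "\<dots> \<le> 1 + \<gamma> * (1 / (1 - \<gamma>))"
    using Cons \<gamma> by (intro add_left_mono mult_mono) (auto simp: sum_nonneg)
  also have "\<dots> = 1 / (1 - \<gamma>)" using \<gamma>(2) by (simp add: field_simps)
  finally show ?case .
qed (use \<gamma> in simp)

text \<open>Common letters only rescale the difference of gradients. At the first distinct letters
  \<open>i\<close> and \<open>j\<close> the two unit vectors contribute 2 to the difference of the
  entries \<open>i\<close> and \<open>j\<close>, and the tails cannot cancel it; one of the two
  entries must then be large.\<close>

lemma transversality:
  assumes "length v = length w" "v \<noteq> w"
  shows "\<exists>k. gap * split_ratio c v w \<le> \<bar>(wlin v - wlin w) $ k\<bar>"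
  using assms
proof (induction v w rule: list_induct2)
  case (Cons i v j w)
  show ?case
  proof (cases "i = j")
    case True
    then obtain k where k: "gap * split_ratio c v w \<le> \<bar>(wlin v - wlin w) $ k\<bar>" using Cons by auto
    have "(wlin (i # v) - wlin (j # w)) $ k = c i * ((wlin v - wlin w) $ k)" using True by (simp add: algebra_simps)
    then show ?thesis using True mult_left_mono[OF k, of "\<bar>c i\<bar>"]
      by (intro exI[of _ k]) (simp add: abs_mult mult_ac)
  next
    case False
    let ?d = "wlin (i # v) - wlin (j # w)"
    \<comment> \<open>Comparing two entries is what reaches \<open>1 / 2\<close>: estimating one
      entry alone in the same way gives only \<open>1 - 2 * \<gamma> / (1 - \<gamma>)\<close>, which
      is positive just for \<open>\<gamma> < 1 / 3\<close>.\<close>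
    have two: "\<bar>c k\<bar> * \<bar>wlin u $ i - wlin u $ j\<bar> \<le> \<gamma> * (1 / (1 - \<gamma>))" for k u
    proof (intro mult_mono \<gamma>)
      have "\<bar>wlin u $ i - wlin u $ j\<bar> \<le> (\<Sum>k\<in>{i, j}. \<bar>wlin u $ k\<bar>)" using False by simp
      also have "\<dots> \<le> (\<Sum>k\<in>UNIV. \<bar>wlin u $ k\<bar>)" by (intro sum_mono2) auto
      finally show "\<bar>wlin u $ i - wlin u $ j\<bar> \<le> 1 / (1 - \<gamma>)" using wlin_sum_bound[of u] by linarith
    qed (use \<gamma> in auto)
    have "?d $ i - ?d $ j = 2 + c i * (wlin v $ i - wlin v $ j) - c j * (wlin w $ i - wlin w $ j)"
      using False by (simp add: axis_def algebra_simps)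
    moreover have "\<bar>c i * (wlin v $ i - wlin v $ j)\<bar> \<le> \<gamma> / (1 - \<gamma>)" "\<bar>c j * (wlin w $ i - wlin w $ j)\<bar> \<le> \<gamma> / (1 - \<gamma>)"
      unfolding abs_mult using two by simp_all
    ultimately have "2 * gap \<le> ?d $ i - ?d $ j" unfolding gap_def by argo
    then have "gap \<le> \<bar>?d $ i\<bar> \<or> gap \<le> \<bar>?d $ j\<bar>" by linarith
    moreover have "gap * split_ratio c (i # v) (j # w) = gap" using False by simp
    ultimately show ?thesis by metis
  qed
qed simp

section \<open>Mean energy over translation vectors\<close>

abbreviation energy :: "nat \<Rightarrow> real ^ 'n \<Rightarrow> real \<Rightarrow> real \<Rightarrow> real" where
  "energy N \<tau> \<equiv> weighted_points.energy (words N) (wprod p) wx (wy \<tau>)"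

lemmas energy_eq = weighted_points.energy_def[OF weighted]

lemma energy_measurable [measurable]:
  "(\<lambda>(\<tau>, \<theta>). energy N \<tau> r \<theta>) \<in> borel_measurable (borel \<Otimes>\<^sub>M borel)"
  unfolding energy_eq wy_def by measurable

text \<open>Each pair of words with split ratio \<open>\<sigma>\<close> contributes on average at
  most a multiple of \<open>r powr (2 + \<eta>) * \<sigma> powr (- (3 + \<eta>))\<close>, and
  \<open>sum_split_ratio_le\<close> adds these contributions uniformly in \<open>N\<close>.\<close>

lemma energy_bound:
  assumes \<eta>: "0 < \<eta>" "\<eta> \<le> 1" and \<kappa>: "(\<Sum>i\<in>UNIV. (p i)\<^sup>2 * \<bar>c i\<bar> powr (- (3 + \<eta>))) < 1" and R: "1 \<le> R"
  shows "\<exists>C\<ge>0. \<forall>N i \<theta>. i \<le> N \<longrightarrow>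
    integrable lborel (\<lambda>\<tau>. cutoff R \<tau> * energy N \<tau> (1 / 2 ^ i) \<theta>) \<and>
    (\<integral>\<tau>. cutoff R \<tau> * energy N \<tau> (1 / 2 ^ i) \<theta> \<partial>lborel) \<le> C * (1 / 2 ^ i) powr (2 + \<eta>)"
proof -
  define V where "V S = measure lborel (cube S :: (real ^ 'n) set)" for S
  have V0: "0 \<le> V S" for S by (simp add: V_def)
  define C1 where "C1 = 10080 * V (R + 3) / gap * (3 * X / gap) powr (2 + \<eta>)"
  define C2 where "C2 = C1 + 2 * V R"
  have C1: "0 \<le> C1" using V0 gap_pos by (simp add: C1_def)
  have C2: "0 \<le> C2" using C1 V0 by (simp add: C2_def)
  define K where "K = (\<lambda>r \<theta> v w \<tau>. \<Sum>m\<in>steps. \<Sum>m'\<in>steps. step_coeff m * step_coeff m' *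
      hat r (wy \<tau> v + \<theta> * wx v + step_shift r (wx v) m - (wy \<tau> w + \<theta> * wx w + step_shift r (wx w) m')))"
  have mK [measurable]: "K r \<theta> v w \<in> borel_measurable borel" for r \<theta> v w
    unfolding K_def wy_def by measurable
  have bK: "\<bar>K r \<theta> v w \<tau>\<bar> \<le> 2 / r" if "0 < r" for r \<theta> v w \<tau>
    unfolding K_def by (rule step_kernel_bound[OF that])
  have iK: "integrable lborel (\<lambda>\<tau>. cutoff R \<tau> * K r \<theta> v w \<tau>)" if "0 < r" for r \<theta> v w
    by (rule integrable_cutoff_mult(1)[OF mK bK[OF that]]) (use R in auto)
  have pair: "(\<integral>\<tau>. cutoff R \<tau> * K r \<theta> v w \<tau> \<partial>lborel) \<le> C2 * r powr (2 + \<eta>) * split_ratio c v w powr (- (3 + \<eta>))"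
    if r: "0 < r" "1 / 2 ^ N \<le> r" and vw: "v \<in> words N" "w \<in> words N" for N r \<theta> v w
  proof (cases "v = w")
    \<comment> \<open>A word paired with itself has no transversality, but its ratio satisfies
      \<open>\<sigma> \<le> 1 / 2 ^ N \<le> r\<close>. Hence the trivial bound of order
      \<open>1 / r\<close> already has the required form; this is where \<open>i \<le> N\<close>
      enters.\<close>
    case True
    define \<sigma> where "\<sigma> = split_ratio c v w"
    have "\<sigma> \<le> \<gamma> ^ N"
      unfolding \<sigma>_def True split_ratio_same using wprod_abs_le_power[of c \<gamma> w] \<gamma>(1) vw by (simp add: words_def)
    also have "\<dots> \<le> (1 / 2) ^ N" using \<gamma> by (intro power_mono) auto
    also have "\<dots> \<le> r" using r by (simp add: power_one_over)
    finally have \<sigma>: "\<sigma> \<le> r" "0 < \<sigma>" using split_ratio_pos[of c, OF c_nz] by (simp_all add: \<sigma>_def)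
    have "(\<integral>\<tau>. cutoff R \<tau> * K r \<theta> v w \<tau> \<partial>lborel) \<le> 2 / r * V R"
      unfolding V_def by (rule integrable_cutoff_mult(2)[OF mK bK[OF r(1)]]) (use R in auto)
    also have "2 / r * V R = 2 * V R * (r powr (2 + \<eta>) * r powr (- (3 + \<eta>)))"
    proof -
      have "1 / r = r powr (2 + \<eta>) * r powr (- (3 + \<eta>))"
        using r by (simp add: powr_add[symmetric] powr_minus_divide)
      then show ?thesis by (metis times_divide_eq_left times_divide_eq_right mult.commute mult_1)
    qed
    also have "\<dots> \<le> 2 * V R * (r powr (2 + \<eta>) * \<sigma> powr (- (3 + \<eta>)))"
      using \<sigma> r V0 \<eta> by (intro mult_left_mono powr_mono2') auto
    also have "\<dots> \<le> C2 * (r powr (2 + \<eta>) * \<sigma> powr (- (3 + \<eta>)))"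
      using C1 by (intro mult_right_mono) (auto simp: C2_def)
    finally show ?thesis by (simp add: \<sigma>_def mult.assoc)
  next
    case False
    define \<sigma> where "\<sigma> = split_ratio c v w"
    have \<sigma>: "0 < \<sigma>" using split_ratio_pos[of c, OF c_nz] by (simp add: \<sigma>_def)
    obtain k where k: "gap * \<sigma> \<le> \<bar>(wlin v - wlin w) $ k\<bar>"
      using transversality[of v w] False vw by (auto simp: words_def \<sigma>_def)
    define D where "D = wlin v - wlin w"
    define \<beta> where "\<beta> = woff v + \<theta> * wx v - woff w - \<theta> * wx w"
    have Keq: "K r \<theta> v w \<tau> = (\<Sum>m\<in>steps. \<Sum>m'\<in>steps. step_coeff m * step_coeff m' *
        hat r (D \<bullet> \<tau> + \<beta> + step_shift r (wx v) m - step_shift r (wx w) m'))" for \<tau>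
      unfolding K_def by (intro sum.cong refl arg_cong2[where f = "(*)"] arg_cong[where f = "hat r"])
        (simp add: wy_def D_def \<beta>_def inner_diff_left)
    \<comment> \<open>Transversality supplies \<open>l = gap * \<sigma>\<close>,
      \<open>step_shift_bound\<close> supplies \<open>G = 3 * X * r\<close>, and the exponent is
      taken as \<open>e = 2 + \<eta>\<close>.\<close>
    have "(\<integral>\<tau>. cutoff R \<tau> * K r \<theta> v w \<tau> \<partial>lborel)
       \<le> 10080 * V (R + 3) / (gap * \<sigma>) * (3 * X * r / (gap * \<sigma>)) powr (2 + \<eta>)"
      unfolding Keq V_def
      by (rule order_trans[OF abs_ge_self hat_difference_energy[where k = k]])
         (use step_moments step_shift_bound[OF _ wx_bound X_ge_1 r(1)] r R X_ge_1 gap_pos \<sigma> k \<eta> in \<open>auto simp: D_def\<close>)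
    also have "(3 * X * r / (gap * \<sigma>)) powr (2 + \<eta>) = (3 * X / gap) powr (2 + \<eta>) * r powr (2 + \<eta>) * \<sigma> powr (- (2 + \<eta>))"
      unfolding powr_minus_divide using X_ge_1 gap_pos \<sigma> r by (simp add: powr_mult powr_divide)
    also have "10080 * V (R + 3) / (gap * \<sigma>) * \<dots> = C1 * r powr (2 + \<eta>) * (\<sigma> powr (- 1) * \<sigma> powr (- (2 + \<eta>)))"
      using \<sigma> by (simp add: C1_def powr_minus_divide)
    also have "\<sigma> powr (- 1) * \<sigma> powr (- (2 + \<eta>)) = \<sigma> powr (- (3 + \<eta>))"
      unfolding powr_add[symmetric] by (rule arg_cong[where f = "\<lambda>x. \<sigma> powr x"]) simp
    also have "C1 * r powr (2 + \<eta>) * \<dots> \<le> C2 * r powr (2 + \<eta>) * \<sigma> powr (- (3 + \<eta>))"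
      using V0 by (intro mult_right_mono) (auto simp: C2_def)
    finally show ?thesis by (simp add: \<sigma>_def)
  qed
  define \<kappa>' where "\<kappa>' = (\<Sum>i\<in>UNIV. (p i)\<^sup>2 * \<bar>c i\<bar> powr (- (3 + \<eta>)))"
  define C where "C = C2 * (1 / (1 - \<kappa>'))"
  have "integrable lborel (\<lambda>\<tau>. cutoff R \<tau> * energy N \<tau> (1 / 2 ^ i) \<theta>) \<and>
    (\<integral>\<tau>. cutoff R \<tau> * energy N \<tau> (1 / 2 ^ i) \<theta> \<partial>lborel) \<le> C * (1 / 2 ^ i) powr (2 + \<eta>)" if iN: "i \<le> N" for N i \<theta>
  proof -
    define r :: real where "r = 1 / 2 ^ i"
    have r: "0 < r" "1 / 2 ^ N \<le> r" using iN by (auto simp: r_def divide_le_cancel frac_le power_increasing)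
    have eq: "(\<lambda>\<tau>. cutoff R \<tau> * energy N \<tau> r \<theta>) =
       (\<lambda>\<tau>. \<Sum>v\<in>words N. \<Sum>w\<in>words N. wprod p v * wprod p w * (cutoff R \<tau> * K r \<theta> v w \<tau>))"
      unfolding energy_eq K_def by (simp add: sum_distrib_left mult_ac)
    have "(\<integral>\<tau>. cutoff R \<tau> * energy N \<tau> r \<theta> \<partial>lborel)
       = (\<Sum>v\<in>words N. \<Sum>w\<in>words N. wprod p v * wprod p w * (\<integral>\<tau>. cutoff R \<tau> * K r \<theta> v w \<tau> \<partial>lborel))"
      unfolding eq using iK[OF r(1)] by simp
    also have "\<dots> \<le> (\<Sum>v\<in>words N. \<Sum>w\<in>words N. wprod p v * wprod p w * (C2 * r powr (2 + \<eta>) * split_ratio c v w powr (- (3 + \<eta>))))"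
      by (intro sum_mono mult_left_mono pair[OF r] mult_nonneg_nonneg less_imp_le[OF wprod_pos[OF p_pos]])
    also have "\<dots> = C2 * r powr (2 + \<eta>) * (\<Sum>v\<in>words N. \<Sum>w\<in>words N. wprod p v * wprod p w * split_ratio c v w powr (- (3 + \<eta>)))"
      by (simp add: sum_distrib_left mult_ac)
    also have "\<dots> \<le> C2 * r powr (2 + \<eta>) * (1 / (1 - \<kappa>'))"
      using C2 \<kappa> sum_p c_nz less_imp_le[OF p_pos] by (intro mult_left_mono sum_split_ratio_le) (auto simp: \<kappa>'_def)
    finally have "(\<integral>\<tau>. cutoff R \<tau> * energy N \<tau> r \<theta> \<partial>lborel) \<le> C * r powr (2 + \<eta>)" by (simp add: C_def mult_ac)
    moreover have "integrable lborel (\<lambda>\<tau>. cutoff R \<tau> * energy N \<tau> r \<theta>)"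
      unfolding eq using iK[OF r(1)] by (intro Bochner_Integration.integrable_sum integrable_mult_right)
    ultimately show ?thesis by (simp add: r_def)
  qed
  moreover have "0 \<le> C" using C2 \<kappa> by (simp add: C_def \<kappa>'_def)
  ultimately show ?thesis by blast
qed

end

section \<open>Almost every translation vector\<close>

context triangular_IFS
begin

text \<open>By Fubini and \<open>energy_bound\<close>, the scales contribute a geometric series to
  the mean of \<open>Q N\<close>, so these means are bounded in \<open>N\<close>. Fatou's lemma
  makes the limit inferior finite almost everywhere, which gives a common bound for infinitely many
  lengths.\<close>

lemma AE_energy_bounded_on_cube:
  assumes \<eta>: "0 < \<eta>" "\<eta> \<le> 1" and \<kappa>: "(\<Sum>i\<in>UNIV. (p i)\<^sup>2 * \<bar>c i\<bar> powr (- (3 + \<eta>))) < 1"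
    and R: "1 \<le> R" and T: "0 \<le> T" and \<epsilon>: "\<epsilon> = \<eta> / 2"
  shows "AE \<tau> in lborel. (\<forall>j. \<bar>\<tau> $ j\<bar> < R) \<longrightarrow>
    (\<exists>B\<ge>0. \<forall>N0. \<exists>N\<ge>N0. \<forall>i. 1 \<le> i \<longrightarrow> i \<le> N \<longrightarrow>
      (\<integral>\<^sup>+\<theta>. indicator {- T..T} \<theta> * ennreal (energy N \<tau> (1 / 2 ^ i) \<theta>) \<partial>lborel) \<le> ennreal (B * (1 / 2 ^ i) powr (2 + \<epsilon>)))"
proof -
  obtain C where C: "0 \<le> C" and
    EB: "\<And>N i \<theta>. i \<le> N \<Longrightarrow> integrable lborel (\<lambda>\<tau>. cutoff R \<tau> * energy N \<tau> (1 / 2 ^ i) \<theta>)"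
      "\<And>N i \<theta>. i \<le> N \<Longrightarrow> (\<integral>\<tau>. cutoff R \<tau> * energy N \<tau> (1 / 2 ^ i) \<theta> \<partial>lborel) \<le> C * (1 / 2 ^ i) powr (2 + \<eta>)"
    using energy_bound[OF \<eta> \<kappa> R] by blast
  define r :: "nat \<Rightarrow> real" where "r i = 1 / 2 ^ i" for i
  have r: "0 < r i" for i by (simp add: r_def)
  define q where "q N i \<tau> = (\<integral>\<^sup>+\<theta>. indicator {- T..T} \<theta> * ennreal (energy N \<tau> (r i) \<theta>) \<partial>lborel)" for N i \<tau>
  have [measurable]: "q N i \<in> borel_measurable borel" for N i
    unfolding q_def by measurable
  \<comment> \<open>All scales are put into one weighted sum, so that a single limit inferior
    controls every \<open>i \<le> N\<close> with the same constant.\<close>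
  define Q where "Q N \<tau> = (\<Sum>i=1..N. ennreal (r i powr (- (2 + \<epsilon>))) * q N i \<tau>)" for N \<tau>
  have [measurable]: "Q N \<in> borel_measurable borel" for N unfolding Q_def by measurable
  have en0: "0 \<le> energy N \<tau> (r i) \<theta>" for N \<tau> i \<theta>
    by (rule weighted_points.energy_nonneg[OF weighted r])
  have q_int: "(\<integral>\<^sup>+\<tau>. ennreal (cutoff R \<tau>) * q N i \<tau> \<partial>lborel) \<le> ennreal (2 * T * C * r i powr (2 + \<eta>))" if "i \<le> N" for N i
  proof -
    have "(\<integral>\<^sup>+\<tau>. ennreal (cutoff R \<tau>) * q N i \<tau> \<partial>lborel)
       = (\<integral>\<^sup>+\<tau>. (\<integral>\<^sup>+\<theta>. indicator {- T..T} \<theta> * ennreal (cutoff R \<tau> * energy N \<tau> (r i) \<theta>) \<partial>lborel) \<partial>lborel)"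
      unfolding q_def
      by (intro nn_integral_cong, subst nn_integral_cmult[symmetric])
         (auto intro!: nn_integral_cong simp: ennreal_mult cutoff_nonneg en0 mult_ac)
    also have "\<dots> = (\<integral>\<^sup>+\<theta>. (\<integral>\<^sup>+\<tau>. indicator {- T..T} \<theta> * ennreal (cutoff R \<tau> * energy N \<tau> (r i) \<theta>) \<partial>lborel) \<partial>lborel)"
      by (rule lborel_pair.Fubini') measurable
    also have "\<dots> = (\<integral>\<^sup>+\<theta>. indicator {- T..T} \<theta> * (\<integral>\<^sup>+\<tau>. ennreal (cutoff R \<tau> * energy N \<tau> (r i) \<theta>) \<partial>lborel) \<partial>lborel)"
      by (intro nn_integral_cong nn_integral_cmult) measurable
    also have "\<dots> \<le> (\<integral>\<^sup>+\<theta>. indicator {- T..T} \<theta> * ennreal (C * r i powr (2 + \<eta>)) \<partial>lborel)"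
    proof (intro nn_integral_mono mult_left_mono)
      fix \<theta>
      have "(\<integral>\<^sup>+\<tau>. ennreal (cutoff R \<tau> * energy N \<tau> (r i) \<theta>) \<partial>lborel) = ennreal (\<integral>\<tau>. cutoff R \<tau> * energy N \<tau> (r i) \<theta> \<partial>lborel)"
        using EB(1)[OF that] by (intro nn_integral_eq_integral) (auto simp: r_def[symmetric] cutoff_nonneg en0)
      also have "\<dots> \<le> ennreal (C * r i powr (2 + \<eta>))" using EB(2)[OF that] by (intro ennreal_leI) (simp add: r_def)
      finally show "(\<integral>\<^sup>+\<tau>. ennreal (cutoff R \<tau> * energy N \<tau> (r i) \<theta>) \<partial>lborel) \<le> ennreal (C * r i powr (2 + \<eta>))" .
    qed simp
    also have "\<dots> = ennreal (2 * T * C * r i powr (2 + \<eta>))"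
      using T C by (simp add: nn_integral_multc ennreal_mult'[symmetric] mult_ac)
    finally show ?thesis .
  qed
  \<comment> \<open>Since \<open>\<eta> = 2 * \<epsilon>\<close>, the product of
    \<open>r i powr (- (2 + \<epsilon>))\<close> and \<open>r i powr (2 + \<eta>)\<close> is
    \<open>r i powr \<epsilon> = g ^ i\<close>.\<close>
  define g :: real where "g = 2 powr (- \<epsilon>)"
  have g: "0 < g" "g < 1" using \<eta> \<epsilon> powr_less_mono[of "- \<epsilon>" 0 2] by (auto simp: g_def)
  define Z where "Z = 2 * T * C / (1 - g)"
  have Q_int: "(\<integral>\<^sup>+\<tau>. ennreal (cutoff R \<tau>) * Q N \<tau> \<partial>lborel) \<le> ennreal Z" for N
  proof -
    have "(\<integral>\<^sup>+\<tau>. ennreal (cutoff R \<tau>) * Q N \<tau> \<partial>lborel)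
       = (\<Sum>i=1..N. ennreal (r i powr (- (2 + \<epsilon>))) * (\<integral>\<^sup>+\<tau>. ennreal (cutoff R \<tau>) * q N i \<tau> \<partial>lborel))"
      unfolding Q_def
      by (subst nn_integral_cmult[symmetric] nn_integral_sum[symmetric], measurable)+
         (simp add: sum_distrib_left mult_ac)
    also have "\<dots> \<le> (\<Sum>i=1..N. ennreal (r i powr (- (2 + \<epsilon>))) * ennreal (2 * T * C * r i powr (2 + \<eta>)))"
      by (intro sum_mono mult_left_mono q_int) auto
    also have "\<dots> = (\<Sum>i=1..N. ennreal (2 * T * C * g ^ i))"
    proof (intro sum.cong refl)
      fix i
      have ri: "r i = 2 powr (- real i)" by (simp add: r_def powr_minus powr_realpow inverse_eq_divide)
      have "r i powr (- (2 + \<epsilon>)) * r i powr (2 + \<eta>) = r i powr \<epsilon>"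
        unfolding powr_add[symmetric] by (simp add: \<epsilon>)
      also have "\<dots> = g ^ i" using g by (simp add: ri g_def powr_powr powr_realpow[symmetric] mult_ac)
      finally have "r i powr (- (2 + \<epsilon>)) * (2 * T * C * r i powr (2 + \<eta>)) = 2 * T * C * g ^ i"
        by (simp only: mult.left_commute[of "r i powr (- (2 + \<epsilon>))"])
      then show "ennreal (r i powr (- (2 + \<epsilon>))) * ennreal (2 * T * C * r i powr (2 + \<eta>)) = ennreal (2 * T * C * g ^ i)"
        by (subst ennreal_mult'[symmetric]) (simp, simp only:)
    qed
    also have "\<dots> = ennreal (2 * T * C * (\<Sum>i=1..N. g ^ i))"
      using T C g by (simp add: sum_ennreal sum_distrib_left)
    also have "\<dots> \<le> ennreal (2 * T * C * (1 / (1 - g)))"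
    proof (intro ennreal_leI mult_left_mono)
      have "(\<Sum>i=1..N. g ^ i) \<le> (\<Sum>i<Suc N. g ^ i)" using g by (intro sum_mono2) auto
      also have "\<dots> \<le> 1 / (1 - g)" unfolding sum_gp_strict using g by (simp add: divide_right_mono)
      finally show "(\<Sum>i=1..N. g ^ i) \<le> 1 / (1 - g)" .
    qed (use T C in auto)
    finally show ?thesis by (simp add: Z_def)
  qed
  have "(\<integral>\<^sup>+\<tau>. liminf (\<lambda>N. ennreal (cutoff R \<tau>) * Q N \<tau>) \<partial>lborel) \<le> liminf (\<lambda>N. \<integral>\<^sup>+\<tau>. ennreal (cutoff R \<tau>) * Q N \<tau> \<partial>lborel)"
    by (rule nn_integral_liminf) measurable
  also have "\<dots> \<le> liminf (\<lambda>N. ennreal Z)" by (intro Liminf_mono always_eventually allI Q_int)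
  also have "\<dots> = ennreal Z" by (simp add: Liminf_const)
  finally have "(\<integral>\<^sup>+\<tau>. liminf (\<lambda>N. ennreal (cutoff R \<tau>) * Q N \<tau>) \<partial>lborel) \<noteq> \<infinity>"
    by (auto simp: top_unique)
  then have "AE \<tau> in lborel. liminf (\<lambda>N. ennreal (cutoff R \<tau>) * Q N \<tau>) \<noteq> \<infinity>"
    by (intro nn_integral_noteq_infinite) measurable
  then show ?thesis
  proof (rule AE_mp, intro AE_I2 impI)
    fix \<tau> :: "real ^ 'n"
    assume fin: "liminf (\<lambda>N. ennreal (cutoff R \<tau>) * Q N \<tau>) \<noteq> \<infinity>" and \<tau>: "\<forall>j. \<bar>\<tau> $ j\<bar> < R"
    define k where "k = cutoff R \<tau>"
    \<comment> \<open>The strict inequalities on the coordinates of \<open>\<tau>\<close> make the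
      cutoff positive, so it can be divided out of the bound.\<close>
    have k: "0 < k" unfolding k_def using \<tau> by (intro cutoff_pos) auto
    obtain M where M: "0 \<le> M" "liminf (\<lambda>N. ennreal k * Q N \<tau>) = ennreal M"
      using fin unfolding k_def by (cases "liminf (\<lambda>N. ennreal (cutoff R \<tau>) * Q N \<tau>)") auto
    have freq: "\<exists>N\<ge>N0. ennreal k * Q N \<tau> < ennreal (M + 1)" for N0
    proof (rule ccontr)
      assume "\<not> ?thesis"
      then have "\<forall>\<^sub>F N in sequentially. ennreal (M + 1) \<le> ennreal k * Q N \<tau>"
        unfolding eventually_sequentially by (auto simp: not_less)
      then have "ennreal (M + 1) \<le> ennreal M" unfolding M(2)[symmetric] by (rule Liminf_bounded)
      then show False using M(1) by (simp add: ennreal_le_iff)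
    qed
    show "\<exists>B\<ge>0. \<forall>N0. \<exists>N\<ge>N0. \<forall>i. 1 \<le> i \<longrightarrow> i \<le> N \<longrightarrow>
      (\<integral>\<^sup>+\<theta>. indicator {- T..T} \<theta> * ennreal (energy N \<tau> (1 / 2 ^ i) \<theta>) \<partial>lborel) \<le> ennreal (B * (1 / 2 ^ i) powr (2 + \<epsilon>))"
    proof (intro exI[of _ "(M + 1) / k"] conjI allI)
      show "0 \<le> (M + 1) / k" using M(1) k by simp
      fix N0
      obtain N where N: "N \<ge> N0" "ennreal k * Q N \<tau> < ennreal (M + 1)" using freq by blast
      have "(\<integral>\<^sup>+\<theta>. indicator {- T..T} \<theta> * ennreal (energy N \<tau> (1 / 2 ^ i) \<theta>) \<partial>lborel) \<le> ennreal ((M + 1) / k * (1 / 2 ^ i) powr (2 + \<epsilon>))"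
        if i: "1 \<le> i" "i \<le> N" for i
      proof -
        define v where "v = k * r i powr (- (2 + \<epsilon>))"
        have v: "0 < v" using k r[of i] by (simp add: v_def)
        have "ennreal v * q N i \<tau> = ennreal k * (ennreal (r i powr (- (2 + \<epsilon>))) * q N i \<tau>)"
          using k by (simp add: v_def ennreal_mult mult.assoc)
        also have "\<dots> \<le> ennreal k * Q N \<tau>"
          unfolding Q_def by (intro mult_left_mono member_le_sum) (use i in auto)
        also have "\<dots> \<le> ennreal (M + 1)" using N(2) by simp
        finally have *: "ennreal v * q N i \<tau> \<le> ennreal (M + 1)" .
        have "q N i \<tau> = ennreal (1 / v) * (ennreal v * q N i \<tau>)"
          using v by (simp add: mult.assoc[symmetric] ennreal_mult'[symmetric])
        also have "\<dots> \<le> ennreal (1 / v) * ennreal (M + 1)" by (intro mult_left_mono *) simp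
        also have "\<dots> = ennreal ((M + 1) / k * r i powr (2 + \<epsilon>))"
        proof -
          have "1 / v * (M + 1) = (M + 1) / k * r i powr (2 + \<epsilon>)"
            unfolding v_def powr_minus_divide using k r[of i] by simp
          then show ?thesis using v by (subst ennreal_mult'[symmetric]) simp_all
        qed
        finally show ?thesis by (simp add: q_def r_def)
      qed
      then show "\<exists>N\<ge>N0. \<forall>i. 1 \<le> i \<longrightarrow> i \<le> N \<longrightarrow>
        (\<integral>\<^sup>+\<theta>. indicator {- T..T} \<theta> * ennreal (energy N \<tau> (1 / 2 ^ i) \<theta>) \<partial>lborel) \<le> ennreal ((M + 1) / k * (1 / 2 ^ i) powr (2 + \<epsilon>))"
        using N(1) by blast
    qed
  qed
qed

text \<open>The lower left entry of the product of the linear parts along the word.\<close>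

primrec wb :: "'n list \<Rightarrow> real" where
  "wb [] = 0"
| "wb (i # w) = b i * wprod a w + c i * wb w"

lemma wy_append: "wy \<tau> (u @ v) = wprod c u * wy \<tau> v + wb u * wx v + wy \<tau> u"
  by (induction u) (simp_all add: wx_append algebra_simps)

text \<open>Relative to \<open>\<bar>wprod c u\<bar>\<close>, a letter followed by \<open>n\<close>
  others adds at most \<open>H * \<rho> ^ n\<close>, because
  \<open>\<bar>a i\<bar> \<le> \<rho> * \<bar>c i\<bar>\<close> with \<open>\<rho> < 1\<close>. The
  quotient of \<open>wb u\<close> and \<open>wprod c u\<close> is the slope of a strip pulled back
  along \<open>u\<close>, so slopes stay in a compact interval.\<close>

lemma wb_bound: "\<exists>K\<ge>0. \<forall>u. \<bar>wb u\<bar> \<le> K * \<bar>wprod c u\<bar>"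
proof -
  define \<rho> where "\<rho> = Max (range (\<lambda>i. \<bar>a i\<bar> / \<bar>c i\<bar>))"
  have \<rho>: "\<bar>a i\<bar> / \<bar>c i\<bar> \<le> \<rho>" for i by (simp add: \<rho>_def)
  have \<rho>1: "\<rho> < 1" unfolding \<rho>_def by (subst Max_less_iff) (use coeffs c_nz in auto)
  have \<rho>0: "0 \<le> \<rho>" by (rule order_trans[OF _ \<rho>[of undefined]]) simp
  define H where "H = Max (range (\<lambda>i. \<bar>b i\<bar> / \<bar>c i\<bar>))"
  have H: "\<bar>b i\<bar> / \<bar>c i\<bar> \<le> H" for i by (simp add: H_def)
  have H0: "0 \<le> H" by (rule order_trans[OF _ H[of undefined]]) simp
  have ac: "\<bar>wprod a u\<bar> \<le> \<rho> ^ length u * \<bar>wprod c u\<bar>" for u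
  proof (induction u)
    case (Cons i u)
    have "\<bar>a i\<bar> * \<bar>wprod a u\<bar> \<le> (\<rho> * \<bar>c i\<bar>) * (\<rho> ^ length u * \<bar>wprod c u\<bar>)"
      using Cons \<rho>[of i] \<rho>0 c_nz[of i] by (intro mult_mono) (auto simp: divide_le_eq)
    then show ?case by (simp add: abs_mult mult_ac)
  qed simp
  \<comment> \<open>The induction carries the partial geometric sum, which makes the step close
    exactly.\<close>
  have "\<bar>wb u\<bar> \<le> H * (1 - \<rho> ^ length u) / (1 - \<rho>) * \<bar>wprod c u\<bar>" for u
  proof (induction u)
    case (Cons i u)
    let ?n = "length u"
    have "\<bar>wb (i # u)\<bar> \<le> \<bar>b i\<bar> * \<bar>wprod a u\<bar> + \<bar>c i\<bar> * \<bar>wb u\<bar>"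
      by (simp add: abs_mult[symmetric] abs_triangle_ineq)
    also have "\<dots> \<le> (H * \<bar>c i\<bar>) * (\<rho> ^ ?n * \<bar>wprod c u\<bar>) + \<bar>c i\<bar> * (H * (1 - \<rho> ^ ?n) / (1 - \<rho>) * \<bar>wprod c u\<bar>)"
      using H[of i] H0 c_nz[of i] by (intro add_mono mult_mono ac Cons) (auto simp: divide_le_eq)
    also have "\<dots> = H * (\<rho> ^ ?n + (1 - \<rho> ^ ?n) / (1 - \<rho>)) * \<bar>wprod c (i # u)\<bar>"
      by (simp add: abs_mult algebra_simps)
    also have "\<rho> ^ ?n + (1 - \<rho> ^ ?n) / (1 - \<rho>) = (1 - \<rho> ^ length (i # u)) / (1 - \<rho>)"
      using \<rho>1 by (simp add: field_simps)
    finally show ?case by simp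
  qed simp
  also have "H * (1 - \<rho> ^ length u) / (1 - \<rho>) * \<bar>wprod c u\<bar> \<le> H / (1 - \<rho>) * \<bar>wprod c u\<bar>" for u
    using H0 \<rho>0 \<rho>1 by (intro mult_right_mono divide_right_mono mult_left_le) auto
  finally show ?thesis using H0 \<rho>1 by (intro exI[of _ "H / (1 - \<rho>)"]) auto
qed

lemma wy_bound: "\<exists>Y\<ge>0. \<forall>w. \<bar>wy \<tau> w\<bar> \<le> Y"
proof -
  define E where "E = (\<Sum>i\<in>UNIV. \<bar>b i\<bar> * X + \<bar>\<tau> $ i\<bar>)"
  have E0: "0 \<le> E" using X_ge_1 by (auto simp: E_def intro!: sum_nonneg)
  have "\<bar>wy \<tau> w\<bar> \<le> 2 * E" for w
  proof (induction w)
    case (Cons i w)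
    have "\<bar>c i * wy \<tau> w\<bar> \<le> 1 / 2 * (2 * E)"
      unfolding abs_mult using coeffs[of i] Cons by (intro mult_mono) auto
    moreover have "\<bar>b i * wx w\<bar> \<le> \<bar>b i\<bar> * X" unfolding abs_mult by (intro mult_left_mono wx_bound) simp
    moreover have "\<bar>b i\<bar> * X + \<bar>\<tau> $ i\<bar> \<le> E" unfolding E_def
      by (rule member_le_sum) (use X_ge_1 in auto)
    ultimately show ?case by simp
  qed (simp add: E0)
  then show ?thesis using E0 by (intro exI[of _ "2 * E"]) auto
qed

text \<open>Words of length \<open>N\<close> resolve positions only down to about
  \<open>1 / 2 ^ N\<close>, hence the lower bound on \<open>\<delta>\<close>. The margin 1 for the
  slopes is the one from \<open>averaged_dyadic_le\<close>.\<close>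

definition thin_strips :: "real ^ 'n \<Rightarrow> real \<Rightarrow> bool" where
  "thin_strips \<tau> T \<longleftrightarrow> (\<exists>C\<ge>0. \<forall>N \<theta> z \<delta>. \<bar>\<theta>\<bar> + 1 \<le> T \<longrightarrow> 1 / 2 ^ N \<le> \<delta> \<longrightarrow>
     (\<Sum>w\<in>{w \<in> words N. \<bar>wy \<tau> w + \<theta> * wx w - z\<bar> \<le> \<delta>}. wprod p w) \<le> C * \<delta>)"

lemma wprod_c_le: "\<bar>wprod c w\<bar> \<le> 1 / 2 ^ length w"
proof -
  have "\<bar>wprod c w\<bar> \<le> (1 / 2) ^ length w"
    by (rule wprod_abs_le_power) (use coeffs in \<open>auto intro: less_imp_le\<close>)
  then show ?thesis by (simp add: power_one_over)
qed

lemma wprod_a_le_c: "\<bar>wprod a w\<bar> \<le> \<bar>wprod c w\<bar>"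
proof (induction w)
  case (Cons i w)
  then show ?case using coeffs[of i] by (simp add: abs_mult mult_mono)
qed simp

text \<open>Energy bounds are available for infinitely many lengths only. A given length
  \<open>n\<close> is reached by extending its words to a good length \<open>N\<close>: this
  preserves mass and moves every point by no more than a multiple of \<open>\<delta>\<close>, so the
  strip only has to be widened by a constant factor.\<close>

lemma thin_strips_if_energy_bounded:
  assumes B: "0 \<le> B" and \<epsilon>: "0 < \<epsilon>"
    and en: "\<And>N0. \<exists>N\<ge>N0. \<forall>i. 1 \<le> i \<longrightarrow> i \<le> N \<longrightarrow>
      (\<integral>\<^sup>+\<theta>. indicator {- T..T} \<theta> * ennreal (energy N \<tau> (1 / 2 ^ i) \<theta>) \<partial>lborel) \<le> ennreal (B * (1 / 2 ^ i) powr (2 + \<epsilon>))"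
  shows "thin_strips \<tau> T"
proof -
  obtain Y where Y: "0 \<le> Y" "\<And>w. \<bar>wy \<tau> w\<bar> \<le> Y" using wy_bound by blast
  obtain K where K: "0 \<le> K" "\<And>u. \<bar>wb u\<bar> \<le> K * \<bar>wprod c u\<bar>" using wb_bound by blast
  define C1 where "C1 = 32 * X * (1 + sqrt B / (1 - 2 powr (- (\<epsilon> / 2))))"
  have "(2::real) powr (- (\<epsilon> / 2)) < 1" using \<epsilon> powr_less_mono[of "- (\<epsilon> / 2)" 0 2] by auto
  then have C1: "0 \<le> C1" using B X_ge_1 by (simp add: C1_def)
  \<comment> \<open>The summands bound, in multiples of \<open>\<delta>\<close>, the original
    deviation and the three terms that the extension adds: vertical scaling, shear, and slope times
    horizontal displacement.\<close>
  define L where "L = 1 + Y + K * X + \<bar>T\<bar> * X"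
  have L: "1 \<le> L" using Y K X_ge_1 by (simp add: L_def)
  have "(\<Sum>w\<in>{w \<in> words n. \<bar>wy \<tau> w + \<theta> * wx w - z\<bar> \<le> \<delta>}. wprod p w) \<le> C1 * L * \<delta>"
    if \<theta>: "\<bar>\<theta>\<bar> + 1 \<le> T" and \<delta>: "1 / 2 ^ n \<le> \<delta>" for n \<theta> z \<delta>
  proof -
    obtain N where N: "n \<le> N" and enN: "\<And>i. 1 \<le> i \<Longrightarrow> i \<le> N \<Longrightarrow>
      (\<integral>\<^sup>+\<theta>. indicator {- T..T} \<theta> * ennreal (energy N \<tau> (1 / 2 ^ i) \<theta>) \<partial>lborel) \<le> ennreal (B * (1 / 2 ^ i) powr (2 + \<epsilon>))"
      using en[of n] by blast
    have p0: "0 \<le> wprod p w" for w using wprod_pos[of p, OF p_pos] less_imp_le by blast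
    define f where "f \<delta> w = (if \<bar>wy \<tau> w + \<theta> * wx w - z\<bar> \<le> \<delta> then wprod p w else 0)" for \<delta> w
    have sumf: "(\<Sum>w\<in>{w \<in> words m. \<bar>wy \<tau> w + \<theta> * wx w - z\<bar> \<le> \<delta>}. wprod p w) = (\<Sum>w\<in>words m. f \<delta> w)" for m \<delta>
      unfolding f_def by (rule sum.inter_filter) simp
    have near: "\<bar>wy \<tau> (u @ v) + \<theta> * wx (u @ v) - z\<bar> \<le> L * \<delta>" if "u \<in> words n" "\<bar>wy \<tau> u + \<theta> * wx u - z\<bar> \<le> \<delta>" for u v
    proof -
      have cu: "\<bar>wprod c u\<bar> \<le> \<delta>" using wprod_c_le[of u] that \<delta> by (simp add: words_def)
      have d0: "0 \<le> \<delta>" using cu abs_ge_zero order_trans by blast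
      have "\<bar>wprod c u * wy \<tau> v\<bar> \<le> \<delta> * Y" unfolding abs_mult using cu Y d0 by (intro mult_mono) auto
      moreover have "\<bar>wb u * wx v\<bar> \<le> (K * \<delta>) * X" unfolding abs_mult
        by (intro mult_mono wx_bound order_trans[OF K(2)] mult_left_mono cu) (use K d0 in auto)
      moreover have "\<bar>\<theta> * (wprod a u * wx v)\<bar> \<le> \<bar>T\<bar> * (\<delta> * X)" unfolding abs_mult
        by (intro mult_mono wx_bound order_trans[OF wprod_a_le_c cu]) (use \<theta> d0 X_ge_1 in auto)
      moreover have "wy \<tau> (u @ v) + \<theta> * wx (u @ v) - z = (wy \<tau> u + \<theta> * wx u - z) + wprod c u * wy \<tau> v + wb u * wx v + \<theta> * (wprod a u * wx v)"
        by (simp add: wy_append wx_append algebra_simps)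
      moreover have "L * \<delta> = \<delta> + \<delta> * Y + (K * \<delta>) * X + \<bar>T\<bar> * (\<delta> * X)" by (simp add: L_def algebra_simps)
      ultimately show ?thesis using that(2) by (simp only:)
    qed
    \<comment> \<open>The extensions of a word by all tails of length \<open>N - n\<close> have
      total relative mass 1.\<close>
    have "(\<Sum>u\<in>words n. f \<delta> u) = (\<Sum>u\<in>words n. \<Sum>v\<in>words (N - n). f \<delta> u * wprod p v)"
      by (simp add: sum_distrib_left[symmetric] sum_wprod sum_p)
    also have "\<dots> \<le> (\<Sum>u\<in>words n. \<Sum>v\<in>words (N - n). f (L * \<delta>) (u @ v))"
      by (intro sum_mono) (use near p0 in \<open>auto simp: f_def\<close>)
    also have "\<dots> = (\<Sum>w\<in>words N. f (L * \<delta>) w)"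
      using N by (simp add: sum_words_add[symmetric])
    also have "\<dots> \<le> C1 * (L * \<delta>)"
      unfolding sumf[symmetric] C1_def
    proof (rule weighted_points.strip_dyadic_le[OF weighted enN B \<theta> \<epsilon>])
      have "(1::real) / 2 ^ N \<le> 1 / 2 ^ n" using N by (simp add: frac_le)
      also have "\<dots> \<le> 1 * \<delta>" using \<delta> by simp
      also have "\<dots> \<le> L * \<delta>" using L \<delta> by (intro mult_right_mono) (auto intro: order_trans[rotated])
      finally show "1 / 2 ^ N \<le> L * \<delta>" .
    qed
    finally show ?thesis unfolding sumf by (simp add: mult_ac)
  qed
  then show ?thesis unfolding thin_strips_def using C1 L by (intro exI[of _ "C1 * L"]) auto
qed

text \<open>Countably many open cubes exhaust the space of translation vectors, and a countable
  union of null sets is null.\<close>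

lemma AE_thin_strips: "AE \<tau> in lborel. thin_strips \<tau> T"
proof -
  have "(\<Sum>i\<in>UNIV. (p i)\<^sup>2 * \<bar>c i\<bar> powr (- 3)) < 1" using small by (simp add: p2_c3)
  then obtain \<eta> where \<eta>: "0 < \<eta>" "\<eta> \<le> 1" "(\<Sum>i\<in>UNIV. (p i)\<^sup>2 * \<bar>c i\<bar> powr (- (3 + \<eta>))) < 1"
    using powr_sum_less_nudge[of c p, OF c_nz] by blast
  have "AE \<tau> in lborel. \<forall>k::nat. (\<forall>j. \<bar>\<tau> $ j\<bar> < real (Suc k)) \<longrightarrow> thin_strips \<tau> T"
    unfolding AE_all_countable
  proof
    fix k :: nat
    show "AE \<tau> in lborel. (\<forall>j. \<bar>\<tau> $ j\<bar> < real (Suc k)) \<longrightarrow> thin_strips \<tau> T"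
    proof (cases "0 \<le> T")
      case True
      note AE_energy_bounded_on_cube[OF \<eta> _ True refl, of "real (Suc k)"]
      then have "AE \<tau> in lborel. (\<forall>j. \<bar>\<tau> $ j\<bar> < real (Suc k)) \<longrightarrow>
        (\<exists>B\<ge>0. \<forall>N0. \<exists>N\<ge>N0. \<forall>i. 1 \<le> i \<longrightarrow> i \<le> N \<longrightarrow>
          (\<integral>\<^sup>+\<theta>. indicator {- T..T} \<theta> * ennreal (energy N \<tau> (1 / 2 ^ i) \<theta>) \<partial>lborel) \<le> ennreal (B * (1 / 2 ^ i) powr (2 + \<eta> / 2)))"
        by simp
      then show ?thesis
      proof (rule AE_mp, intro AE_I2 impI)
        fix \<tau> :: "real ^ 'n" assume *: "(\<forall>j. \<bar>\<tau> $ j\<bar> < real (Suc k)) \<longrightarrow>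
          (\<exists>B\<ge>0. \<forall>N0. \<exists>N\<ge>N0. \<forall>i. 1 \<le> i \<longrightarrow> i \<le> N \<longrightarrow>
          (\<integral>\<^sup>+\<theta>. indicator {- T..T} \<theta> * ennreal (energy N \<tau> (1 / 2 ^ i) \<theta>) \<partial>lborel) \<le> ennreal (B * (1 / 2 ^ i) powr (2 + \<eta> / 2)))"
          and "\<forall>j. \<bar>\<tau> $ j\<bar> < real (Suc k)"
        then obtain B where "B \<ge> 0" "\<And>N0. \<exists>N\<ge>N0. \<forall>i. 1 \<le> i \<longrightarrow> i \<le> N \<longrightarrow>
          (\<integral>\<^sup>+\<theta>. indicator {- T..T} \<theta> * ennreal (energy N \<tau> (1 / 2 ^ i) \<theta>) \<partial>lborel) \<le> ennreal (B * (1 / 2 ^ i) powr (2 + \<eta> / 2))"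
          by blast
        then show "thin_strips \<tau> T" using \<eta>(1) by (intro thin_strips_if_energy_bounded[of B "\<eta> / 2"]) auto
      qed
    next
      case False
      \<comment> \<open>For negative \<open>T\<close> no slope is admissible and the condition is
        vacuous.\<close>
      then have "thin_strips \<tau> T" for \<tau> unfolding thin_strips_def by (intro exI[of _ 0]) (auto dest: order_trans[rotated])
      then show ?thesis by simp
    qed
  qed
  then show ?thesis
  proof (rule AE_mp, intro AE_I2 impI)
    fix \<tau> :: "real ^ 'n" assume *: "\<forall>k::nat. (\<forall>j. \<bar>\<tau> $ j\<bar> < real (Suc k)) \<longrightarrow> thin_strips \<tau> T"
    obtain k :: nat where k: "norm \<tau> < real k" using reals_Archimedean2 by blast
    have "\<bar>\<tau> $ j\<bar> < real (Suc k)" for j using component_le_norm_cart[of \<tau> j] k by simp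
    then show "thin_strips \<tau> T" using * by blast
  qed
qed

end

section \<open>Stopping words and mass distribution\<close>

context triangular_IFS
begin

definition min_a :: real where "min_a = Min (range (\<lambda>i. \<bar>a i\<bar>))"

lemma min_a: "0 < min_a" "min_a \<le> \<bar>a i\<bar>" "min_a \<le> 1"
proof -
  show "0 < min_a" unfolding min_a_def by (subst Min_gr_iff) (use a_nz in auto)
  show 1: "min_a \<le> \<bar>a i\<bar>" for i by (simp add: min_a_def)
  show "min_a \<le> 1" using 1[of undefined] coeffs[of undefined] by linarith
qed

definition cut :: "real \<Rightarrow> 'n list \<Rightarrow> 'n list" where
  "cut d w = take (LEAST n. \<bar>wprod a (take n w)\<bar> \<le> d) w"

text \<open>The cut stops at the first prefix of horizontal ratio at most \<open>d\<close>. For a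
  nonempty cut the prefix one letter shorter exceeds \<open>d\<close> and the last letter
  contributes a factor of at least \<open>min_a\<close>; for the empty cut the lower bound uses
  \<open>d \<le> 1\<close>.\<close>

lemma cut_props:
  assumes "\<bar>wprod a w\<bar> \<le> d" "d \<le> 1" "0 < d"
  shows "\<bar>wprod a (cut d w)\<bar> \<le> d" "min_a * d \<le> \<bar>wprod a (cut d w)\<bar>"
    "prefix (cut d w) w" "\<And>v. strict_prefix v (cut d w) \<Longrightarrow> d < \<bar>wprod a v\<bar>"
proof -
  define n where "n = (LEAST n. \<bar>wprod a (take n w)\<bar> \<le> d)"
  have ex: "\<bar>wprod a (take (length w) w)\<bar> \<le> d" using assms by simp
  have n1: "\<bar>wprod a (take n w)\<bar> \<le> d" unfolding n_def by (rule LeastI[where P = "\<lambda>n. \<bar>wprod a (take n w)\<bar> \<le> d", OF ex])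
  have n2: "n \<le> length w" unfolding n_def by (rule Least_le[where P = "\<lambda>n. \<bar>wprod a (take n w)\<bar> \<le> d", OF ex])
  have n3: "d < \<bar>wprod a (take m w)\<bar>" if "m < n" for m
    using not_less_Least[OF that[unfolded n_def]] by simp
  have cut: "cut d w = take n w" by (simp add: cut_def n_def)
  show "\<bar>wprod a (cut d w)\<bar> \<le> d" using n1 cut by simp
  show "prefix (cut d w) w" by (simp add: cut take_is_prefix)
  show sp: "d < \<bar>wprod a v\<bar>" if "strict_prefix v (cut d w)" for v
  proof -
    have "length v < n" using that n2 by (auto simp: cut dest: prefix_length_less)
    moreover have "v = take (length v) w"
      using that unfolding cut by (metis prefix_order.less_imp_le prefix_order.trans take_is_prefix prefix_def append_eq_conv_conj)
    ultimately show ?thesis using n3 by metis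
  qed
  show "min_a * d \<le> \<bar>wprod a (cut d w)\<bar>"
  proof (cases "cut d w" rule: rev_cases)
    case Nil
    then show ?thesis using assms min_a by (simp add: mult_le_one)
  next
    case (snoc u i)
    have "d < \<bar>wprod a u\<bar>" by (rule sp) (simp add: snoc strict_prefix_def)
    then have "min_a * d \<le> \<bar>a i\<bar> * \<bar>wprod a u\<bar>" using min_a assms by (intro mult_mono) auto
    then show ?thesis by (simp add: snoc abs_mult mult.commute)
  qed
qed

section \<open>Cylinders on the line under the open set condition\<close>

lemma cylinder_images:
  assumes inv: "\<And>i. line_IFS a t i ` U \<subseteq> U" and "z \<in> U"
  shows "wprod a u * z + wx u \<in> U"
proof (induction u)
  case (Cons i u)
  have "wprod a (i # u) * z + wx (i # u) = line_IFS a t i (wprod a u * z + wx u)"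
    by (simp add: line_IFS_def algebra_simps)
  then show ?case using Cons inv by auto
qed (use assms in simp)

text \<open>The common prefix acts injectively, so a coincidence would pass to the first letters in
  which the words differ, where the images of \<open>U\<close> are disjoint.\<close>

lemma parallel_cylinders_disjoint:
  assumes inv: "\<And>i. line_IFS a t i ` U \<subseteq> U"
    and disj: "\<And>i j. i \<noteq> j \<Longrightarrow> line_IFS a t i ` U \<inter> line_IFS a t j ` U = {}"
    and "u \<parallel> v" "z \<in> U" "z' \<in> U"
  shows "wprod a u * z + wx u \<noteq> wprod a v * z' + wx v"
proof
  assume eq: "wprod a u * z + wx u = wprod a v * z' + wx v"
  obtain q i u' j v' where w: "i \<noteq> j" "u = q @ i # u'" "v = q @ j # v'"
    using parallel_decomp[OF \<open>u \<parallel> v\<close>] by metis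
  let ?h = "\<lambda>i u z. line_IFS a t i (wprod a u * z + wx u)"
  have "wprod a (q @ i # u) * z + wx (q @ i # u) = wprod a q * ?h i u z + wx q" for i u z
    by (simp add: wx_append line_IFS_def algebra_simps)
  then have "wprod a q * ?h i u' z = wprod a q * ?h j v' z'" using eq w by simp
  moreover have "wprod a q \<noteq> 0" using a_nz by (induction q) auto
  ultimately have "?h i u' z = ?h j v' z'" by simp
  moreover have "?h i u' z \<in> line_IFS a t i ` U" "?h j v' z' \<in> line_IFS a t j ` U"
    using cylinder_images[OF inv] assms(4,5) by auto
  ultimately show False using disj[OF w(1)] by auto
qed

text \<open>Distinct stopping words are incomparable and have ratios between
  \<open>min_a * d\<close> and \<open>d\<close>. The image of \<open>o'\<close> under one of them
  avoids the image under another of the ball of radius \<open>l\<close>, so these points are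
  separated by a multiple of \<open>d\<close>, while all of them lie within \<open>A * d\<close> of
  \<open>x0\<close>.\<close>

lemma card_cylinders_le:
  assumes U: "open U" "o' \<in> U" and inv: "\<And>i. line_IFS a t i ` U \<subseteq> U"
    and disj: "\<And>i j. i \<noteq> j \<Longrightarrow> line_IFS a t i ` U \<inter> line_IFS a t j ` U = {}"
  obtains C where "\<And>d x0 S. 0 < d \<Longrightarrow> d \<le> 1 \<Longrightarrow>
    (\<And>w. w \<in> S \<Longrightarrow> \<bar>wprod a w\<bar> \<le> d \<and> \<bar>wx w - x0\<bar> \<le> d) \<Longrightarrow> finite (cut d ` S) \<and> real (card (cut d ` S)) \<le> C"
proof -
  obtain l where l: "0 < l" "ball o' l \<subseteq> U" using U open_contains_ball by blast
  define A where "A = \<bar>o'\<bar> + X + 1"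
  have A: "0 \<le> A" using X_ge_1 by (simp add: A_def)
  show ?thesis
  proof (rule that[of "2 * A / (l * min_a) + 3"])
    fix d x0 S assume d: "0 < d" "d \<le> 1" and S: "\<And>w. w \<in> S \<Longrightarrow> \<bar>wprod a w\<bar> \<le> d \<and> \<bar>wx w - x0\<bar> \<le> d"
    define g where "g u = wprod a u * o' + wx u" for u
    have cp: "\<bar>wprod a (cut d w)\<bar> \<le> d" "min_a * d \<le> \<bar>wprod a (cut d w)\<bar>"
      "prefix (cut d w) w" "\<And>v. strict_prefix v (cut d w) \<Longrightarrow> d < \<bar>wprod a v\<bar>" if "w \<in> S" for w
      using cut_props[of w d] S[OF that] d by blast+
    have "finite (cut d ` S) \<and> real (card (cut d ` S)) \<le> 2 * (A * d) / (l * (min_a * d)) + 3"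
    proof (rule card_separated_le)
      show "0 < l * (min_a * d)" using l min_a d by simp
      show "0 \<le> A * d" using A d by simp
    next
      fix u assume "u \<in> cut d ` S"
      then obtain w where w: "w \<in> S" "u = cut d w" by auto
      then obtain v where v: "w = u @ v" using cp(3) by (auto simp: prefix_def)
      have "g u - x0 = wprod a u * (o' - wx v) + (wx w - x0)" by (simp add: g_def v wx_append algebra_simps)
      moreover have "\<bar>wprod a u * (o' - wx v)\<bar> \<le> d * (\<bar>o'\<bar> + X)"
        unfolding abs_mult using cp(1)[OF w(1)] w wx_bound[of v] d X_ge_1 by (intro mult_mono) auto
      moreover have "A * d = d * (\<bar>o'\<bar> + X) + d" by (simp add: A_def algebra_simps)
      ultimately show "\<bar>g u - x0\<bar> \<le> A * d" using S[OF w(1)] by linarith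
    next
      fix u v assume u: "u \<in> cut d ` S" and v: "v \<in> cut d ` S" and ne: "u \<noteq> v"
      have np: "\<not> prefix u v" if "u \<in> cut d ` S" "v \<in> cut d ` S" "u \<noteq> v" for u v
      proof
        assume "prefix u v"
        then have "strict_prefix u v" using that by (simp add: strict_prefix_def)
        then have "d < \<bar>wprod a u\<bar>" using that(2) cp(4) by blast
        moreover have "\<bar>wprod a u\<bar> \<le> d" using that(1) cp(1) by blast
        ultimately show False by simp
      qed
      then have par: "u \<parallel> v" using u v ne by (metis parallelI)
      have au: "min_a * d \<le> \<bar>wprod a u\<bar>" using u cp(2) by blast
      have au0: "0 < \<bar>wprod a u\<bar>" using au min_a d by (meson less_le_trans mult_pos_pos)
      show "l * (min_a * d) \<le> \<bar>g u - g v\<bar>"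
      proof (rule ccontr)
        assume "\<not> ?thesis"
        moreover have "l * (min_a * d) \<le> l * \<bar>wprod a u\<bar>" using au l by (intro mult_left_mono) auto
        ultimately have lt: "\<bar>g v - g u\<bar> < l * \<bar>wprod a u\<bar>" by linarith
        \<comment> \<open>The preimage of \<open>g v\<close> under the map of the word
          \<open>u\<close>; if the two points were close it would lie in \<open>U\<close>, giving a
          common point of disjoint images.\<close>
        define z where "z = o' + (g v - g u) / wprod a u"
        have "\<bar>(g v - g u) / wprod a u\<bar> < l" using lt au0 by (simp add: abs_divide divide_less_eq)
        then have "z \<in> U" using l(2) by (auto simp: z_def dist_real_def)
        moreover have "wprod a u * z + wx u = wprod a v * o' + wx v"
          using au0 by (simp add: z_def g_def field_simps)
        ultimately show False using parallel_cylinders_disjoint[OF inv disj par _ U(2)] by blast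
      qed
    qed
    then show "finite (cut d ` S) \<and> real (card (cut d ` S)) \<le> 2 * A / (l * min_a) + 3"
      using d by simp
  qed
qed

text \<open>Behind a stopping word \<open>u\<close> the square lies in a strip of half-width
  \<open>d / \<bar>wprod c u\<bar>\<close>. Multiplying the strip bound by \<open>wprod p u\<close>
  cancels the vertical ratio and leaves \<open>C1 * \<bar>wprod a u\<bar> powr (s - 1) * d\<close>,
  at most \<open>C1 * d powr s\<close>; the number of stopping words is bounded.\<close>

lemma square_mass_le:
  assumes U: "open U" "o' \<in> U" and inv: "\<And>i. line_IFS a t i ` U \<subseteq> U"
    and disj: "\<And>i j. i \<noteq> j \<Longrightarrow> line_IFS a t i ` U \<inter> line_IFS a t j ` U = {}"
    and K: "\<And>u. \<bar>wb u\<bar> \<le> K * \<bar>wprod c u\<bar>" and ts: "thin_strips \<tau> (K + 1)"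
  shows "\<exists>C\<ge>1. \<forall>N d x0 y0. 0 < d \<longrightarrow> d \<le> 1 \<longrightarrow> 1 / 2 ^ N \<le> d \<longrightarrow>
    (\<Sum>w\<in>{w \<in> words N. \<bar>wx w - x0\<bar> \<le> d \<and> \<bar>wy \<tau> w - y0\<bar> \<le> d}. wprod p w) \<le> C * d powr s"
proof -
  obtain C0 where C0: "\<And>d x0 S. 0 < d \<Longrightarrow> d \<le> 1 \<Longrightarrow>
    (\<And>w. w \<in> S \<Longrightarrow> \<bar>wprod a w\<bar> \<le> d \<and> \<bar>wx w - x0\<bar> \<le> d) \<Longrightarrow> finite (cut d ` S) \<and> real (card (cut d ` S)) \<le> C0"
    using card_cylinders_le[OF U inv disj] by blast
  obtain C1 where C1: "0 \<le> C1" "\<And>N \<theta> z \<delta>. \<bar>\<theta>\<bar> + 1 \<le> K + 1 \<Longrightarrow> 1 / 2 ^ N \<le> \<delta> \<Longrightarrow>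
     (\<Sum>w\<in>{w \<in> words N. \<bar>wy \<tau> w + \<theta> * wx w - z\<bar> \<le> \<delta>}. wprod p w) \<le> C1 * \<delta>"
    using ts unfolding thin_strips_def by blast
  have p0: "0 \<le> wprod p w" for w using wprod_pos[of p, OF p_pos] less_imp_le by blast
  have "(\<Sum>w\<in>{w \<in> words N. \<bar>wx w - x0\<bar> \<le> d \<and> \<bar>wy \<tau> w - y0\<bar> \<le> d}. wprod p w) \<le> C0 * C1 * d powr s"
    if d: "0 < d" "d \<le> 1" "1 / 2 ^ N \<le> d" for N d x0 y0
  proof -
    define S where "S = {w \<in> words N. \<bar>wx w - x0\<bar> \<le> d \<and> \<bar>wy \<tau> w - y0\<bar> \<le> d}"
    have fS: "finite S" by (simp add: S_def)
    have aw: "\<bar>wprod a w\<bar> \<le> d" if "w \<in> S" for w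
      using wprod_a_le_c[of w] wprod_c_le[of w] that d by (simp add: S_def words_def)
    have fT: "finite (cut d ` S)" "real (card (cut d ` S)) \<le> C0"
      using C0[OF d(1,2), of S x0] aw by (auto simp: S_def)
    have piece: "(\<Sum>w\<in>{w \<in> S. cut d w = u}. wprod p w) \<le> C1 * d powr s" if uT: "u \<in> cut d ` S" for u
    proof -
      obtain w0 where w0: "w0 \<in> S" "u = cut d w0" using uT by auto
      note cp = cut_props[OF aw[OF w0(1)] d(2,1), folded w0(2)]
      have lu: "length u \<le> N" using prefix_length_le[OF cp(3)] w0(1) by (simp add: S_def words_def)
      have cu: "0 < \<bar>wprod c u\<bar>"
        using wprod_pos[of "\<lambda>i. \<bar>c i\<bar>" u] c_nz by (simp add: wprod_abs)
      \<comment> \<open>By \<open>wy_append\<close>, the vertical constraint divided by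
        \<open>wprod c u\<close> is a strip constraint on the remaining word, with this slope and
        the offset \<open>z\<close>.\<close>
      define \<theta> where "\<theta> = wb u / wprod c u"
      define z where "z = (y0 - wy \<tau> u) / wprod c u"
      define V where "V = {v \<in> words (N - length u). \<bar>wy \<tau> v + \<theta> * wx v - z\<bar> \<le> d / \<bar>wprod c u\<bar>}"
      have "{w \<in> S. cut d w = u} \<subseteq> (@) u ` V"
      proof
        fix w assume w: "w \<in> {w \<in> S. cut d w = u}"
        then have "prefix u w" using cut_props(3)[OF aw d(2,1), of w] by auto
        then obtain v where v: "w = u @ v" by (auto simp: prefix_def)
        have "(wy \<tau> v + \<theta> * wx v - z) * wprod c u = wy \<tau> w - y0"
          using cu by (simp add: \<theta>_def z_def v wy_append field_simps)
        then have "\<bar>wy \<tau> v + \<theta> * wx v - z\<bar> * \<bar>wprod c u\<bar> \<le> d"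
          using w by (simp add: abs_mult[symmetric] S_def)
        then have "\<bar>wy \<tau> v + \<theta> * wx v - z\<bar> \<le> d / \<bar>wprod c u\<bar>" using cu by (simp add: pos_le_divide_eq)
        then have "v \<in> V" using w v by (auto simp: V_def S_def words_def)
        then show "w \<in> (@) u ` V" using v by blast
      qed
      then have "(\<Sum>w\<in>{w \<in> S. cut d w = u}. wprod p w) \<le> (\<Sum>w\<in>(@) u ` V. wprod p w)"
        by (intro sum_mono2) (auto simp: V_def p0)
      also have "\<dots> = wprod p u * (\<Sum>v\<in>V. wprod p v)"
        by (subst sum.reindex) (auto simp: sum_distrib_left inj_on_def)
      also have "\<dots> \<le> wprod p u * (C1 * (d / \<bar>wprod c u\<bar>))"
        unfolding V_def
      proof (intro mult_left_mono C1(2) p0)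
        show "\<bar>\<theta>\<bar> + 1 \<le> K + 1" using K[of u] cu by (simp add: \<theta>_def abs_divide divide_le_eq)
        \<comment> \<open>The strip is not thinner than the resolution of the remaining word,
          because \<open>\<bar>wprod c u\<bar> \<le> 1 / 2 ^ length u\<close>.\<close>
        have "(1::real) / 2 ^ (N - length u) = (1 / 2 ^ N) / (1 / 2 ^ length u)"
          using lu by (simp add: power_diff)
        also have "\<dots> \<le> d / \<bar>wprod c u\<bar>" using d cu wprod_c_le[of u] by (intro frac_le) auto
        finally show "1 / 2 ^ (N - length u) \<le> d / \<bar>wprod c u\<bar>" .
      qed
      also have "\<dots> = C1 * (\<bar>wprod a u\<bar> powr (s - 1) * d)" using cu by (simp add: wprod_p)
      also have "\<dots> \<le> C1 * (d powr (s - 1) * d)"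
        using C1 cp(1) d s by (intro mult_left_mono mult_right_mono powr_mono2) auto
      also have "d powr (s - 1) * d = d powr s" using d powr_mult_base[of d "s - 1"] by (simp add: mult.commute)
      finally show ?thesis .
    qed
    have "(\<Sum>w\<in>S. wprod p w) = (\<Sum>u\<in>cut d ` S. \<Sum>w\<in>{w \<in> S. cut d w = u}. wprod p w)"
      by (rule sum.image_gen[OF fS])
    also have "\<dots> \<le> real (card (cut d ` S)) * (C1 * d powr s)"
      by (rule sum_bounded_above[OF piece])
    also have "\<dots> \<le> C0 * (C1 * d powr s)" using fT C1 by (intro mult_right_mono) auto
    finally show ?thesis by (simp add: S_def mult.assoc)
  qed
  then have "(\<Sum>w\<in>{w \<in> words N. \<bar>wx w - x0\<bar> \<le> d \<and> \<bar>wy \<tau> w - y0\<bar> \<le> d}. wprod p w) \<le> max 1 (C0 * C1) * d powr s"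
    if "0 < d" "d \<le> 1" "1 / 2 ^ N \<le> d" for N d x0 y0
    using that mult_right_mono[of "C0 * C1" "max 1 (C0 * C1)" "d powr s"] by (meson max.cobounded2 order_trans powr_ge_zero)
  then show ?thesis by (intro exI[of _ "max 1 (C0 * C1)"]) auto
qed

section \<open>Geometry of the attractor and bounds for its Hausdorff measure\<close>

abbreviation F :: "real ^ 'n \<Rightarrow> 'n \<Rightarrow> real ^ 2 \<Rightarrow> real ^ 2" where
  "F \<tau> \<equiv> planar_IFS a b c t \<tau>"

definition F_word :: "real ^ 'n \<Rightarrow> 'n list \<Rightarrow> real ^ 2 \<Rightarrow> real ^ 2" where
  "F_word \<tau> w = foldr (F \<tau>) w"

lemma F_components: "F \<tau> i z $ 1 = a i * z $ 1 + t i" "F \<tau> i z $ 2 = b i * z $ 1 + c i * z $ 2 + \<tau> $ i"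
  by (simp_all add: planar_IFS_def lin_part_def matrix_vector_mult_def sum_2)

lemma F_word_components:
  "F_word \<tau> w z $ 1 = wprod a w * z $ 1 + wx w"
  "F_word \<tau> w z $ 2 = wb w * z $ 1 + wprod c w * z $ 2 + wy \<tau> w"
  by (induction w) (simp_all add: F_word_def F_components algebra_simps)

lemma F_word_Cons: "F_word \<tau> (i # w) z = F \<tau> i (F_word \<tau> w z)"
  by (simp add: F_word_def)

lemma F_word_mem:
  assumes "E = (\<Union>i. F \<tau> i ` E)" "z \<in> E"
  shows "F_word \<tau> w z \<in> E"
proof (induction w)
  case (Cons i w)
  have "(\<Union>i. F \<tau> i ` E) \<subseteq> E" using assms(1) by simp
  then show ?case using Cons by (auto simp: F_word_Cons)
qed (use assms in \<open>simp add: F_word_def\<close>)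

lemma subset_F_words:
  assumes "E = (\<Union>i. F \<tau> i ` E)"
  shows "E \<subseteq> (\<Union>w\<in>words N. F_word \<tau> w ` E)"
proof (induction N)
  case (Suc N)
  show ?case
  proof
    fix z assume "z \<in> E"
    then obtain i z' where z': "z' \<in> E" "z = F \<tau> i z'" using equalityD1[OF assms] by blast
    then obtain w z'' where "w \<in> words N" "z'' \<in> E" "z' = F_word \<tau> w z''" using Suc by blast
    then show "z \<in> (\<Union>w\<in>words (Suc N). F_word \<tau> w ` E)"
      using z'(2) by (intro UN_I[of "i # w"] image_eqI[of _ _ z'']) (auto simp: F_word_Cons words_def)
  qed
qed (auto simp: F_word_def)

lemma norm2_le: "norm z \<le> \<bar>z $ 1\<bar> + \<bar>z $ 2\<bar>" for z :: "real ^ 2"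
  using norm_le_l1_cart[of z] by (simp add: sum_2)

text \<open>The mass distribution principle without a limit measure: a cover is thickened to an open
  one at small cost, compactness makes it finite, and then a single length \<open>N\<close> is fine
  enough for all of its members. Their masses must add up to at least 1.\<close>

lemma hausdorff_measure_pos:
  assumes E: "is_attractor (F \<tau>) E"
    and mass: "\<exists>C\<ge>1. \<forall>N d x0 y0. 0 < d \<longrightarrow> d \<le> 1 \<longrightarrow> 1 / 2 ^ N \<le> d \<longrightarrow>
    (\<Sum>w\<in>{w \<in> words N. \<bar>wx w - x0\<bar> \<le> d \<and> \<bar>wy \<tau> w - y0\<bar> \<le> d}. wprod p w) \<le> C * d powr s"
  shows "0 < hausdorff_measure s E"
proof -
  obtain C where C: "1 \<le> C" and mass: "\<And>N d x0 y0. 0 < d \<Longrightarrow> d \<le> 1 \<Longrightarrow> 1 / 2 ^ N \<le> d \<Longrightarrow>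
    (\<Sum>w\<in>{w \<in> words N. \<bar>wx w - x0\<bar> \<le> d \<and> \<bar>wy \<tau> w - y0\<bar> \<le> d}. wprod p w) \<le> C * d powr s"
    using mass by blast
  have cE: "compact E" and eE: "E = (\<Union>i. F \<tau> i ` E)" and nE: "E \<noteq> {}"
    using E[unfolded is_attractor_def] by argo+
  obtain z0 where z0: "z0 \<in> E" using nE by blast
  obtain K where K: "0 \<le> K" "\<And>u. \<bar>wb u\<bar> \<le> K * \<bar>wprod c u\<bar>" using wb_bound by blast
  define L where "L = \<bar>z0 $ 1\<bar> + (K * \<bar>z0 $ 1\<bar> + \<bar>z0 $ 2\<bar>)"
  have p0: "0 \<le> wprod p w" for w using wprod_pos[of p, OF p_pos] less_imp_le by blast
  \<comment> \<open>The masses sit at images of the origin, which may lie outside \<open>E\<close>;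
    images of \<open>z0\<close> do lie in \<open>E\<close> and approach them uniformly as
    \<open>N\<close> grows.\<close>
  have close: "norm (F_word \<tau> w z0 - F_word \<tau> w 0) \<le> L * (1 / 2 ^ N)" if "w \<in> words N" for w N
  proof -
    have cw: "\<bar>wprod c w\<bar> \<le> 1 / 2 ^ N" using wprod_c_le[of w] that by (simp add: words_def)
    have "norm (F_word \<tau> w z0 - F_word \<tau> w 0) \<le> \<bar>wprod a w * z0 $ 1\<bar> + \<bar>wb w * z0 $ 1 + wprod c w * z0 $ 2\<bar>"
      using norm2_le[of "F_word \<tau> w z0 - F_word \<tau> w 0"] by (simp add: F_word_components)
    also have "\<dots> \<le> \<bar>wprod a w\<bar> * \<bar>z0 $ 1\<bar> + (\<bar>wb w\<bar> * \<bar>z0 $ 1\<bar> + \<bar>wprod c w\<bar> * \<bar>z0 $ 2\<bar>)"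
      unfolding abs_mult[symmetric] by (intro add_left_mono abs_triangle_ineq)
    also have "\<dots> \<le> (1 / 2 ^ N) * \<bar>z0 $ 1\<bar> + ((K * (1 / 2 ^ N)) * \<bar>z0 $ 1\<bar> + (1 / 2 ^ N) * \<bar>z0 $ 2\<bar>)"
      by (intro add_mono mult_right_mono cw order_trans[OF wprod_a_le_c cw] order_trans[OF K(2) mult_left_mono[OF cw K(1)]]) auto
    also have "\<dots> = L * (1 / 2 ^ N)" by (simp add: L_def algebra_simps)
    finally show ?thesis .
  qed
  have "ennreal (1 / (2 * C)) \<le> hausdorff_premeasure s (1 / 2) E"
    unfolding hausdorff_premeasure_def
  proof (rule INF_greatest)
    fix U :: "nat \<Rightarrow> (real ^ 2) set"
    assume "U \<in> {U. E \<subseteq> (\<Union>n. U n) \<and> (\<forall>n. bounded (U n) \<and> diameter (U n) \<le> 1 / 2)}"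
    then have U: "E \<subseteq> (\<Union>n. U n)" "\<And>n. bounded (U n)" "\<And>n. diameter (U n) \<le> 1 / 2" by auto
    have "\<exists>e>0. e \<le> 1 / 8 \<and> (diameter (U n) + 4 * e) powr s \<le> diameter (U n) powr s + 1 / (4 * C) * (1 / 2) ^ n" for n
    proof -
      have d0: "0 \<le> diameter (U n)" using U(2) by (rule diameter_ge_0)
      have "((\<lambda>e. (diameter (U n) + 4 * e) powr s) \<longlongrightarrow> (diameter (U n) + 4 * 0) powr s) (at_right 0)"
      proof (rule tendsto_powr')
        show "((\<lambda>e. diameter (U n) + 4 * e) \<longlongrightarrow> diameter (U n) + 4 * 0) (at_right 0)"
          by (intro tendsto_intros)
      qed (use d0 s in \<open>auto intro!: tendsto_intros eventually_mono[OF eventually_at_right_less[of 0]]\<close>)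
      then have "\<forall>\<^sub>F e in at_right 0. (diameter (U n) + 4 * e) powr s < diameter (U n) powr s + 1 / (4 * C) * (1 / 2) ^ n"
        by (rule order_tendstoD) (use C in simp)
      moreover have "\<forall>\<^sub>F e in at_right (0::real). e \<in> {0<..<1 / 8}" by (rule eventually_at_right_real) simp
      ultimately have "\<forall>\<^sub>F e in at_right 0. (diameter (U n) + 4 * e) powr s < diameter (U n) powr s + 1 / (4 * C) * (1 / 2) ^ n \<and> e \<in> {0<..<1 / 8}"
        by (rule eventually_conj)
      then obtain e where "(diameter (U n) + 4 * e) powr s < diameter (U n) powr s + 1 / (4 * C) * (1 / 2) ^ n" "e \<in> {0<..<1 / 8}"
        using eventually_happens[of _ "at_right (0::real)"] trivial_limit_at_right_real by blast
      then show ?thesis by (intro exI[of _ e]) auto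
    qed
    then obtain e where e: "\<And>n. 0 < e n" "\<And>n. e n \<le> 1 / 8"
      "\<And>n. (diameter (U n) + 4 * e n) powr s \<le> diameter (U n) powr s + 1 / (4 * C) * (1 / 2) ^ n" by metis
    \<comment> \<open>One \<open>e n\<close> pays for the thickening and another for passing from
      \<open>z0\<close> to the origin. The sum is positive even for one-point sets, and at most
      \<open>1 / 2 + 4 / 8 = 1\<close>.\<close>
    define D where "D n = diameter (U n) + 4 * e n" for n
    have D: "0 < D n" "D n \<le> 1" for n
      using diameter_ge_0[OF U(2), of n] e(1,2)[of n] U(3)[of n] by (auto simp: D_def)
    define V where "V n = (\<Union>u\<in>U n. ball u (e n))" for n
    have "E \<subseteq> (\<Union>n. V n)"
    proof
      fix z assume "z \<in> E"
      then obtain n where "z \<in> U n" using U(1) by blast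
      then have "z \<in> V n" using e(1)[of n] by (auto simp: V_def intro!: bexI[of _ z])
      then show "z \<in> (\<Union>n. V n)" by blast
    qed
    moreover have "open (V n)" for n by (auto simp: V_def)
    ultimately obtain I where I: "finite I" "E \<subseteq> (\<Union>n\<in>I. V n)"
      using compactE_image[OF cE, of UNIV V] by auto
    have lim: "((\<lambda>N. B * (1 / 2 ^ N)) \<longlongrightarrow> 0) sequentially" for B :: real
      using tendsto_mult_right_zero[OF LIMSEQ_power_zero[of "1 / 2 :: real"], of B] by (simp add: power_one_over)
    have "\<forall>\<^sub>F N in sequentially. \<forall>n\<in>I. 1 * (1 / 2 ^ N) < D n \<and> L * (1 / 2 ^ N) < e n"
      by (intro eventually_ball_finite I(1) ballI eventually_conj order_tendstoD(2)[OF lim] D e(1))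
    then obtain N where N: "\<And>n. n \<in> I \<Longrightarrow> 1 / 2 ^ N \<le> D n" "\<And>n. n \<in> I \<Longrightarrow> L * (1 / 2 ^ N) \<le> e n"
      unfolding eventually_sequentially by (auto intro: less_imp_le)
    define W where "W n = {w \<in> words N. F_word \<tau> w z0 \<in> V n}" for n
    have Wn: "sum (wprod p) (W n) \<le> C * D n powr s" if n: "n \<in> I" for n
    proof (cases "U n = {}")
      case True
      then show ?thesis using C by (simp add: W_def V_def)
    next
      case False
      then obtain u0 where u0: "u0 \<in> U n" by blast
      have "W n \<subseteq> {w \<in> words N. \<bar>wx w - u0 $ 1\<bar> \<le> D n \<and> \<bar>wy \<tau> w - u0 $ 2\<bar> \<le> D n}"
      proof
        fix w assume "w \<in> W n"
        then obtain u where w: "w \<in> words N" and u: "u \<in> U n" "dist u (F_word \<tau> w z0) < e n"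
          by (auto simp: W_def V_def)
        have "dist u0 u \<le> diameter (U n)" by (rule diameter_bounded_bound[OF U(2) u0 u(1)])
        moreover have "dist (F_word \<tau> w z0) (F_word \<tau> w 0) \<le> e n"
          using close[OF w] N(2)[OF n] by (simp add: dist_norm)
        ultimately have "dist u0 (F_word \<tau> w 0) \<le> diameter (U n) + e n + e n"
          using u(2) by metric
        then have nd: "norm (F_word \<tau> w 0 - u0) \<le> D n"
          using e(1)[of n] by (simp add: D_def dist_norm norm_minus_commute)
        have "\<bar>wx w - u0 $ 1\<bar> \<le> D n" "\<bar>wy \<tau> w - u0 $ 2\<bar> \<le> D n"
          using component_le_norm_cart[of "F_word \<tau> w 0 - u0" 1] component_le_norm_cart[of "F_word \<tau> w 0 - u0" 2] nd
          by (auto simp: F_word_components)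
        then show "w \<in> {w \<in> words N. \<bar>wx w - u0 $ 1\<bar> \<le> D n \<and> \<bar>wy \<tau> w - u0 $ 2\<bar> \<le> D n}" using w by simp
      qed
      then have "sum (wprod p) (W n) \<le> (\<Sum>w\<in>{w \<in> words N. \<bar>wx w - u0 $ 1\<bar> \<le> D n \<and> \<bar>wy \<tau> w - u0 $ 2\<bar> \<le> D n}. wprod p w)"
        by (intro sum_mono2) (auto simp: p0)
      also have "\<dots> \<le> C * D n powr s" by (rule mass[OF D N(1)[OF n]])
      finally show ?thesis .
    qed
    have "words N = (\<Union>n\<in>I. W n)"
      using F_word_mem[OF eE z0] I(2) by (fastforce simp: W_def)
    then have "1 = sum (wprod p) (\<Union>n\<in>I. W n)" using sum_wprod[of p N] sum_p by simp
    also have "\<dots> \<le> (\<Sum>n\<in>I. sum (wprod p) (W n))"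
      by (rule sum_UN_le) (auto simp: p0 I W_def)
    also have "\<dots> \<le> (\<Sum>n\<in>I. C * (diameter (U n) powr s + 1 / (4 * C) * (1 / 2) ^ n))"
      using Wn e(3) C by (intro sum_mono) (force simp: D_def intro: order_trans mult_left_mono)
    also have "\<dots> = C * (\<Sum>n\<in>I. diameter (U n) powr s) + (\<Sum>n\<in>I. (1 / 2) ^ n) / 4"
      using C by (simp add: sum.distrib sum_distrib_left distrib_left sum_divide_distrib)
    also have "(\<Sum>n\<in>I. (1 / 2 :: real) ^ n) \<le> 2"
      using sum_le_suminf[of "\<lambda>n. (1 / 2 :: real) ^ n" I] I(1) suminf_geometric[of "1 / 2 :: real"] by simp
    finally have "1 \<le> C * (\<Sum>n\<in>I. diameter (U n) powr s) + 2 / 4" by simp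
    then have "1 / (2 * C) \<le> (\<Sum>n\<in>I. diameter (U n) powr s)" using C by (simp add: field_simps)
    then have "ennreal (1 / (2 * C)) \<le> ennreal (\<Sum>n\<in>I. diameter (U n) powr s)" by (rule ennreal_leI)
    also have "\<dots> = (\<Sum>n\<in>I. ennreal (diameter (U n) powr s))" by (simp add: sum_ennreal)
    also have "\<dots> \<le> (\<Sum>n. ennreal (diameter (U n) powr s))" by (intro sum_le_suminf I(1)) auto
    finally show "ennreal (1 / (2 * C)) \<le> (\<Sum>n. ennreal (diameter (U n) powr s))" .
  qed
  also have "\<dots> \<le> hausdorff_measure s E" unfolding hausdorff_measure_def by (intro SUP_upper) auto
  finally have "ennreal (1 / (2 * C)) \<le> hausdorff_measure s E" .
  moreover have "0 < ennreal (1 / (2 * C))" using C by simp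
  ultimately show ?thesis by (rule less_le_trans[rotated])
qed

text \<open>A cylinder of width about \<open>\<alpha> w\<close> and height about
  \<open>\<zeta> w\<close> is sliced into roughly \<open>\<zeta> w / \<alpha> w\<close> slabs of
  diameter about \<open>\<alpha> w\<close>. Their cost is a multiple of
  \<open>\<zeta> w * \<alpha> w powr (s - 1)\<close>, the mass of \<open>w\<close>, and the masses
  add up to 1 for every \<open>N\<close>.\<close>

lemma hausdorff_measure_finite:
  assumes E: "is_attractor (F \<tau>) E"
  shows "hausdorff_measure s E < \<infinity>"
proof -
  have cE: "compact E" and eE: "E = (\<Union>i. F \<tau> i ` E)"
    using E[unfolded is_attractor_def] by argo+
  obtain R where R: "0 < R" "\<And>z. z \<in> E \<Longrightarrow> norm z \<le> R"
    using compact_imp_bounded[OF cE] bounded_pos by blast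
  have Rc: "\<bar>z $ k\<bar> \<le> R" if "z \<in> E" for z k
    using component_le_norm_cart[of z k] R(2)[OF that] by linarith
  obtain K where K: "0 \<le> K" "\<And>u. \<bar>wb u\<bar> \<le> K * \<bar>wprod c u\<bar>" using wb_bound by blast
  \<comment> \<open>Shear contributes \<open>K\<close> and vertical scaling contributes 1: the
    cylinder of \<open>w\<close> lies within vertical distance \<open>h * \<zeta> w\<close> of
    \<open>wy \<tau> w\<close>.\<close>
  define h where "h = (K + 1) * R"
  have h: "0 < h" using K R by (simp add: h_def)
  define C where "C = (2 * h + 1) * (2 * R + 1) powr s"
  have C: "0 \<le> C" using h by (simp add: C_def)
  have "hausdorff_premeasure s \<delta> E \<le> ennreal C" if \<delta>: "0 < \<delta>" for \<delta>
  proof -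
    have "(\<lambda>N. (2 * R + 1) * (1 / 2 ^ N)) \<longlonglongrightarrow> 0"
      using tendsto_mult_right_zero[OF LIMSEQ_power_zero[of "1 / 2 :: real"], of "2 * R + 1"] by (simp add: power_one_over)
    then have "\<forall>\<^sub>F N in sequentially. (2 * R + 1) * (1 / 2 ^ N) < \<delta>" by (rule order_tendstoD) (rule \<delta>)
    then obtain N :: nat where N: "(2 * R + 1) * (1 / 2 ^ N) < \<delta>" unfolding eventually_sequentially by blast
    define \<alpha> where "\<alpha> w = \<bar>wprod a w\<bar>" for w
    define \<zeta> where "\<zeta> w = \<bar>wprod c w\<bar>" for w
    have \<alpha>: "0 < \<alpha> w" for w using wprod_pos[of "\<lambda>i. \<bar>a i\<bar>" w] a_nz by (simp add: \<alpha>_def wprod_abs)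
    have \<alpha>\<zeta>: "\<alpha> w \<le> \<zeta> w" for w by (simp add: \<alpha>_def \<zeta>_def wprod_a_le_c)
    define m where "m w = nat \<lfloor>2 * (h * \<zeta> w) / \<alpha> w\<rfloor>" for w
    define Q where "Q = (\<lambda>(w, k). F_word \<tau> w ` E \<inter>
       {z. wy \<tau> w - h * \<zeta> w + real k * \<alpha> w \<le> z $ 2 \<and> z $ 2 \<le> wy \<tau> w - h * \<zeta> w + real (Suc k) * \<alpha> w})"
    define I where "I = Sigma (words N) (\<lambda>w. {0..m w})"
    have fI: "finite I" by (simp add: I_def)
    have dQ: "diameter (Q (w, k)) \<le> (2 * R + 1) * \<alpha> w \<and> bounded (Q (w, k))" for w k
    proof
      have n: "norm (z - z') \<le> (2 * R + 1) * \<alpha> w" if zz': "z \<in> Q (w, k)" "z' \<in> Q (w, k)" for z z'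
      proof -
        obtain u u' where u: "u \<in> E" "z = F_word \<tau> w u" "u' \<in> E" "z' = F_word \<tau> w u'"
          using zz' by (auto simp: Q_def)
        have "\<bar>z $ 1 - z' $ 1\<bar> = \<alpha> w * \<bar>u $ 1 - u' $ 1\<bar>"
          by (simp add: u F_word_components \<alpha>_def abs_mult[symmetric] right_diff_distrib)
        also have "\<dots> \<le> \<alpha> w * (2 * R)"
          using Rc[OF u(1), of 1] Rc[OF u(3), of 1] \<alpha>[of w] by (intro mult_left_mono) auto
        finally have "\<bar>z $ 1 - z' $ 1\<bar> \<le> \<alpha> w * (2 * R)" .
        moreover have "\<bar>z $ 2 - z' $ 2\<bar> \<le> \<alpha> w" using that by (auto simp: Q_def algebra_simps)
        ultimately show ?thesis using norm2_le[of "z - z'"] by (simp add: algebra_simps)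
      qed
      show "diameter (Q (w, k)) \<le> (2 * R + 1) * \<alpha> w"
        by (rule diameter_le) (use n R \<alpha>[of w] in \<open>auto intro: less_imp_le\<close>)
      show "bounded (Q (w, k))" unfolding bounded_two_points
        using n by (auto simp: dist_norm)
    qed
    have "E \<subseteq> (\<Union>i\<in>I. Q i)"
    proof
      fix z assume "z \<in> E"
      then obtain w u where w: "w \<in> words N" "u \<in> E" "z = F_word \<tau> w u" using subset_F_words[OF eE, of N] by blast
      have "\<bar>wb w * u $ 1\<bar> \<le> (K * \<zeta> w) * R" unfolding abs_mult \<zeta>_def
        by (intro mult_mono K Rc w) (use K in auto)
      moreover have "\<bar>wprod c w * u $ 2\<bar> \<le> \<zeta> w * R" unfolding abs_mult \<zeta>_def
        by (intro mult_left_mono Rc w) auto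
      moreover have "h * \<zeta> w = (K * \<zeta> w) * R + \<zeta> w * R" by (simp add: h_def algebra_simps)
      moreover have "z $ 2 - wy \<tau> w = wb w * u $ 1 + wprod c w * u $ 2" by (simp add: w F_word_components)
      ultimately have zb: "\<bar>z $ 2 - wy \<tau> w\<bar> \<le> h * \<zeta> w" by linarith
      define x where "x = (z $ 2 - (wy \<tau> w - h * \<zeta> w)) / \<alpha> w"
      define k where "k = nat \<lfloor>x\<rfloor>"
      have x: "0 \<le> x" "x \<le> 2 * (h * \<zeta> w) / \<alpha> w" using zb \<alpha>[of w] by (auto simp: x_def intro!: divide_right_mono)
      have "k \<le> m w" unfolding k_def m_def by (intro nat_mono floor_mono x)
      have k: "real k \<le> x" "x \<le> real (Suc k)" using x(1) by (simp_all add: k_def) linarith+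
      have xa: "x * \<alpha> w = z $ 2 - (wy \<tau> w - h * \<zeta> w)" using \<alpha>[of w] by (simp add: x_def)
      have "real k * \<alpha> w \<le> x * \<alpha> w" "x * \<alpha> w \<le> real (Suc k) * \<alpha> w"
        by (intro mult_right_mono k less_imp_le[OF \<alpha>])+
      then have "z \<in> Q (w, k)" using w xa by (auto simp: Q_def)
      then show "z \<in> (\<Union>i\<in>I. Q i)" using w(1) \<open>k \<le> m w\<close> by (intro UN_I[of "(w, k)"]) (auto simp: I_def)
    qed
    then have "hausdorff_premeasure s \<delta> E \<le> (\<Sum>i\<in>I. ennreal (diameter (Q i) powr s))"
    proof (rule hausdorff_premeasure_finite_cover[OF fI])
      fix i assume "i \<in> I"
      then obtain w k where wk: "i = (w, k)" "w \<in> words N" by (auto simp: I_def)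
      have "\<alpha> w \<le> 1 / 2 ^ N" using \<alpha>\<zeta>[of w] wprod_c_le[of w] wk by (simp add: \<zeta>_def words_def)
      then have "(2 * R + 1) * \<alpha> w \<le> (2 * R + 1) * (1 / 2 ^ N)" using R by (intro mult_left_mono) auto
      then show "bounded (Q i) \<and> diameter (Q i) \<le> \<delta>" using dQ[of w k] N wk by auto
    qed (use \<delta> in simp)
    also have "\<dots> = ennreal (\<Sum>i\<in>I. diameter (Q i) powr s)" by (simp add: sum_ennreal)
    also have "\<dots> \<le> ennreal C"
    proof (rule ennreal_leI)
      have "(\<Sum>i\<in>I. diameter (Q i) powr s) = (\<Sum>w\<in>words N. \<Sum>k\<in>{0..m w}. diameter (Q (w, k)) powr s)"
        unfolding I_def by (subst sum.Sigma) auto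
      also have "\<dots> \<le> (\<Sum>w\<in>words N. C * wprod p w)"
      proof (rule sum_mono)
        fix w :: "'n list"
        have "(\<Sum>k\<in>{0..m w}. diameter (Q (w, k)) powr s) \<le> real (card {0..m w}) * ((2 * R + 1) * \<alpha> w) powr s"
          using dQ s by (intro sum_bounded_above powr_mono2) (auto intro: diameter_ge_0)
        also have "\<dots> \<le> (2 * h + 1) * \<zeta> w / \<alpha> w * ((2 * R + 1) * \<alpha> w) powr s"
        proof (rule mult_right_mono)
          have "0 \<le> 2 * (h * \<zeta> w) / \<alpha> w" using h \<alpha>[of w] by (simp add: \<zeta>_def)
          then have "real (m w) \<le> 2 * (h * \<zeta> w) / \<alpha> w" unfolding m_def by simp
          \<comment> \<open>Since \<open>\<alpha> w \<le> \<zeta> w\<close>, the additional slab in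
            \<open>{0..m w}\<close> is absorbed by the summand 1 of
            \<open>2 * h + 1\<close>.\<close>
          moreover have "1 \<le> \<zeta> w / \<alpha> w" using \<alpha>[of w] \<alpha>\<zeta>[of w] by simp
          ultimately show "real (card {0..m w}) \<le> (2 * h + 1) * \<zeta> w / \<alpha> w"
            by (simp add: distrib_right add_divide_distrib mult.assoc)
        qed simp
        also have "\<dots> = C * (\<zeta> w * (\<alpha> w powr s / \<alpha> w))" using R \<alpha>[of w] by (simp add: C_def powr_mult)
        also have "\<alpha> w powr s / \<alpha> w = \<alpha> w powr (s - 1)" using \<alpha>[of w] by (simp add: powr_diff)
        finally show "(\<Sum>k\<in>{0..m w}. diameter (Q (w, k)) powr s) \<le> C * wprod p w"
          by (simp add: wprod_p \<alpha>_def \<zeta>_def)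
      qed
      also have "\<dots> = C" by (simp add: sum_distrib_left[symmetric] sum_wprod sum_p)
      finally show "(\<Sum>i\<in>I. diameter (Q i) powr s) \<le> C" .
    qed
    finally show ?thesis .
  qed
  then have "hausdorff_measure s E \<le> ennreal C" unfolding hausdorff_measure_def by (intro SUP_least) auto
  then show ?thesis using ennreal_less_top le_less_trans by fastforce
qed

end

section \<open>Positivity and finiteness for almost every translation vector\<close>

theorem proposition4p2:
  fixes a b c t1 :: "'n::finite \<Rightarrow> real" and s0 :: real
  assumes linear_parts: "affine_IFS_linear_parts (lin_part a b c)"
    and coeffs: "\<And>i. 0 < \<bar>a i\<bar> \<and> \<bar>a i\<bar> < \<bar>c i\<bar> \<and> \<bar>c i\<bar> < 1 / 2"
    and sum_c: "(\<Sum>i\<in>UNIV. \<bar>c i\<bar>) > 1"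
    and not_diag: "\<not> simultaneously_diagonalisable (lin_part a b c)"
    and sosc: "satisfies_SOSC (line_IFS a t1)"
    and s0_range: "1 < s0" "s0 \<le> 2"
    and s0_affinity_dim: "(\<Sum>i\<in>UNIV. \<bar>c i\<bar> * \<bar>a i\<bar> powr (s0 - 1)) = 1"
    and sum_lt_1: "(\<Sum>i\<in>UNIV. inverse \<bar>c i\<bar> * \<bar>a i\<bar> powr (2 * (s0 - 1))) < 1"
  shows "AE \<tau> in (lebesgue :: (real ^ 'n) measure).
           0 < hausdorff_measure s0 (attractor (planar_IFS a b c t1 \<tau>)) \<and>
           hausdorff_measure s0 (attractor (planar_IFS a b c t1 \<tau>)) < \<infinity>"
proof -
  interpret triangular_IFS a b c t1 s0
    by unfold_locales (use coeffs s0_range s0_affinity_dim sum_lt_1 in auto)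
  obtain U where U: "U \<noteq> {}" "open U" "\<And>i. line_IFS a t1 i ` U \<subseteq> U"
    "\<And>i j. i \<noteq> j \<Longrightarrow> line_IFS a t1 i ` U \<inter> line_IFS a t1 j ` U = {}"
    using sosc unfolding satisfies_SOSC_def strong_open_set_condition_def by metis
  obtain z where z: "z \<in> U" using U(1) by blast
  obtain K where K: "0 \<le> K" "\<And>u. \<bar>wb u\<bar> \<le> K * \<bar>wprod c u\<bar>" using wb_bound by blast
  \<comment> \<open>The largest operator norm is a common contraction ratio, independent of
    \<open>\<tau>\<close>, so \<open>attractor\<close> denotes the actual invariant set for every
    \<open>\<tau>\<close>.\<close>
  define L where "L = Max (range (\<lambda>i. onorm ((*v) (lin_part a b c i))))"
  have Li: "onorm ((*v) (lin_part a b c i)) \<le> L" for i by (simp add: L_def)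
  have L1: "L < 1" unfolding L_def
    by (subst Max_less_iff) (use linear_parts in \<open>auto simp: affine_IFS_linear_parts_def\<close>)
  have L0: "0 \<le> L" by (rule order_trans[OF onorm_pos_le Li[of undefined]]) (rule matrix_vector_mul_bounded_linear)
  have contr: "dist (planar_IFS a b c t1 \<tau> i x) (planar_IFS a b c t1 \<tau> i y) \<le> L * dist x y" for \<tau> i x y
  proof -
    have "dist (planar_IFS a b c t1 \<tau> i x) (planar_IFS a b c t1 \<tau> i y) = norm (lin_part a b c i *v (x - y))"
      by (simp add: planar_IFS_def dist_norm matrix_vector_mult_diff_distrib)
    also have "\<dots> \<le> onorm ((*v) (lin_part a b c i)) * norm (x - y)"
      by (rule onorm) (rule matrix_vector_mul_bounded_linear)
    also have "\<dots> \<le> L * dist x y" unfolding dist_norm by (intro mult_right_mono Li) simp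
    finally show ?thesis .
  qed
  \<comment> \<open>Strips pulled back along cylinders have slopes at most \<open>K\<close>; the
    extra 1 is the margin built into \<open>thin_strips\<close>.\<close>
  have "AE \<tau> in lborel. thin_strips \<tau> (K + 1)" by (rule AE_thin_strips)
  then have "AE \<tau> in lborel. 0 < hausdorff_measure s0 (attractor (planar_IFS a b c t1 \<tau>)) \<and>
     hausdorff_measure s0 (attractor (planar_IFS a b c t1 \<tau>)) < \<infinity>"
  proof (rule AE_mp, intro AE_I2 impI conjI)
    fix \<tau> :: "real ^ 'n" assume ts: "thin_strips \<tau> (K + 1)"
    have att: "is_attractor (planar_IFS a b c t1 \<tau>) (attractor (planar_IFS a b c t1 \<tau>))"
      by (rule is_attractor_attractor[OF L0 L1 contr])
    show "0 < hausdorff_measure s0 (attractor (planar_IFS a b c t1 \<tau>))"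
      by (rule hausdorff_measure_pos[OF att square_mass_le[OF U(2) z U(3,4) K(2) ts]])
    show "hausdorff_measure s0 (attractor (planar_IFS a b c t1 \<tau>)) < \<infinity>"
      by (rule hausdorff_measure_finite[OF att])
  qed
  then show ?thesis by (rule AE_completion)
qed

end
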